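(* Let $G$ be a finite group and $s\ge 1$ an integer, and suppose that $\mathrm{Pol}_s(G)$ is amenable. Then $G$ is weakly $P_s$-stable if and only if $\mathrm{Pol}_s(G)$ is residually finite.
   Context: For groups $G,H$, a map $f:G\to H$ and $g\in G$, define $\partial_g f:G\to H$ by $(\partial_g f)(x)=f(gx)f(x)^{-1}$, and put $\partial_{g_1,\ldots,g_k}f=\partial_{g_1}(\partial_{g_2}(\cdots\partial_{g_k}f))$. The map $f$ is polynomial of degree $\le s$ if $(\partial_{g_1,\ldots,g_{s+1}}f)(x)=1$ for all $x,g_1,\ldots,g_{s+1}\in G$; it is unital if $f(1)=1$. Universal polynomial group: let $F_G$ be the free group on the symbols $\{x_g : g\in G\setminus\{1\}\}$, set $x_1=1$, and let $\iota:G\to F_G$, $\iota(g)=x_g$. Let $R_s(G)$ be the normal closure in $F_G$ of all elements $(\partial_{g_1,\ldots,g_{s+1}}\iota)(1)$, $g_1,\ldots,g_{s+1}\in G$. Then $\mathrm{Pol}_s(G)=F_G/R_s(G)$. $\mathrm{Sym}(m)$ carries the normalized Hamming distance $d_m(\sigma,\tau)=1-\frac1m|\mathrm{Fix}(\sigma^{-1}\tau)|$. Weak $P_s$-stability ($G$ finite): for a unital map $f:G\to\mathrm{Sym}(m)$ let $\widehat f:F_G\to\mathrm{Sym}(m)$ be the homomorphism with $\widehat f(x_g)=f(g)$ for all $g\in G$. Let $\ell$ be the word length on $F_G$ with respect to $\{x_g\}$. For $\delta>0$, $f$ is a $\delta$-strong polynomial approximation of degree at most $s$ if for every $w\in F_G$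 with $\ell(w)<1/\delta$: $w\in R_s(G)$ implies $d_m(\widehat f(w),1)<\delta$, and $w\notin R_s(G)$ implies $d_m(\widehat f(w),1)>1-\delta$. $G$ is weakly $P_s$-stable if for every $\varepsilon>0$ there is $\delta>0$ such that for every $m$ and every $\delta$-strong polynomial approximation $f:G\to\mathrm{Sym}(m)$ of degree at most $s$ there is a unital polynomial map $q:G\to\mathrm{Sym}(m)$ of degree $\le s$ with $\max_{g\in G}d_m(f(g),q(g))<\varepsilon$. *)

theory Defs
  imports Complex_Main "HOL-Algebra.Sym_Groups"
begin

section \<open>Groups given by generators\<close>

definition normal_closure :: "('a, 'b) monoid_scheme \<Rightarrow> 'a set \<Rightarrow> 'a set" where
  "normal_closure G A = \<Inter> {N. N \<lhd> G \<and> A \<subseteq> N}"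

lemma normal_closure_normal:
  assumes "group G" "A \<subseteq> carrier G"
  shows "normal_closure G A \<lhd> G"
proof -
  interpret group G by fact
  let ?\<N> = "{N. N \<lhd> G \<and> A \<subseteq> N}"
  have "carrier G \<in> ?\<N>"
    using assms(2) by (auto simp: normal_inv_iff subgroup_self)
  then show ?thesis
    unfolding normal_closure_def
    by (subst normal_inv_iff)
       (auto intro!: subgroups_Inter simp: normal_imp_subgroup normal.inv_op_closed2)
qed

definition word_length :: "('a, 'b) monoid_scheme \<Rightarrow> 'a set \<Rightarrow> 'a \<Rightarrow> nat" where
  "word_length G A x =
     (LEAST n. \<exists>as. length as = n \<and> set as \<subseteq> A \<union> m_inv G ` A
                  \<and> foldr (mult G) as \<one>\<^bsub>G\<^esub> = x)"

section \<open>Free groups\<close>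

text \<open>The elements of the free group on a set are the reduced words in it; \<open>(x, True)\<close> stands
  for the generator \<open>x\<close> and \<open>(x, False)\<close> for its inverse.\<close>

type_synonym 'a word = "('a \<times> bool) list"

definition inv_letter :: "'a \<times> bool \<Rightarrow> 'a \<times> bool" where
  "inv_letter a = (fst a, \<not> snd a)"

definition reduced :: "'a word \<Rightarrow> bool" where
  "reduced = successively (\<lambda>a b. b \<noteq> inv_letter a)"

definition cons_red :: "'a \<times> bool \<Rightarrow> 'a word \<Rightarrow> 'a word" where
  "cons_red a w = (case w of [] \<Rightarrow> [a] | b # v \<Rightarrow> if b = inv_letter a then v else a # w)"

text \<open>For reduced \<open>v\<close>, the word \<open>foldr cons_red u v\<close> is the reduced form of \<open>u @ v\<close>.\<close>

definition free_group :: "'a set \<Rightarrow> 'a word monoid" where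
  "free_group S =
     \<lparr>carrier = {w. reduced w \<and> fst ` set w \<subseteq> S}, mult = foldr cons_red, one = []\<rparr>"

definition free_lift :: "('h, 'b) monoid_scheme \<Rightarrow> ('a \<Rightarrow> 'h) \<Rightarrow> 'a word \<Rightarrow> 'h" where
  "free_lift H f w =
     foldr (\<lambda>(x, b) h. (if b then f x else inv\<^bsub>H\<^esub> f x) \<otimes>\<^bsub>H\<^esub> h) w \<one>\<^bsub>H\<^esub>"

lemma inv_letter_simps [simp]:
  "inv_letter (inv_letter a) = a" "fst (inv_letter a) = fst a" "inv_letter a \<noteq> a"
  by (auto simp: inv_letter_def prod_eq_iff)

lemma reduced_simps [simp]:
  "reduced []" "reduced [a]" "reduced (a # b # w) \<longleftrightarrow> b \<noteq> inv_letter a \<and> reduced (b # w)"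
  by (auto simp: reduced_def)

lemma reduced_ConsD: "reduced (a # w) \<Longrightarrow> reduced w"
  by (cases w) auto

lemma reduced_cons_red: "reduced w \<Longrightarrow> reduced (cons_red a w)"
  by (cases w) (auto simp: cons_red_def dest: reduced_ConsD)

lemma reduced_foldr: "reduced v \<Longrightarrow> reduced (foldr cons_red u v)"
  by (induction u) (auto intro: reduced_cons_red)

lemma set_cons_red: "set (cons_red a w) \<subseteq> insert a (set w)"
  by (auto simp: cons_red_def split: list.splits if_splits)

lemma set_foldr: "set (foldr cons_red u v) \<subseteq> set u \<union> set v"
  by (induction u) (use set_cons_red in fastforce)+

lemma cons_red_cancel:
  assumes "reduced w"
  shows "cons_red a (cons_red (inv_letter a) w) = w"
proof (cases w)
  case (Cons b v)
  with assms show ?thesis by (cases v) (auto simp: cons_red_def)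
qed (auto simp: cons_red_def)

lemma foldr_cons_red:
  assumes "reduced v"
  shows "foldr cons_red (cons_red a u) v = cons_red a (foldr cons_red u v)"
  using cons_red_cancel[OF reduced_foldr[OF assms]]
  by (auto simp: cons_red_def[of a u] split: list.splits)

lemma foldr_assoc:
  assumes "reduced w"
  shows "foldr cons_red (foldr cons_red u v) w = foldr cons_red u (foldr cons_red v w)"
  by (induction u) (auto simp: foldr_cons_red assms)

lemma cons_red_reduced: "reduced (a # w) \<Longrightarrow> cons_red a w = a # w"
  by (cases w) (auto simp: cons_red_def)

lemma foldr_reduced_Nil: "reduced w \<Longrightarrow> foldr cons_red w [] = w"
proof (induction w)
  case (Cons a w)
  then show ?case using reduced_ConsD[of a w] by (simp add: cons_red_reduced)
qed simp

lemma foldr_inverse: "foldr cons_red (rev (map inv_letter w)) w = []"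
  by (induction w) (auto simp: cons_red_def)

lemma free_group_group: "group (free_group S)"
proof (rule groupI, goal_cases)
  case (1 x y)
  then show ?case using set_foldr[of x y] by (fastforce simp: free_group_def reduced_foldr)
next
  case (5 x)
  let ?y = "foldr cons_red (rev (map inv_letter x)) []"
  have "?y \<in> carrier (free_group S)"
    using 5 set_foldr[of "rev (map inv_letter x)" "[]"]
    by (fastforce simp: free_group_def reduced_foldr)
  moreover have "foldr cons_red ?y x = []"
    using 5 by (subst foldr_assoc) (auto simp: free_group_def foldr_inverse)
  ultimately show ?case by (auto simp: free_group_def)
qed (auto simp: free_group_def foldr_assoc)

lemma free_lift_hom:
  assumes "group H" "f \<in> S \<rightarrow> carrier H"
  shows "free_lift H f \<in> hom (free_group S) H"
proof -
  interpret H: group H by fact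
  have closed: "free_lift H f w \<in> carrier H" if "fst ` set w \<subseteq> S" for w
    using that assms(2) by (induction w) (auto simp: free_lift_def Pi_iff)
  have cons: "free_lift H f (cons_red a w) = free_lift H f (a # w)"
    if "fst a \<in> S" "fst ` set w \<subseteq> S" for a w
  proof (cases "\<exists>v. w = inv_letter a # v")
    case True
    then obtain v where v: "w = inv_letter a # v" by blast
    have "f (fst a) \<in> carrier H" "free_lift H f v \<in> carrier H"
      using that assms(2) closed[of v] v by auto
    then show ?thesis
      unfolding v by (cases "snd a")
        (auto simp: cons_red_def free_lift_def inv_letter_def case_prod_beta
            H.inv_solve_left H.inv_solve_right H.m_assoc[symmetric])
  qed (auto simp: cons_red_def split: list.splits)
  have "free_lift H f (foldr cons_red u v) = free_lift H f u \<otimes>\<^bsub>H\<^esub> free_lift H f v"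
    if "fst ` set u \<subseteq> S" "fst ` set v \<subseteq> S" for u v
    using that(1)
  proof (induction u)
    case Nil
    then show ?case using closed[OF that(2)] by (simp add: free_lift_def)
  next
    case (Cons a u)
    have *: "fst ` set (foldr cons_red u v) \<subseteq> S"
      using set_foldr[of u v] Cons.prems that(2) by fastforce
    have "(if snd a then f (fst a) else inv\<^bsub>H\<^esub> f (fst a)) \<in> carrier H"
      using Cons.prems assms(2) by auto
    moreover have "free_lift H f (x # w) =
        (if snd x then f (fst x) else inv\<^bsub>H\<^esub> f (fst x)) \<otimes>\<^bsub>H\<^esub> free_lift H f w" for x w
      by (simp add: free_lift_def case_prod_beta)
    ultimately show ?case
      using Cons cons[OF _ *, of a] closed[OF that(2)] closed[of u] by (simp add: H.m_assoc)
  qed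
  with closed show ?thesis by (auto simp: hom_def free_group_def)
qed

section \<open>Polynomial maps between groups\<close>

definition deriv_at ::
  "('a, 'b) monoid_scheme \<Rightarrow> ('h, 'c) monoid_scheme \<Rightarrow> 'a \<Rightarrow> ('a \<Rightarrow> 'h) \<Rightarrow> 'a \<Rightarrow> 'h" where
  "deriv_at G H g f = (\<lambda>x. f (g \<otimes>\<^bsub>G\<^esub> x) \<otimes>\<^bsub>H\<^esub> inv\<^bsub>H\<^esub> f x)"

definition iter_deriv ::
  "('a, 'b) monoid_scheme \<Rightarrow> ('h, 'c) monoid_scheme \<Rightarrow> 'a list \<Rightarrow> ('a \<Rightarrow> 'h) \<Rightarrow> 'a \<Rightarrow> 'h" where
  "iter_deriv G H gs f = foldr (deriv_at G H) gs f"

definition unital_map ::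
  "('a, 'b) monoid_scheme \<Rightarrow> ('h, 'c) monoid_scheme \<Rightarrow> ('a \<Rightarrow> 'h) \<Rightarrow> bool" where
  "unital_map G H f \<longleftrightarrow> f \<in> carrier G \<rightarrow> carrier H \<and> f \<one>\<^bsub>G\<^esub> = \<one>\<^bsub>H\<^esub>"

definition polynomial_map ::
  "nat \<Rightarrow> ('a, 'b) monoid_scheme \<Rightarrow> ('h, 'c) monoid_scheme \<Rightarrow> ('a \<Rightarrow> 'h) \<Rightarrow> bool" where
  "polynomial_map s G H f \<longleftrightarrow>
     f \<in> carrier G \<rightarrow> carrier H \<and>
     (\<forall>gs x. set gs \<subseteq> carrier G \<and> length gs = s + 1 \<and> x \<in> carrier G
        \<longrightarrow> iter_deriv G H gs f x = \<one>\<^bsub>H\<^esub>)"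

section \<open>The universal polynomial group\<close>

definition F_grp :: "('a, 'b) monoid_scheme \<Rightarrow> 'a word monoid" where
  "F_grp G = free_group (carrier G - {\<one>\<^bsub>G\<^esub>})"

definition iota :: "('a, 'b) monoid_scheme \<Rightarrow> 'a \<Rightarrow> 'a word" where
  "iota G g = (if g = \<one>\<^bsub>G\<^esub> then [] else [(g, True)])"

definition R_sub :: "nat \<Rightarrow> ('a, 'b) monoid_scheme \<Rightarrow> 'a word set" where
  "R_sub s G = normal_closure (F_grp G)
     {iter_deriv G (F_grp G) gs (iota G) \<one>\<^bsub>G\<^esub> | gs. set gs \<subseteq> carrier G \<and> length gs = s + 1}"

definition Pol :: "nat \<Rightarrow> ('a, 'b) monoid_scheme \<Rightarrow> 'a word set monoid" where
  "Pol s G = F_grp G Mod R_sub s G"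

lemma F_grp_group: "group (F_grp G)"
  by (simp add: F_grp_def free_group_group)

lemma iota_closed: "iota G \<in> carrier G \<rightarrow> carrier (F_grp G)"
  by (auto simp: iota_def F_grp_def free_group_def)

lemma inv_iota:
  assumes "g \<in> carrier G"
  shows "inv\<^bsub>F_grp G\<^esub> iota G g = (if g = \<one>\<^bsub>G\<^esub> then [] else [(g, False)])"
  using assms
  by (intro group.inv_equality[OF F_grp_group])
     (auto simp: iota_def F_grp_def free_group_def cons_red_def inv_letter_def)

lemma word_length_F_grp:
  assumes "w \<in> carrier (F_grp G)"
  shows "word_length (F_grp G) (iota G ` carrier G) w = length w"
  unfolding word_length_def
proof (rule Least_equality, goal_cases)
  case 1
  let ?as = "map (\<lambda>a. [a]) w"
  have "[(g, b)] \<in> iota G ` carrier G \<union> m_inv (F_grp G) ` iota G ` carrier G"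
    if "(g, b) \<in> set w" for g b
  proof -
    have g: "g \<in> carrier G" "g \<noteq> \<one>\<^bsub>G\<^esub>"
      using assms that by (auto simp: F_grp_def free_group_def)
    show ?thesis
    proof (cases b)
      case True
      with g have "[(g, b)] = iota G g" by (simp add: iota_def)
      with g show ?thesis by blast
    next
      case False
      with g have "[(g, b)] = inv\<^bsub>F_grp G\<^esub> iota G g" by (simp add: inv_iota)
      with g show ?thesis by blast
    qed
  qed
  then have "set ?as \<subseteq> iota G ` carrier G \<union> m_inv (F_grp G) ` iota G ` carrier G"
    by auto
  moreover have "foldr (mult (F_grp G)) (map (\<lambda>a. [a]) v) \<one>\<^bsub>F_grp G\<^esub> = foldr cons_red v []" for v
    by (induction v) (auto simp: F_grp_def free_group_def)
  ultimately show ?case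
    using assms by (intro exI[of _ ?as]) (auto simp: F_grp_def free_group_def foldr_reduced_Nil)
next
  case (2 n)
  then obtain as where as: "length as = n" "foldr (mult (F_grp G)) as \<one>\<^bsub>F_grp G\<^esub> = w"
    "set as \<subseteq> iota G ` carrier G \<union> m_inv (F_grp G) ` iota G ` carrier G" by blast
  have cons: "length (cons_red a v) \<le> Suc (length v)" for a :: "'a \<times> bool" and v
    by (auto simp: cons_red_def split: list.splits)
  have "length (foldr (mult (F_grp G)) as \<one>\<^bsub>F_grp G\<^esub>) \<le> length as"
    using as(3)
  proof (induction as)
    case (Cons a as)
    then have "a = [] \<or> (\<exists>x. a = [x])"
      by (auto simp: inv_iota) (auto simp: iota_def split: if_splits)
    moreover have "length (foldr (mult (F_grp G)) as \<one>\<^bsub>F_grp G\<^esub>) \<le> length as"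
      using Cons by simp
    moreover have "mult (F_grp G) = foldr cons_red"
      by (simp add: F_grp_def free_group_def)
    ultimately show ?case
      by (elim disjE exE) (simp_all add: order_trans[OF cons])
  qed (simp add: F_grp_def free_group_def)
  with as show ?case by simp
qed

lemma iter_deriv_closed:
  assumes "group G" "group H" "f \<in> carrier G \<rightarrow> carrier H" "set gs \<subseteq> carrier G"
  shows "iter_deriv G H gs f \<in> carrier G \<rightarrow> carrier H"
proof -
  interpret G: group G by fact
  interpret H: group H by fact
  show ?thesis
    using assms(4)
  proof (induction gs)
    case (Cons g gs)
    have "deriv_at G H g h \<in> carrier G \<rightarrow> carrier H"
      if "h \<in> carrier G \<rightarrow> carrier H" for h
      using that Cons.prems by (auto simp: deriv_at_def Pi_iff)
    with Cons show ?case by (simp add: iter_deriv_def)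
  qed (use assms(3) in \<open>simp add: iter_deriv_def\<close>)
qed

lemma R_sub_normal:
  assumes "group G"
  shows "R_sub s G \<lhd> F_grp G"
  unfolding R_sub_def
proof (rule normal_closure_normal[OF F_grp_group], safe)
  fix gs assume "set gs \<subseteq> carrier G"
  then show "iter_deriv G (F_grp G) gs (iota G) \<one>\<^bsub>G\<^esub> \<in> carrier (F_grp G)"
    using iter_deriv_closed[OF assms F_grp_group iota_closed] group.is_monoid[OF assms]
    by (fastforce simp: Pi_iff monoid.one_closed)
qed

lemma Pol_group: "group G \<Longrightarrow> group (Pol s G)"
  by (simp add: Pol_def R_sub_normal normal.factorgroup_is_group)

lemma free_lift_iota:
  assumes "group H" "unital_map G H f" "g \<in> carrier G"
  shows "free_lift H f (iota G g) = f g"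
proof -
  interpret H: group H by fact
  show ?thesis
    using assms(2,3) by (auto simp: free_lift_def iota_def unital_map_def Pi_iff)
qed

section \<open>Amenability and residual finiteness\<close>

text \<open>A discrete group is amenable if it carries a left-invariant, finitely additive probability
  measure defined on all of its subsets.\<close>

definition amenable :: "('a, 'b) monoid_scheme \<Rightarrow> bool" where
  "amenable G \<longleftrightarrow>
     (\<exists>\<mu> :: 'a set \<Rightarrow> real.
        (\<forall>A. A \<subseteq> carrier G \<longrightarrow> 0 \<le> \<mu> A) \<and>
        \<mu> (carrier G) = 1 \<and>
        (\<forall>A B. A \<subseteq> carrier G \<and> B \<subseteq> carrier G \<and> A \<inter> B = {} \<longrightarrow> \<mu> (A \<union> B) = \<mu> A + \<mu> B) \<and>
        (\<forall>g A. g \<in> carrier G \<and> A \<subseteq> carrier G \<longrightarrow> \<mu> (g <#\<^bsub>G\<^esub> A) = \<mu> A))"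

definition residually_finite :: "('a, 'b) monoid_scheme \<Rightarrow> bool" where
  "residually_finite G \<longleftrightarrow>
     (\<forall>g \<in> carrier G - {\<one>\<^bsub>G\<^esub>}. \<exists>N. N \<lhd> G \<and> finite (carrier (G Mod N)) \<and> g \<notin> N)"

section \<open>Weak stability\<close>

definition hamming :: "nat \<Rightarrow> (nat \<Rightarrow> nat) \<Rightarrow> (nat \<Rightarrow> nat) \<Rightarrow> real" where
  "hamming m \<sigma> \<tau> =
     1 - real (card {i \<in> {1..m}. (inv\<^bsub>sym_group m\<^esub> \<sigma> \<otimes>\<^bsub>sym_group m\<^esub> \<tau>) i = i}) / real m"

definition strong_poly_approx ::
  "nat \<Rightarrow> ('a, 'b) monoid_scheme \<Rightarrow> real \<Rightarrow> nat \<Rightarrow> ('a \<Rightarrow> nat \<Rightarrow> nat) \<Rightarrow> bool" where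
  "strong_poly_approx s G \<delta> m f \<longleftrightarrow>
     unital_map G (sym_group m) f \<and>
     (\<forall>w \<in> carrier (F_grp G).
        real (word_length (F_grp G) (iota G ` carrier G) w) < 1 / \<delta> \<longrightarrow>
          (w \<in> R_sub s G \<longrightarrow> hamming m (free_lift (sym_group m) f w) \<one>\<^bsub>sym_group m\<^esub> < \<delta>) \<and>
          (w \<notin> R_sub s G \<longrightarrow> hamming m (free_lift (sym_group m) f w) \<one>\<^bsub>sym_group m\<^esub> > 1 - \<delta>))"

text \<open>The normalized Hamming distance is a metric on \<open>Sym(m)\<close> only for \<open>m \<ge> 1\<close>.\<close>

definition weakly_P_stable :: "nat \<Rightarrow> ('a, 'b) monoid_scheme \<Rightarrow> bool" where
  "weakly_P_stable s G \<longleftrightarrow>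
     (\<forall>\<epsilon>>0. \<exists>\<delta>>0. \<forall>m\<ge>1. \<forall>f. strong_poly_approx s G \<delta> m f \<longrightarrow>
        (\<exists>q. unital_map G (sym_group m) q \<and> polynomial_map s G (sym_group m) q \<and>
             (MAX g \<in> carrier G. hamming m (f g) (q g)) < \<epsilon>))"

end

theory Submission
  imports Defs
begin

text \<open>A unital map is polynomial of degree \<open>\<le> s\<close> iff its extension to the free group kills
  \<open>R_sub s G\<close>, so the claim is that the amenable group \<open>\<Gamma> = Pol s G\<close> is weakly stable in
  permutations iff it is residually finite. If \<open>\<Gamma>\<close> is stable, the almost actions on its Folner
  sets are close to actions on finite sets, and these separate the points of \<open>\<Gamma>\<close>. Conversely, if
  \<open>\<Gamma>\<close> is residually finite, then it has arbitrarily invariant Folner sets that are transversals of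
  finite quotients, and such a set carries a genuine action of \<open>\<Gamma>\<close> that agrees with left
  translation away from the boundary. By the Ornstein-Weiss argument every good approximate action
  is almost covered by almost disjoint copies of finitely many of these sets; replacing each copy by
  its genuine action gives an action of \<open>\<Gamma>\<close> close to the given approximate one.\<close>

section \<open>The marriage theorem\<close>

text \<open>Two obstacles shape the converse. Approximate translates overlap, while
  \<open>Sym(m)\<close> has exactly \<open>m\<close> points. So each tile records a part
  \<open>P\<close>, the parts being disjoint, and whole shapes are put back only up to total size
  \<open>m\<close>; little is lost because \<open>P\<close> has at least the fraction
  \<open>1 - \<epsilon>\<close> of its shape. A single shape is only sure to cover about a fraction
  \<open>\<epsilon>\<close> of what is left, so up to \<open>n\<close> shapes are used, those placed
  earlier being nearly invariant under the inverses of those placed later, until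
  \<open>(1 - \<epsilon>) ^ n\<close> is negligible. If \<open>m\<close> is so small that one tile
  matters, \<open>\<delta>\<close> forces the given map to be polynomial already. The bound on words
  outside \<open>R_sub s G\<close> makes the approximate action free at most points, so that tiles
  are faithful copies of subsets of \<open>\<Gamma>\<close>. The transversals come from Weiss's
  argument: a Folner set is embedded in a finite quotient, the quotient is cut along translates of
  its image, and the pieces are lifted one by one to a section. Folner sets come from the invariant
  mean by a doubling argument, which needs marriage for infinite index sets.\<close>

text \<open>Rado's argument: in a minimal subrelation satisfying Hall's condition every fibre is a
  singleton, by submodularity of cardinality.\<close>

theorem marriage:
  fixes A :: "'i \<Rightarrow> 'a set"
  assumes fin: "\<And>i. i \<in> I \<Longrightarrow> finite (A i)"
    and hall: "\<And>J. finite J \<Longrightarrow> J \<subseteq> I \<Longrightarrow> card J \<le> card (\<Union>i\<in>J. A i)"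
  shows "\<exists>\<phi>. inj_on \<phi> I \<and> (\<forall>i\<in>I. \<phi> i \<in> A i)"
proof -
  define R where "R = Sigma I A"
  define Hall where "Hall B \<longleftrightarrow> (\<forall>J. finite J \<and> J \<subseteq> I \<longrightarrow> card J \<le> card (B `` J))" for B :: "('i \<times> 'a) set"
  \<comment> \<open>A minimal subrelation is sought as a maximal set of deleted edges, so that
    unions of chains serve as upper bounds in Zorn's lemma.\<close>
  define \<D> where "\<D> = {D. D \<subseteq> R \<and> Hall (R - D)}"
  have fR: "finite (R \<inter> J \<times> UNIV)" if "finite J" "J \<subseteq> I" for J
  proof -
    have "R \<inter> J \<times> UNIV = Sigma J A" using that by (auto simp: R_def)
    then show ?thesis using that fin by (auto intro!: finite_SigmaI)
  qed
  have fI: "finite (B `` J)" if "finite J" "J \<subseteq> I" "B \<subseteq> R" for B J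
  proof -
    have "B `` J \<subseteq> snd ` (R \<inter> J \<times> UNIV)" using that by force
    then show ?thesis using fR[OF that(1,2)] finite_subset by blast
  qed
  have "\<exists>M\<in>\<D>. \<forall>X\<in>\<D>. M \<subseteq> X \<longrightarrow> X = M"
  proof (rule subset_Zorn_nonempty)
    have "R `` J = (\<Union>i\<in>J. A i)" if "J \<subseteq> I" for J using that by (auto simp: R_def)
    then show "\<D> \<noteq> {}" using hall by (auto simp: \<D>_def Hall_def intro!: exI[of _ "{}"])
  next
    fix \<C> assume ne: "\<C> \<noteq> {}" and ch: "subset.chain \<D> \<C>"
    have sub: "\<C> \<subseteq> \<D>" using ch by (simp add: subset.chain_def)
    have "card J \<le> card ((R - \<Union>\<C>) `` J)" if J: "finite J" "J \<subseteq> I" for J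
    proof -
      \<comment> \<open>Only finitely many edges lie over a finite \<open>J\<close>, so one member
        of the chain already contains all those deleted there.\<close>
      have "finite (\<Union>\<C> \<inter> J \<times> UNIV)"
        by (rule finite_subset[OF _ fR[OF J]]) (use sub in \<open>auto simp: \<D>_def\<close>)
      then obtain D where D: "D \<in> \<C>" "\<Union>\<C> \<inter> J \<times> UNIV \<subseteq> D"
        using finite_subset_Union_chain[of "\<Union>\<C> \<inter> J \<times> UNIV" \<C> \<D>] ne ch by blast
      have "(R - \<Union>\<C>) `` J = (R - D) `` J" using D by fast
      then show ?thesis using D sub J by (auto simp: \<D>_def Hall_def)
    qed
    then show "\<Union>\<C> \<in> \<D>" using sub by (auto simp: \<D>_def Hall_def)
  qed
  then obtain D where D: "D \<in> \<D>" and max: "\<And>X. X \<in> \<D> \<Longrightarrow> D \<subseteq> X \<Longrightarrow> X = D" by blast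
  define B where "B = R - D"
  have BR: "B \<subseteq> R" and HB: "\<And>J. finite J \<Longrightarrow> J \<subseteq> I \<Longrightarrow> card J \<le> card (B `` J)"
    using D by (auto simp: B_def \<D>_def Hall_def)
  \<comment> \<open>By maximality no further edge can be deleted. A set violating Hall's condition
    after deleting \<open>(i, x)\<close> must contain \<open>i\<close>; taking \<open>i\<close> out
    turns its strict inequality into a weak one.\<close>
  have defect: "\<exists>J. finite J \<and> J \<subseteq> I \<and> i \<notin> J \<and> card (B `` J \<union> (B `` {i} - {x})) \<le> card J"
    if ix: "(i, x) \<in> B" for i x
  proof -
    have "insert (i, x) D \<notin> \<D>" using max[of "insert (i, x) D"] ix by (auto simp: B_def)
    moreover have "insert (i, x) D \<subseteq> R" "R - insert (i, x) D = B - {(i, x)}"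
      using D ix by (auto simp: \<D>_def B_def)
    ultimately have "\<not> Hall (B - {(i, x)})" by (simp add: \<D>_def)
    then obtain J where J: "finite J" "J \<subseteq> I" "card ((B - {(i, x)}) `` J) < card J"
      by (auto simp: Hall_def not_le)
    have i: "i \<in> J"
    proof (rule ccontr)
      assume "i \<notin> J"
      then have "(B - {(i, x)}) `` J = B `` J" by auto
      then show False using HB[OF J(1,2)] J(3) by simp
    qed
    have "B `` (J - {i}) \<union> (B `` {i} - {x}) = (B - {(i, x)}) `` J" using i by auto
    then show ?thesis using J i by (intro exI[of _ "J - {i}"]) auto
  qed
  have single: "x = y" if xy: "(i, x) \<in> B" "(i, y) \<in> B" for i x y
  proof (rule ccontr)
    assume neq: "x \<noteq> y"
    obtain J where J: "finite J" "J \<subseteq> I" "i \<notin> J" "card (B `` J \<union> (B `` {i} - {x})) \<le> card J"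
      using defect[OF xy(1)] by blast
    obtain K where K: "finite K" "K \<subseteq> I" "i \<notin> K" "card (B `` K \<union> (B `` {i} - {y})) \<le> card K"
      using defect[OF xy(2)] by blast
    let ?U = "B `` J \<union> (B `` {i} - {x})" and ?V = "B `` K \<union> (B `` {i} - {y})"
    have iI: "i \<in> I" using xy BR by (auto simp: R_def)
    have fU: "finite ?U" "finite ?V" using fI J K BR iI by (auto intro!: finite_Diff)
    \<comment> \<open>Since \<open>x\<close> and \<open>y\<close> differ, the two fibres with one
      point removed still unite to the whole fibre of \<open>i\<close>. This gains the extra element
      \<open>i\<close> that contradicts submodularity.\<close>
    have "B `` (insert i (J \<union> K)) \<subseteq> ?U \<union> ?V" using neq by auto
    then have "card (insert i (J \<union> K)) \<le> card (?U \<union> ?V)"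
      using HB[of "insert i (J \<union> K)"] J K iI fU
      by (meson card_mono finite_Un finite_insert insert_subset le_trans Un_least)
    moreover have "B `` (J \<inter> K) \<subseteq> ?U \<inter> ?V" by auto
    then have "card (J \<inter> K) \<le> card (?U \<inter> ?V)"
      using HB[of "J \<inter> K"] J K fU by (meson card_mono finite_Int inf.coboundedI1 le_trans)
    moreover have "card ?U + card ?V = card (?U \<union> ?V) + card (?U \<inter> ?V)"
      using fU by (rule card_Un_Int)
    moreover have "card J + card K = card (J \<union> K) + card (J \<inter> K)"
      using J K by (intro card_Un_Int)
    ultimately show False using J K by simp
  qed
  have ex: "\<exists>x. (i, x) \<in> B" if "i \<in> I" for i
    using HB[of "{i}"] that by (cases "B `` {i} = {}") auto
  define \<phi> where "\<phi> i = (SOME x. (i, x) \<in> B)" for i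
  have \<phi>: "(i, \<phi> i) \<in> B" if "i \<in> I" for i
    unfolding \<phi>_def using ex[OF that] by (rule someI_ex)
  have "i = j" if ij: "i \<in> I" "j \<in> I" "\<phi> i = \<phi> j" for i j
  proof (rule ccontr)
    assume "i \<noteq> j"
    moreover have "B `` {k} = {\<phi> k}" if "k \<in> I" for k using \<phi>[OF that] single by blast
    then have "B `` {i, j} = {\<phi> i}" using ij by (metis Image_Un Un_absorb insert_is_Un)
    ultimately show False using HB[of "{i, j}"] ij by simp
  qed
  then show ?thesis using \<phi> BR by (intro exI[of _ \<phi>]) (auto simp: inj_on_def R_def)
qed

section \<open>Folner sets\<close>

text \<open>Only the outer boundary under left multiplication is counted. As left translations are
  injective, it also bounds, for each \<open>k\<close> in \<open>K\<close>, the number of points of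
  \<open>S\<close> that \<open>k\<close> moves out of \<open>S\<close>.\<close>

definition folner :: "('a, 'b) monoid_scheme \<Rightarrow> 'a set \<Rightarrow> real \<Rightarrow> 'a set \<Rightarrow> bool" where
  "folner G K e S \<longleftrightarrow> S \<subseteq> carrier G \<and> finite S \<and> S \<noteq> {} \<and>
     real (card ((K <#>\<^bsub>G\<^esub> S) - S)) \<le> e * real (card S)"

lemma finite_set_mult: "finite A \<Longrightarrow> finite B \<Longrightarrow> finite (A <#>\<^bsub>G\<^esub> B)"
  by (auto simp: set_mult_def)

lemma folner_mono:
  assumes "folner G K e S" "finite K" "K' \<subseteq> K" "e \<le> e'"
  shows "folner G K' e' S"
proof -
  have "card ((K' <#>\<^bsub>G\<^esub> S) - S) \<le> card ((K <#>\<^bsub>G\<^esub> S) - S)"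
    using assms by (intro card_mono finite_Diff finite_set_mult) (auto simp: folner_def set_mult_def)
  also have "real \<dots> \<le> e * real (card S)" using assms by (simp add: folner_def)
  also have "\<dots> \<le> e' * real (card S)" using assms by (intro mult_right_mono) auto
  finally show ?thesis using assms by (simp add: folner_def)
qed

context group
begin

lemma finite_additive_sum:
  fixes \<mu> :: "'a set \<Rightarrow> real"
  assumes add: "\<And>A B. A \<subseteq> carrier G \<Longrightarrow> B \<subseteq> carrier G \<Longrightarrow> A \<inter> B = {} \<Longrightarrow> \<mu> (A \<union> B) = \<mu> A + \<mu> B"
    and "finite L" "\<And>l. l \<in> L \<Longrightarrow> A l \<subseteq> carrier G"
    and "\<And>k l. k \<in> L \<Longrightarrow> l \<in> L \<Longrightarrow> k \<noteq> l \<Longrightarrow> A k \<inter> A l = {}"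
  shows "\<mu> (\<Union>l\<in>L. A l) = (\<Sum>l\<in>L. \<mu> (A l))"
  using assms(2-)
proof (induction L)
  case empty
  then show ?case using add[of "{}" "{}"] by simp
next
  case (insert l L)
  have "\<mu> (A l \<union> (\<Union>l\<in>L. A l)) = \<mu> (A l) + \<mu> (\<Union>l\<in>L. A l)"
    using insert by (intro add) fastforce+
  then show ?case using insert by simp
qed

text \<open>Sorting the points by the multiplier in \<open>L\<close> that \<open>\<psi>\<close> uses
  cuts the group into finitely many pieces, each moved by a single left translation; injectivity
  keeps the images disjoint.\<close>

lemma piecewise_translation_measure:
  fixes \<mu> :: "'a set \<Rightarrow> real"
  assumes add: "\<And>A B. A \<subseteq> carrier G \<Longrightarrow> B \<subseteq> carrier G \<Longrightarrow> A \<inter> B = {} \<Longrightarrow> \<mu> (A \<union> B) = \<mu> A + \<mu> B"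
    and inv: "\<And>g A. g \<in> carrier G \<Longrightarrow> A \<subseteq> carrier G \<Longrightarrow> \<mu> (g <# A) = \<mu> A"
    and L: "finite L" "L \<subseteq> carrier G"
    and \<psi>: "inj_on \<psi> (carrier G)" "\<And>x. x \<in> carrier G \<Longrightarrow> \<psi> x \<in> L #> x"
  shows "\<mu> (\<psi> ` carrier G) = \<mu> (carrier G)"
proof -
  have "\<forall>x\<in>carrier G. \<exists>l\<in>L. \<psi> x = l \<otimes> x" using \<psi>(2) by (fastforce simp: r_coset_def)
  then obtain \<kappa> where \<kappa>: "\<And>x. x \<in> carrier G \<Longrightarrow> \<kappa> x \<in> L \<and> \<psi> x = \<kappa> x \<otimes> x" by metis
  define A where "A l = {x \<in> carrier G. \<kappa> x = l}" for l
  have im: "(l <# A l) = \<psi> ` A l" for l using \<kappa> by (fastforce simp: l_coset_def A_def)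
  have "\<mu> (\<psi> ` carrier G) = \<mu> (\<Union>l\<in>L. (l <# A l))"
    using \<kappa> by (intro arg_cong[of _ _ \<mu>]) (auto simp: im, auto simp: A_def)
  also have "\<dots> = (\<Sum>l\<in>L. \<mu> (l <# A l))"
  proof (rule finite_additive_sum[OF add L(1)])
    show "(l <# A l) \<subseteq> carrier G" if "l \<in> L" for l
      using that L by (auto simp: l_coset_def A_def)
    show "(k <# A k) \<inter> (l <# A l) = {}" if "k \<noteq> l" for k l
      using that \<psi>(1) unfolding im by (auto simp: A_def inj_on_def)
  qed
  also have "\<dots> = (\<Sum>l\<in>L. \<mu> (A l))"
    using L by (intro sum.cong inv) (auto simp: A_def)
  also have "\<dots> = \<mu> (\<Union>l\<in>L. A l)"
    by (rule finite_additive_sum[OF add L(1), symmetric]) (auto simp: A_def)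
  also have "(\<Union>l\<in>L. A l) = carrier G" using \<kappa> by (auto simp: A_def)
  finally show ?thesis .
qed

text \<open>Without a Folner set some \<open>L n = E^n\<close> doubles every finite set, and the marriage theorem then
  yields two disjoint piecewise translated copies of \<open>G\<close> inside \<open>G\<close>.\<close>

theorem amenable_imp_folner:
  assumes "amenable G" "finite K" "K \<subseteq> carrier G" "e > 0"
  shows "\<exists>S. folner G K e S"
proof (rule ccontr)
  assume nf: "\<nexists>S. folner G K e S"
  \<comment> \<open>Adjoining the unit makes \<open>E <#> S\<close> the disjoint union of
    \<open>S\<close> and its outer boundary, which gives the growth factor
    \<open>1 + e\<close>.\<close>
  define E where "E = insert \<one> K"
  have E: "finite E" "E \<subseteq> carrier G" using assms by (auto simp: E_def)
  have expand: "(1 + e) * real (card S) \<le> real (card (E <#> S))"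
    if S: "finite S" "S \<subseteq> carrier G" for S
  proof (cases "S = {}")
    case False
    have "{\<one>} <#> S = S" using S by (simp add: lcos_mult_one flip: l_coset_eq_set_mult)
    moreover have "E <#> S = ({\<one>} <#> S) \<union> (K <#> S)" by (auto simp: E_def set_mult_def)
    ultimately have "E <#> S = S \<union> ((K <#> S) - S)" by simp
    moreover have "card (S \<union> ((K <#> S) - S)) = card S + card ((K <#> S) - S)"
      using S assms by (intro card_Un_disjoint) (auto simp: finite_set_mult)
    moreover have "\<not> folner G K e S" using nf by blast
    then have "real (card ((K <#> S) - S)) > e * real (card S)"
      using S False by (auto simp: folner_def)
    ultimately show ?thesis by (simp add: algebra_simps)
  qed (simp add: set_mult_def)
  define L where "L = rec_nat {\<one>} (\<lambda>_ M. E <#> M)"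
  have L0: "L 0 = {\<one>}" and LS: "L (Suc n) = E <#> L n" for n by (simp_all add: L_def)
  have L: "finite (L n) \<and> L n \<subseteq> carrier G" for n
    by (induction n) (use E in \<open>auto simp: L0 LS finite_set_mult set_mult_closed\<close>)
  have grow: "(1 + e) ^ n * real (card S) \<le> real (card (L n <#> S))"
    if S: "finite S" "S \<subseteq> carrier G" for S n
  proof (induction n)
    case 0
    have "L 0 <#> S = S" using S by (simp add: L0 lcos_mult_one flip: l_coset_eq_set_mult)
    then show ?case by simp
  next
    case (Suc n)
    have "(1 + e) ^ Suc n * real (card S) \<le> (1 + e) * real (card (L n <#> S))"
      using Suc assms(4) by (simp add: mult.assoc)
    also have "\<dots> \<le> real (card (E <#> (L n <#> S)))"
      using L[of n] S by (intro expand) (auto simp: finite_set_mult set_mult_closed)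
    also have "E <#> (L n <#> S) = L (Suc n) <#> S"
      using L[of n] S E by (simp add: LS set_mult_assoc)
    finally show ?case .
  qed
  obtain n where n: "2 < (1 + e) ^ n" using assms(4) real_arch_pow[of "1 + e" 2] by auto
  have double: "2 * card S \<le> card (L n <#> S)" if S: "finite S" "S \<subseteq> carrier G" for S
  proof -
    have "2 * real (card S) \<le> (1 + e) ^ n * real (card S)" using n by (intro mult_right_mono) auto
    then show ?thesis using grow[OF S, of n] by linarith
  qed
  \<comment> \<open>The \<open>bool\<close> component asks for two images per point. A finite set of
    pairs has at most twice as many elements as its projection, so \<open>double\<close> is exactly
    Hall's condition.\<close>
  have "\<exists>\<phi>. inj_on \<phi> (carrier G \<times> (UNIV :: bool set)) \<and>
          (\<forall>i\<in>carrier G \<times> UNIV. \<phi> i \<in> L n #> fst i)"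
  proof (rule marriage)
    show "finite (L n #> fst i)" for i :: "'a \<times> bool" using L[of n] by (auto simp: r_coset_def)
  next
    fix J :: "('a \<times> bool) set" assume J: "finite J" "J \<subseteq> carrier G \<times> UNIV"
    have "card J \<le> card (fst ` J \<times> (UNIV :: bool set))"
      using J by (intro card_mono) force+
    also have "\<dots> \<le> card (L n <#> fst ` J)"
      using double[of "fst ` J"] J by (force simp: card_cartesian_product)
    also have "L n <#> fst ` J = (\<Union>i\<in>J. L n #> fst i)"
      by (force simp: set_mult_def r_coset_def)
    finally show "card J \<le> card (\<Union>i\<in>J. L n #> fst i)" .
  qed
  then obtain \<phi> where inj: "inj_on \<phi> (carrier G \<times> (UNIV :: bool set))"
    and \<phi>: "\<And>x b. x \<in> carrier G \<Longrightarrow> \<phi> (x, b) \<in> L n #> x" by force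
  obtain \<mu> :: "'a set \<Rightarrow> real" where pos: "\<And>A. A \<subseteq> carrier G \<Longrightarrow> 0 \<le> \<mu> A" and one: "\<mu> (carrier G) = 1"
    and add: "\<And>A B. A \<subseteq> carrier G \<Longrightarrow> B \<subseteq> carrier G \<Longrightarrow> A \<inter> B = {} \<Longrightarrow> \<mu> (A \<union> B) = \<mu> A + \<mu> B"
    and inv: "\<And>g A. g \<in> carrier G \<Longrightarrow> A \<subseteq> carrier G \<Longrightarrow> \<mu> (g <# A) = \<mu> A"
    using assms(1) unfolding amenable_def by (elim exE conjE) blast
  define P where "P b = (\<lambda>x. \<phi> (x, b)) ` carrier G" for b
  have P1: "\<mu> (P b) = 1" for b
  proof -
    have "\<mu> ((\<lambda>x. \<phi> (x, b)) ` carrier G) = \<mu> (carrier G)"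
      using inj L[of n] \<phi> by (intro piecewise_translation_measure[of \<mu>, OF add inv, of "L n"])
        (auto simp: inj_on_def)
    then show ?thesis by (simp add: P_def one)
  qed
  have PG: "P b \<subseteq> carrier G" for b
    using \<phi> L[of n] r_coset_subset_G unfolding P_def by blast
  have "P True \<inter> P False = {}" by (auto simp: P_def dest: inj_onD[OF inj])
  then have "\<mu> (P True \<union> P False) = 2" using add[OF PG PG] P1 by simp
  moreover have "\<mu> (carrier G) = \<mu> (P True \<union> P False) + \<mu> (carrier G - (P True \<union> P False))"
    using add[of "P True \<union> P False" "carrier G - (P True \<union> P False)"] PG
    by (simp add: Un_absorb1)
  ultimately show False using one pos[of "carrier G - (P True \<union> P False)"] by auto
qed

end

section \<open>Folner transversals of finite quotients\<close>

context group
begin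

section \<open>Averaging over the right translates of a set in a finite group\<close>

lemma mem_translate_iff:
  assumes "E \<subseteq> carrier G" "c \<in> carrier G" "u \<in> carrier G"
  shows "u \<in> E #> c \<longleftrightarrow> u \<otimes> inv c \<in> E"
proof
  assume "u \<in> E #> c"
  then show "u \<otimes> inv c \<in> E" using assms by (auto simp: r_coset_def m_assoc subset_eq)
next
  assume "u \<otimes> inv c \<in> E"
  moreover have "u = (u \<otimes> inv c) \<otimes> c" using assms by (simp add: m_assoc)
  ultimately show "u \<in> E #> c" by (auto simp: r_coset_def)
qed

lemma card_translates_containing:
  assumes "finite (carrier G)" "E \<subseteq> carrier G" "u \<in> carrier G"
  shows "card {c \<in> carrier G. u \<in> E #> c} = card E"
proof -
  have "bij_betw (\<lambda>c. u \<otimes> inv c) {c \<in> carrier G. u \<in> E #> c} E"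
  proof (rule bij_betw_byWitness[where f' = "\<lambda>e. inv e \<otimes> u"])
    show "(\<lambda>e. inv e \<otimes> u) ` E \<subseteq> {c \<in> carrier G. u \<in> E #> c}"
      using assms by (auto simp: mem_translate_iff subset_eq inv_mult_group m_assoc[symmetric])
  qed (use assms in \<open>auto simp: mem_translate_iff subset_eq inv_mult_group m_assoc[symmetric]\<close>,
       simp_all add: m_assoc)
  then show ?thesis by (rule bij_betw_same_card)
qed

text \<open>With \<open>e = u \<otimes> inv c\<close>, the translate separates the pair iff exactly
  one of \<open>e\<close> and \<open>a \<otimes> e\<close> lies in \<open>E\<close>. Left
  translation by \<open>a\<close> permutes a finite group, so as many points enter \<open>E\<close>
  as leave it; hence the factor 2.\<close>

lemma card_translates_separating:
  assumes fin: "finite (carrier G)" and E: "E \<subseteq> carrier G" and u: "u \<in> carrier G"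
    and a: "a \<in> carrier G"
  shows "card {c \<in> carrier G. (u \<in> E #> c) \<noteq> (a \<otimes> u \<in> E #> c)} \<le> 2 * card {e \<in> E. a \<otimes> e \<notin> E}"
proof -
  define B where "B = {e \<in> carrier G. a \<otimes> e \<in> E}"
  have fE: "finite E" and fB: "finite B" using fin E finite_subset by (auto simp: B_def)
  have "bij_betw (\<lambda>e. a \<otimes> e) B E"
    by (rule bij_betw_byWitness[where f' = "\<lambda>e. inv a \<otimes> e"])
       (use E a in \<open>auto simp: B_def m_assoc[symmetric] subset_eq\<close>)
  then have "card B = card E" by (rule bij_betw_same_card)
  then have "card (E - B) = card (B - E)"
    using fE fB by (metis card_Diff_subset_Int Int_commute finite_Int)
  moreover have EB: "E - B = {e \<in> E. a \<otimes> e \<notin> E}" using E by (auto simp: B_def)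
  moreover have "card ((E - B) \<union> (B - E)) \<le> card (E - B) + card (B - E)" by (rule card_Un_le)
  moreover have "card {c \<in> carrier G. (u \<in> E #> c) \<noteq> (a \<otimes> u \<in> E #> c)} \<le> card ((E - B) \<union> (B - E))"
  proof (rule card_inj_on_le[where f = "\<lambda>c. u \<otimes> inv c"])
    show "inj_on (\<lambda>c. u \<otimes> inv c) {c \<in> carrier G. (u \<in> E #> c) \<noteq> (a \<otimes> u \<in> E #> c)}"
      using u by (intro inj_onI) (auto dest: inj_onD[OF inv_inj])
    show "(\<lambda>c. u \<otimes> inv c) ` {c \<in> carrier G. (u \<in> E #> c) \<noteq> (a \<otimes> u \<in> E #> c)} \<subseteq> (E - B) \<union> (B - E)"
      using u a E by (auto simp: mem_translate_iff B_def m_assoc)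
    show "finite ((E - B) \<union> (B - E))" using fE fB by simp
  qed
  ultimately show ?thesis by simp
qed

text \<open>Averaging over the centre \<open>c\<close> of a translate \<open>E #> c\<close> yields one that separates few of the
  pairs \<open>u\<close>, \<open>h k \<otimes> u\<close> inside \<open>U\<close>, in proportion to the number of points of \<open>U\<close> it covers.\<close>

lemma exists_cheap_translate:
  fixes h :: "'k \<Rightarrow> 'a" and \<beta> :: real
  assumes fin: "finite (carrier G)" and E: "E \<subseteq> carrier G" "E \<noteq> {}" and U: "U \<subseteq> carrier G" "U \<noteq> {}"
    and K: "finite K" "h ` K \<subseteq> carrier G"
    and small: "\<And>k. k \<in> K \<Longrightarrow> real (card {e \<in> E. h k \<otimes> e \<notin> E}) \<le> \<beta> * real (card E)"
  shows "\<exists>c\<in>carrier G. U \<inter> (E #> c) \<noteq> {} \<and>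
     real (card {(k, u) \<in> K \<times> U. h k \<otimes> u \<in> U \<and> (u \<in> E #> c) \<noteq> (h k \<otimes> u \<in> E #> c)})
       \<le> 2 * \<beta> * real (card K) * real (card (U \<inter> (E #> c)))"
proof (rule ccontr)
  define cut where "cut c = {(k, u) \<in> K \<times> U. h k \<otimes> u \<in> U \<and> (u \<in> E #> c) \<noteq> (h k \<otimes> u \<in> E #> c)}" for c
  let ?b = "2 * \<beta> * real (card K)"
  assume "\<not> ?thesis"
  then have big: "?b * real (card (U \<inter> (E #> c))) < real (card (cut c))"
    if "c \<in> carrier G" "U \<inter> (E #> c) \<noteq> {}" for c using that by (auto simp: cut_def not_le)
  have fU: "finite U" and fE: "finite E" using fin U E finite_subset by auto
  obtain u where u: "u \<in> U" using U by blast
  obtain e where e: "e \<in> E" using E by blast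
  have sum_cells: "(\<Sum>c\<in>carrier G. card (U \<inter> (E #> c))) = card E * card U"
  proof -
    have "(\<Sum>c\<in>carrier G. card {u \<in> U. u \<in> E #> c}) = card E * card U"
      using card_translates_containing[OF fin E(1)] U fin fU
      by (intro sum_multicount) auto
    then show ?thesis by (simp add: Int_def)
  qed
  have "(\<Sum>c\<in>carrier G. real (card (cut c))) \<le> ?b * real (card E * card U)"
  proof -
    define A where "A = {(k, u) \<in> K \<times> U. h k \<otimes> u \<in> U}"
    have fA: "finite A" using fU K finite_subset[of A "K \<times> U"] by (auto simp: A_def)
    have "(\<Sum>c\<in>carrier G. card (cut c)) =
        (\<Sum>c\<in>carrier G. card {p \<in> A. (snd p \<in> E #> c) \<noteq> (h (fst p) \<otimes> snd p \<in> E #> c)})"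
      by (intro sum.cong arg_cong[of _ _ card]) (auto simp: cut_def A_def)
    also have "\<dots> = (\<Sum>p\<in>A. card {c \<in> carrier G. (snd p \<in> E #> c) \<noteq> (h (fst p) \<otimes> snd p \<in> E #> c)})"
      using fin fA by (intro sum_multicount_gen) auto
    finally have "real (\<Sum>c\<in>carrier G. card (cut c)) =
        real (\<Sum>p\<in>A. card {c \<in> carrier G. (snd p \<in> E #> c) \<noteq> (h (fst p) \<otimes> snd p \<in> E #> c)})"
      by (rule arg_cong)
    then have "(\<Sum>c\<in>carrier G. real (card (cut c))) =
        (\<Sum>p\<in>A. real (card {c \<in> carrier G. (snd p \<in> E #> c) \<noteq> (h (fst p) \<otimes> snd p \<in> E #> c)}))"
      by (simp only: of_nat_sum)
    also have "\<dots> \<le> (\<Sum>p\<in>A. 2 * \<beta> * real (card E))"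
    proof (rule sum_mono)
      fix p assume "p \<in> A"
      then have p: "fst p \<in> K" "snd p \<in> carrier G" "h (fst p) \<in> carrier G"
        using U K by (auto simp: A_def)
      have "real (card {c \<in> carrier G. (snd p \<in> E #> c) \<noteq> (h (fst p) \<otimes> snd p \<in> E #> c)})
          \<le> 2 * real (card {e \<in> E. h (fst p) \<otimes> e \<notin> E})"
        using card_translates_separating[OF fin E(1) p(2,3)] by linarith
      then show "real (card {c \<in> carrier G. (snd p \<in> E #> c) \<noteq> (h (fst p) \<otimes> snd p \<in> E #> c)})
          \<le> 2 * \<beta> * real (card E)"
        using small[OF p(1)] by linarith
    qed
    also have "\<dots> = real (card A) * (2 * \<beta> * real (card E))" by simp
    also have "\<dots> \<le> real (card K * card U) * (2 * \<beta> * real (card E))"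
    \<comment> \<open>The sign of \<open>\<beta>\<close> is read off from \<open>small\<close>,
      which requires an element of \<open>K\<close>.\<close>
    proof (cases "K = {}")
      case False
      then obtain k where "k \<in> K" by blast
      then have "0 \<le> \<beta> * real (card E)" using small[of k] by (meson of_nat_0_le_iff order_trans)
      moreover have "card A \<le> card (K \<times> U)"
        using fU K by (intro card_mono) (auto simp: A_def)
      then have "real (card A) \<le> real (card K * card U)"
        by (simp add: card_cartesian_product flip: of_nat_mult)
      ultimately show ?thesis by (intro mult_right_mono) auto
    qed (simp add: A_def)
    finally show ?thesis by (simp add: mult_ac)
  qed
  moreover have "(\<Sum>c\<in>carrier G. ?b * real (card (U \<inter> (E #> c)))) < (\<Sum>c\<in>carrier G. real (card (cut c)))"
  proof (rule sum_strict_mono_ex1[OF fin])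
    show "\<forall>c\<in>carrier G. ?b * real (card (U \<inter> (E #> c))) \<le> real (card (cut c))"
      using big less_imp_le by (metis card.empty mult_zero_right of_nat_0 of_nat_0_le_iff)
    \<comment> \<open>Some translate does meet \<open>U\<close>; there the inequality is strict. For
      centres whose translate misses \<open>U\<close> it only reads
      \<open>0 \<le> ...\<close>.\<close>
    have "inv e \<otimes> u \<in> carrier G" "u \<in> E #> (inv e \<otimes> u)"
      using e u E U by (auto simp: mem_translate_iff subset_eq inv_mult_group m_assoc[symmetric])
    then show "\<exists>c\<in>carrier G. ?b * real (card (U \<inter> (E #> c))) < real (card (cut c))"
      using big u by blast
  qed
  moreover have "(\<Sum>c\<in>carrier G. ?b * real (card (U \<inter> (E #> c)))) = ?b * real (card E * card U)"
    by (simp only: sum_cells flip: sum_distrib_left of_nat_sum)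
  ultimately show False by simp
qed

end

text \<open>Cheap translates \<open>E #> c\<close> are carved off \<open>U\<close> one after the other; on each of them \<open>t\<close> is the
  lift along the injective map \<open>F #> g \<rightarrow> E #> c\<close>, so it only jumps across the cuts.\<close>

lemma section_with_few_jumps:
  fixes G :: "('a, 'b) monoid_scheme" and H :: "('c, 'd) monoid_scheme"
  assumes "group G" "group H" and h: "h \<in> hom G H" "h ` carrier G = carrier H"
    and fin: "finite (carrier H)" and K: "finite K" "K \<subseteq> carrier G"
    and F: "folner G K e F" and inj: "inj_on h (F \<union> (K <#>\<^bsub>G\<^esub> F))"
    and U: "U \<subseteq> carrier H"
  shows "\<exists>t. (\<forall>u\<in>U. t u \<in> carrier G \<and> h (t u) = u) \<and>
    real (card {(k, u) \<in> K \<times> U. h k \<otimes>\<^bsub>H\<^esub> u \<in> U \<and> k \<otimes>\<^bsub>G\<^esub> t u \<noteq> t (h k \<otimes>\<^bsub>H\<^esub> u)})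
      \<le> 2 * e * real (card K) * real (card U)"
  using U
proof (induction "card U" arbitrary: U rule: less_induct)
  case less
  interpret G: group G by fact
  interpret H: group H by fact
  interpret h: group_hom G H h using h by unfold_locales
  have FG: "F \<subseteq> carrier G" "finite F" "F \<noteq> {}" using F by (auto simp: folner_def)
  have fU: "finite U" using less.prems fin finite_subset by blast
  show ?case
  proof (cases "U = {}")
    case False
    define E where "E = h ` F"
    have E: "E \<subseteq> carrier H" "E \<noteq> {}" using FG by (auto simp: E_def)
    have cardE: "card E = card F" unfolding E_def using inj by (intro card_image) (auto intro: inj_on_subset)
    have hK: "h ` K \<subseteq> carrier H" using K by auto
    \<comment> \<open>A point of \<open>E\<close> that \<open>h k\<close> moves out of
      \<open>E\<close> is sent to the image of a boundary point of \<open>F\<close>, so invariance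
      of \<open>F\<close> passes to the quotient.\<close>
    have small: "real (card {x \<in> E. h k \<otimes>\<^bsub>H\<^esub> x \<notin> E}) \<le> e * real (card E)" if k: "k \<in> K" for k
    proof -
      have "card {x \<in> E. h k \<otimes>\<^bsub>H\<^esub> x \<notin> E} \<le> card (h ` ((K <#>\<^bsub>G\<^esub> F) - F))"
      proof (rule card_inj_on_le[where f = "\<lambda>x. h k \<otimes>\<^bsub>H\<^esub> x"])
        show "inj_on ((\<otimes>\<^bsub>H\<^esub>) (h k)) {x \<in> E. h k \<otimes>\<^bsub>H\<^esub> x \<notin> E}"
          using E k K by (intro inj_onI) (auto simp: subset_eq)
        show "(\<otimes>\<^bsub>H\<^esub>) (h k) ` {x \<in> E. h k \<otimes>\<^bsub>H\<^esub> x \<notin> E} \<subseteq> h ` ((K <#>\<^bsub>G\<^esub> F) - F)"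
        proof safe
          fix x assume x: "x \<in> E" "h k \<otimes>\<^bsub>H\<^esub> x \<notin> E"
          then obtain f where f: "f \<in> F" "x = h f" by (auto simp: E_def)
          then have "h k \<otimes>\<^bsub>H\<^esub> x = h (k \<otimes>\<^bsub>G\<^esub> f)" using k K FG by (auto simp: subset_eq)
          moreover from this x have "k \<otimes>\<^bsub>G\<^esub> f \<notin> F" by (auto simp: E_def)
          moreover have "k \<otimes>\<^bsub>G\<^esub> f \<in> K <#>\<^bsub>G\<^esub> F" using k f by (auto simp: set_mult_def)
          ultimately show "h k \<otimes>\<^bsub>H\<^esub> x \<in> h ` ((K <#>\<^bsub>G\<^esub> F) - F)" by blast
        qed
      qed (use K FG in \<open>auto simp: finite_set_mult\<close>)
      also have "\<dots> \<le> card ((K <#>\<^bsub>G\<^esub> F) - F)"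
        using K FG by (intro card_image_le) (auto simp: finite_set_mult)
      also have "real \<dots> \<le> e * real (card F)" using F by (simp add: folner_def)
      finally show ?thesis by (simp add: cardE)
    qed
    obtain c where c: "c \<in> carrier H" "U \<inter> (E #>\<^bsub>H\<^esub> c) \<noteq> {}"
      and cut: "real (card {(k, u) \<in> K \<times> U. h k \<otimes>\<^bsub>H\<^esub> u \<in> U \<and>
           (u \<in> E #>\<^bsub>H\<^esub> c) \<noteq> (h k \<otimes>\<^bsub>H\<^esub> u \<in> E #>\<^bsub>H\<^esub> c)})
         \<le> 2 * e * real (card K) * real (card (U \<inter> (E #>\<^bsub>H\<^esub> c)))" (is "real (card ?cut) \<le> _")
      using H.exists_cheap_translate[OF fin E less.prems False K(1) hK small] by blast
    define V where "V = U - (E #>\<^bsub>H\<^esub> c)"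
    have "card V < card U" unfolding V_def using fU c(2) by (intro psubset_card_mono) auto
    then obtain t where t: "\<And>u. u \<in> V \<Longrightarrow> t u \<in> carrier G \<and> h (t u) = u"
      and tcard: "real (card {(k, u) \<in> K \<times> V. h k \<otimes>\<^bsub>H\<^esub> u \<in> V \<and> k \<otimes>\<^bsub>G\<^esub> t u \<noteq> t (h k \<otimes>\<^bsub>H\<^esub> u)})
         \<le> 2 * e * real (card K) * real (card V)" (is "real (card ?D) \<le> _")
      using less.hyps[of V] less.prems by (auto simp: V_def)
    obtain g where g: "g \<in> carrier G" "h g = c" using c(1)[folded h(2)] by blast
    have "\<forall>u\<in>E #>\<^bsub>H\<^esub> c. \<exists>f\<in>F. u = h f \<otimes>\<^bsub>H\<^esub> c" by (auto simp: E_def r_coset_def)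
    then obtain \<phi> where \<phi>: "\<And>u. u \<in> E #>\<^bsub>H\<^esub> c \<Longrightarrow> \<phi> u \<in> F \<and> u = h (\<phi> u) \<otimes>\<^bsub>H\<^esub> c" by metis
    define t' where "t' u = (if u \<in> E #>\<^bsub>H\<^esub> c then \<phi> u \<otimes>\<^bsub>G\<^esub> g else t u)" for u
    have t'1: "t' u \<in> carrier G \<and> h (t' u) = u" if "u \<in> U" for u
    proof (cases "u \<in> E #>\<^bsub>H\<^esub> c")
      case True
      then show ?thesis using \<phi>[OF True] FG g by (auto simp: t'_def subset_eq)
    qed (use t that in \<open>auto simp: t'_def V_def\<close>)
    \<comment> \<open>Both lifts are products with the same \<open>g\<close>, of elements of
      \<open>F\<close> and of \<open>K <#> F\<close> with equal image under \<open>h\<close>. This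
      is why \<open>h\<close> must be injective on the union of these two sets and not just on
      \<open>F\<close>.\<close>
    have nojump: "k \<otimes>\<^bsub>G\<^esub> t' u = t' (h k \<otimes>\<^bsub>H\<^esub> u)"
      if k: "k \<in> K" and u: "u \<in> E #>\<^bsub>H\<^esub> c" "h k \<otimes>\<^bsub>H\<^esub> u \<in> E #>\<^bsub>H\<^esub> c" for k u
    proof -
      have cl: "\<phi> u \<in> carrier G" "\<phi> (h k \<otimes>\<^bsub>H\<^esub> u) \<in> carrier G" "k \<in> carrier G"
        using \<phi> u FG k K by auto
      have "h k \<otimes>\<^bsub>H\<^esub> (h (\<phi> u) \<otimes>\<^bsub>H\<^esub> c) = h (\<phi> (h k \<otimes>\<^bsub>H\<^esub> u)) \<otimes>\<^bsub>H\<^esub> c"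
        using \<phi>[OF u(1)] \<phi>[OF u(2)] by metis
      then have "h (k \<otimes>\<^bsub>G\<^esub> \<phi> u) \<otimes>\<^bsub>H\<^esub> c = h (\<phi> (h k \<otimes>\<^bsub>H\<^esub> u)) \<otimes>\<^bsub>H\<^esub> c"
        using cl c(1) by (simp add: H.m_assoc)
      then have "h (k \<otimes>\<^bsub>G\<^esub> \<phi> u) = h (\<phi> (h k \<otimes>\<^bsub>H\<^esub> u))" using cl c(1) by simp
      moreover have "k \<otimes>\<^bsub>G\<^esub> \<phi> u \<in> K <#>\<^bsub>G\<^esub> F" using \<phi>[OF u(1)] k by (auto simp: set_mult_def)
      ultimately have "k \<otimes>\<^bsub>G\<^esub> \<phi> u = \<phi> (h k \<otimes>\<^bsub>H\<^esub> u)" using \<phi>[OF u(2)] by (intro inj_onD[OF inj]) auto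
      then show ?thesis using u cl g by (simp add: t'_def flip: G.m_assoc)
    qed
    let ?D' = "{(k, u) \<in> K \<times> U. h k \<otimes>\<^bsub>H\<^esub> u \<in> U \<and> k \<otimes>\<^bsub>G\<^esub> t' u \<noteq> t' (h k \<otimes>\<^bsub>H\<^esub> u)}"
    have "?D' \<subseteq> ?D \<union> ?cut"
    proof
      fix p assume "p \<in> ?D'"
      then obtain k u where p: "p = (k, u)" and
        *: "k \<in> K" "u \<in> U" "h k \<otimes>\<^bsub>H\<^esub> u \<in> U" "k \<otimes>\<^bsub>G\<^esub> t' u \<noteq> t' (h k \<otimes>\<^bsub>H\<^esub> u)" by auto
      show "p \<in> ?D \<union> ?cut"
      proof (cases "(u \<in> E #>\<^bsub>H\<^esub> c) = (h k \<otimes>\<^bsub>H\<^esub> u \<in> E #>\<^bsub>H\<^esub> c)")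
        case True
        then have n: "u \<notin> E #>\<^bsub>H\<^esub> c" "h k \<otimes>\<^bsub>H\<^esub> u \<notin> E #>\<^bsub>H\<^esub> c" using nojump * by blast+
        then show ?thesis using * by (simp add: p V_def t'_def)
      qed (use * in \<open>simp add: p\<close>)
    qed
    moreover have "finite ?D" "finite ?cut"
      by (rule finite_subset[of _ "K \<times> U"]; use fU K in \<open>auto simp: V_def\<close>)+
    ultimately have "card ?D' \<le> card ?D + card ?cut"
      by (meson card_Un_le card_mono finite_UnI order_trans)
    then have "real (card ?D') \<le> 2 * e * real (card K) * (real (card V) + real (card (U \<inter> (E #>\<^bsub>H\<^esub> c))))"
      using tcard cut by (simp add: algebra_simps)
    also have "real (card V) + real (card (U \<inter> (E #>\<^bsub>H\<^esub> c))) = real (card U)"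
      using fU card_Int_Diff[of U "E #>\<^bsub>H\<^esub> c"] by (simp add: V_def)
    finally show ?thesis using t'1 by blast
  qed auto
qed

section \<open>Invariant transversals from residual finiteness\<close>

definition finite_quotient_transversals :: "('a, 'b) monoid_scheme \<Rightarrow> 'a set set" where
  "finite_quotient_transversals G =
     {T. T \<subseteq> carrier G \<and> (\<exists>N. N \<lhd> G \<and> finite (carrier (G Mod N)) \<and>
        bij_betw (\<lambda>g. N #>\<^bsub>G\<^esub> g) T (carrier (G Mod N)))}"

context group
begin

text \<open>Each coset of the intersection is the intersection of a coset of \<open>M\<close> with a
  coset of \<open>N\<close>.\<close>

lemma finite_index_Int:
  assumes M: "M \<lhd> G" "finite (carrier (G Mod M))" and N: "N \<lhd> G" "finite (carrier (G Mod N))"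
  shows "finite (carrier (G Mod (M \<inter> N)))"
proof -
  have "carrier (G Mod (M \<inter> N)) \<subseteq> (\<lambda>(A, B). A \<inter> B) ` (carrier (G Mod M) \<times> carrier (G Mod N))"
  proof
    fix X assume "X \<in> carrier (G Mod (M \<inter> N))"
    then obtain x where x: "x \<in> carrier G" "X = (M \<inter> N) #> x"
      by (auto simp: FactGroup_def RCOSETS_def)
    have "M \<subseteq> carrier G" "N \<subseteq> carrier G"
      using M N by (simp_all add: normal_imp_subgroup subgroup.subset)
    then have "X = (M #> x) \<inter> (N #> x)" using x by (auto simp: r_coset_def subset_eq)
    then show "X \<in> (\<lambda>(A, B). A \<inter> B) ` (carrier (G Mod M) \<times> carrier (G Mod N))"
      using x by (auto simp: FactGroup_def RCOSETS_def)
  qed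
  then show ?thesis using M N by (meson finite_SigmaI finite_imageI finite_subset)
qed

text \<open>Finitely many finite-index normal subgroups are intersected. Applied to the elements
  \<open>a \<otimes> inv b\<close>, this yields a finite quotient that is injective on a given
  finite set.\<close>

lemma residually_finite_avoid:
  assumes "residually_finite G" "finite A" "A \<subseteq> carrier G" "\<one> \<notin> A"
  shows "\<exists>N. N \<lhd> G \<and> finite (carrier (G Mod N)) \<and> A \<inter> N = {}"
  using assms(2-)
proof (induction A)
  case empty
  have "carrier G \<lhd> G" by (simp add: normal_inv_iff subgroup_self)
  moreover have "carrier (G Mod carrier G) \<subseteq> {carrier G}"
    by (auto simp: FactGroup_def RCOSETS_def coset_join2 subgroup_self)
  ultimately show ?case by (meson finite.simps finite_subset inf_bot_left)
next
  case (insert a A)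
  then obtain N where N: "N \<lhd> G" "finite (carrier (G Mod N))" "A \<inter> N = {}" by auto
  obtain M where M: "M \<lhd> G" "finite (carrier (G Mod M))" "a \<notin> M"
    using assms(1) insert.prems by (auto simp: residually_finite_def)
  show ?case
    using M N finite_index_Int[OF M(1,2) N(1,2)] normal_subgroup_intersect[OF M(1) N(1)]
    by (intro exI[of _ "M \<inter> N"]) auto
qed

text \<open>Weiss's theorem. The transversal is the image of a section of a finite quotient that
  commutes with translation by \<open>K\<close> except at few jumps, and only jumps can produce
  boundary points.\<close>

theorem folner_transversal:
  assumes rf: "residually_finite G" and am: "amenable G"
    and K: "finite K" "K \<subseteq> carrier G" and e: "e > 0"
  shows "\<exists>T\<in>finite_quotient_transversals G. folner G K e T"
proof -
  \<comment> \<open>Jumps number at most \<open>2 * e1 * card K\<close> times the order of the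
    quotient, so this \<open>e1\<close> brings them below the fraction \<open>e\<close>; the
    \<open>+ 1\<close> covers empty \<open>K\<close>.\<close>
  define e1 where "e1 = e / (2 * (real (card K) + 1))"
  have e1: "e1 > 0" using e by (simp add: e1_def)
  obtain F where F: "folner G K e1 F" using amenable_imp_folner[OF am K e1] by blast
  have FG: "F \<subseteq> carrier G" "finite F" "F \<noteq> {}" using F by (auto simp: folner_def)
  define B where "B = F \<union> (K <#> F)"
  have B: "finite B" "B \<subseteq> carrier G"
    using K FG by (auto simp: B_def finite_set_mult set_mult_closed)
  define A where "A = {a \<otimes> inv b | a b. a \<in> B \<and> b \<in> B \<and> a \<noteq> b}"
  have "A \<subseteq> (\<lambda>(a, b). a \<otimes> inv b) ` (B \<times> B)" by (force simp: A_def)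
  then have "finite A" using B by (meson finite_SigmaI finite_imageI finite_subset)
  moreover have "A \<subseteq> carrier G" using B by (auto simp: A_def)
  moreover have "\<one> \<notin> A"
  proof
    assume "\<one> \<in> A"
    then obtain a b where ab: "a \<in> B" "b \<in> B" "a \<noteq> b" "\<one> = a \<otimes> inv b"
      unfolding A_def by blast
    then have "inv (inv b) = a" using B by (intro inv_equality) auto
    then show False using ab B by auto
  qed
  ultimately obtain N where N: "N \<lhd> G" "finite (carrier (G Mod N))" "A \<inter> N = {}"
    using residually_finite_avoid[OF rf] by blast
  interpret N: normal N G by fact
  let ?h = "\<lambda>g. N #> g" and ?H = "G Mod N"
  have H: "group ?H" by (rule N.factorgroup_is_group)
  have h: "?h \<in> hom G ?H" "?h ` carrier G = carrier ?H"
    using N.r_coset_hom_Mod by (auto simp: FactGroup_def RCOSETS_def)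
  have inj: "inj_on ?h B"
  proof (rule inj_onI, rule ccontr)
    fix a b assume ab: "a \<in> B" "b \<in> B" "?h a = ?h b" "a \<noteq> b"
    then have "a \<otimes> inv b \<in> A" by (auto simp: A_def)
    moreover have "a \<in> N #> b" using ab B rcos_self[of a N] N.subgroup_axioms by auto
    then have "a \<otimes> inv b \<in> N" using N.rcos_module[of b a] ab B is_group by blast
    ultimately show False using N(3) by blast
  qed
  obtain t where t: "\<And>u. u \<in> carrier ?H \<Longrightarrow> t u \<in> carrier G \<and> ?h (t u) = u"
    and jumps: "real (card {(k, u) \<in> K \<times> carrier ?H. ?h k \<otimes>\<^bsub>?H\<^esub> u \<in> carrier ?H \<and> k \<otimes> t u \<noteq> t (?h k \<otimes>\<^bsub>?H\<^esub> u)})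
      \<le> 2 * e1 * real (card K) * real (card (carrier ?H))" (is "real (card ?D) \<le> _")
    using section_with_few_jumps[OF is_group H h N(2) K F inj[unfolded B_def] order_refl] by blast
  define T where "T = t ` carrier ?H"
  have tinj: "inj_on t (carrier ?H)" using t by (metis inj_onI)
  have T: "T \<subseteq> carrier G" using t by (auto simp: T_def)
  have bij: "bij_betw ?h T (carrier ?H)"
    by (rule bij_betw_byWitness[where f' = t]) (use t in \<open>auto simp: T_def\<close>)
  have cardT: "card T = card (carrier ?H)" using bij by (rule bij_betw_same_card)
  have fD: "finite ?D" by (rule finite_subset[of _ "K \<times> carrier ?H"]) (use K N(2) in auto)
  \<comment> \<open>If \<open>k \<otimes> t u\<close> is outside \<open>T\<close>, it differs from
    the representative that \<open>t\<close> selects in its coset, so \<open>(k, u)\<close> is a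
    jump.\<close>
  have "(K <#> T) - T \<subseteq> (\<lambda>(k, u). k \<otimes> t u) ` ?D"
  proof
    fix x assume x: "x \<in> (K <#> T) - T"
    then obtain k u where ku: "k \<in> K" "u \<in> carrier ?H" "x = k \<otimes> t u" by (auto simp: T_def set_mult_def)
    have "?h k \<otimes>\<^bsub>?H\<^esub> u \<in> carrier ?H"
      using ku K h H by (intro monoid.m_closed group.is_monoid) auto
    then show "x \<in> (\<lambda>(k, u). k \<otimes> t u) ` ?D"
      using ku x by (intro image_eqI[of _ _ "(k, u)"]) (auto simp: T_def)
  qed
  then have "card ((K <#> T) - T) \<le> card ?D" using fD by (meson surj_card_le)
  then have "real (card ((K <#> T) - T)) \<le> 2 * e1 * real (card K) * real (card T)"
    using jumps by (simp add: cardT)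
  also have "\<dots> \<le> e * real (card T)"
    using e by (intro mult_right_mono) (auto simp: e1_def field_simps)
  finally have "real (card ((K <#> T) - T)) \<le> e * real (card T)" .
  moreover have "finite T" using N(2) by (simp add: T_def)
  moreover have "T \<noteq> {}" using H group.is_monoid monoid.one_closed by (auto simp: T_def)
  ultimately have "folner G K e T" using T by (simp add: folner_def)
  moreover have "T \<in> finite_quotient_transversals G"
    using T N bij by (auto simp: finite_quotient_transversals_def)
  ultimately show ?thesis by blast
qed

end

section \<open>Quasi-tilings of approximate actions\<close>

text \<open>Multiplicativity is what allows tiles to be compared and moved; the injectivity clause
  makes the translate of a subset of \<open>W\<close> to \<open>x\<close> a faithful copy. The
  product of \<open>g\<close> and \<open>h\<close> is allowed to leave \<open>W\<close>.\<close>

definition good_point ::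
  "('g, 'b) monoid_scheme \<Rightarrow> ('g \<Rightarrow> 'x \<Rightarrow> 'x) \<Rightarrow> 'g set \<Rightarrow> 'x \<Rightarrow> bool" where
  "good_point G a W x \<longleftrightarrow>
     (\<forall>g\<in>W. \<forall>h\<in>W. a g (a h x) = a (g \<otimes>\<^bsub>G\<^esub> h) x \<and> (a g x = a h x \<longrightarrow> g = h))"

definition approx_action ::
  "('g, 'b) monoid_scheme \<Rightarrow> 'g set \<Rightarrow> real \<Rightarrow> 'x set \<Rightarrow> ('g \<Rightarrow> 'x \<Rightarrow> 'x) \<Rightarrow> bool" where
  "approx_action G W \<delta> X a \<longleftrightarrow> finite X \<and> (\<forall>g\<in>carrier G. bij_betw (a g) X X) \<and>
     real (card {x \<in> X. \<not> good_point G a W x}) \<le> \<delta> * real (card X)"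

lemma approx_action_mono:
  assumes "approx_action G W \<delta> X a" "\<delta> \<le> \<delta>'"
  shows "approx_action G W \<delta>' X a"
proof -
  have "\<delta> * real (card X) \<le> \<delta>' * real (card X)" using assms(2) by (intro mult_right_mono) auto
  then show ?thesis using assms(1) by (auto simp: approx_action_def)
qed

text \<open>A tile \<open>(x, T, P)\<close> is the translate of the shape \<open>T\<close> to the centre \<open>x\<close>; the translates of the
  large parts \<open>P \<subseteq> T\<close> are disjoint and already cover the whole tiles.\<close>

definition covered :: "('g \<Rightarrow> 'x \<Rightarrow> 'x) \<Rightarrow> ('x \<times> 'g set \<times> 'g set) set \<Rightarrow> 'x set" where
  "covered a I = (\<lambda>((x, T, P), p). a p x) ` (SIGMA i:I. snd (snd i))"

definition tiling :: "('g, 'b) monoid_scheme \<Rightarrow> ('g \<Rightarrow> 'x \<Rightarrow> 'x) \<Rightarrow> 'g set \<Rightarrow> 'x set \<Rightarrow> 'g set set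
    \<Rightarrow> real \<Rightarrow> ('x \<times> 'g set \<times> 'g set) set \<Rightarrow> bool" where
  "tiling G a W X \<T> \<epsilon> I \<longleftrightarrow> finite I \<and>
     (\<forall>(x, T, P)\<in>I. x \<in> X \<and> good_point G a W x \<and> T \<in> \<T> \<and> P \<subseteq> T \<and>
        (1 - \<epsilon>) * real (card T) \<le> real (card P) \<and> (\<lambda>t. a t x) ` T \<subseteq> covered a I) \<and>
     inj_on (\<lambda>((x, T, P), p). a p x) (SIGMA i:I. snd (snd i))"

lemma tilingD:
  assumes "tiling G a W X \<T> \<epsilon> I" "(x, T, P) \<in> I"
  shows "x \<in> X" "good_point G a W x" "T \<in> \<T>" "P \<subseteq> T" "(1 - \<epsilon>) * real (card T) \<le> real (card P)"
    "\<And>t. t \<in> T \<Longrightarrow> a t x \<in> covered a I"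
  using assms unfolding tiling_def Ball_def split_paired_All prod.case by blast+

lemma tiling_finite: "tiling G a W X \<T> \<epsilon> I \<Longrightarrow> finite I"
  by (simp add: tiling_def)

lemma mem_covered: "y \<in> covered a I \<longleftrightarrow> (\<exists>x T P p. (x, T, P) \<in> I \<and> p \<in> P \<and> y = a p x)"
  by (force simp: covered_def)

lemma tiling_mono:
  assumes "tiling G a W X \<T> \<epsilon> I" "\<T> \<subseteq> \<T>'"
  shows "tiling G a W X \<T>' \<epsilon> I"
  using assms unfolding tiling_def Ball_def split_paired_All prod.case by blast

lemma covered_subset:
  assumes "tiling G a W X \<T> \<epsilon> I" "\<Union>\<T> \<subseteq> carrier G" "\<And>g. g \<in> carrier G \<Longrightarrow> bij_betw (a g) X X"
  shows "covered a I \<subseteq> X"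
proof
  fix y assume "y \<in> covered a I"
  then obtain x T P p where i: "(x, T, P) \<in> I" and p: "p \<in> P" "y = a p x" by (auto simp: mem_covered)
  have "p \<in> carrier G" using tilingD[OF assms(1) i] p assms(2) by auto
  then have "bij_betw (a p) X X" by (rule assms(3))
  then show "y \<in> X" using p tilingD(1)[OF assms(1) i] by (auto simp: bij_betw_def)
qed

lemma card_covered:
  assumes "tiling G a W X \<T> \<epsilon> I" "\<And>T. T \<in> \<T> \<Longrightarrow> finite T"
  shows "card (covered a I) = (\<Sum>i\<in>I. card (snd (snd i)))"
proof -
  have "card (covered a I) = card (SIGMA i:I. snd (snd i))"
    using assms(1) unfolding covered_def tiling_def by (intro card_image) simp
  also have "\<dots> = (\<Sum>i\<in>I. card (snd (snd i)))"
  proof (rule card_SigmaI)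
    show "\<forall>i\<in>I. finite (snd (snd i))"
      using tilingD(3,4)[OF assms(1)] assms(2) finite_subset
      unfolding Ball_def split_paired_All prod.sel by metis
  qed (use assms(1) in \<open>simp add: tiling_def\<close>)
  finally show ?thesis .
qed

text \<open>Whole shapes may overlap, but their disjoint parts lose at most a fraction
  \<open>\<epsilon>\<close>, so the total size counted with multiplicity stays under
  control.\<close>

lemma card_shapes_le:
  assumes I: "tiling G a W X \<T> \<epsilon> I" and fin: "\<And>T. T \<in> \<T> \<Longrightarrow> finite T"
  shows "(1 - \<epsilon>) * (\<Sum>i\<in>I. real (card (fst (snd i)))) \<le> real (card (covered a I))"
proof -
  have "(1 - \<epsilon>) * (\<Sum>i\<in>I. real (card (fst (snd i)))) \<le> (\<Sum>i\<in>I. real (card (snd (snd i))))"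
    unfolding sum_distrib_left using tilingD(5)[OF I] by (intro sum_mono) force
  then show ?thesis by (simp add: card_covered[OF I fin])
qed

text \<open>The part \<open>P\<close> of the new tile is what it adds to the covered set. Few of its
  points were covered before, so \<open>P\<close> is large, and those that were keep the whole tile
  inside the covered set.\<close>

lemma tiling_insert:
  assumes I: "tiling G a W X \<T> \<epsilon> I" and T: "T \<in> \<T>" "finite T" "T \<noteq> {}" "T \<subseteq> W"
    and x: "x \<in> X" "good_point G a W x" and \<epsilon>: "\<epsilon> < 1"
    and few: "real (card {t \<in> T. a t x \<in> covered a I}) \<le> \<epsilon> * real (card T)"
  shows "\<exists>J. tiling G a W X \<T> \<epsilon> J \<and> covered a I \<subset> covered a J"
proof -
  define P where "P = {t \<in> T. a t x \<notin> covered a I}"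
  define J where "J = insert (x, T, P) I"
  have "card T = card P + card {t \<in> T. a t x \<in> covered a I}"
    using T(2) by (subst card_Un_disjoint[symmetric]) (auto simp: P_def intro!: arg_cong[of _ _ card])
  then have cardP: "(1 - \<epsilon>) * real (card T) \<le> real (card P)" using few by (simp add: algebra_simps)
  have "0 < (1 - \<epsilon>) * real (card T)" using T \<epsilon> by (simp add: card_gt_0_iff)
  then have "P \<noteq> {}" using cardP by auto
  then obtain p where p: "p \<in> P" by blast
  have new: "a q x \<notin> covered a I" if "q \<in> P" for q using that by (simp add: P_def)
  have notin: "(x, T, P) \<notin> I" using new[OF p] p unfolding mem_covered by blast
  have "(SIGMA i:J. snd (snd i)) = (SIGMA i:I. snd (snd i)) \<union> Pair (x, T, P) ` P"
    by (auto simp: J_def)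
  then have cov: "covered a J = covered a I \<union> (\<lambda>q. a q x) ` P"
    by (simp add: covered_def image_Un image_image)
  have injP: "q = r" if "q \<in> P" "r \<in> P" "a q x = a r x" for q r
    using that x(2) T(4) by (auto simp: good_point_def P_def)
  have "inj_on (\<lambda>((x, T, P), p). a p x) (SIGMA i:J. snd (snd i))"
  proof (rule inj_onI)
    fix u v assume uv: "u \<in> (SIGMA i:J. snd (snd i))" "v \<in> (SIGMA i:J. snd (snd i))"
      "(\<lambda>((x, T, P), p). a p x) u = (\<lambda>((x, T, P), p). a p x) v"
    let ?f = "\<lambda>((x, T, P), p). a p x"
    have old: "w \<in> (SIGMA i:I. snd (snd i)) \<or> (\<exists>q\<in>P. w = ((x, T, P), q))"
      if "w \<in> (SIGMA i:J. snd (snd i))" for w using that by (auto simp: J_def)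
    have cI: "?f w \<in> covered a I" if "w \<in> (SIGMA i:I. snd (snd i))" for w
      using that unfolding covered_def by (rule imageI)
    have inj: "inj_on ?f (SIGMA i:I. snd (snd i))" using I by (simp add: tiling_def)
    consider "u \<in> (SIGMA i:I. snd (snd i))" "v \<in> (SIGMA i:I. snd (snd i))"
      | q where "q \<in> P" "u = ((x, T, P), q)" "v \<in> (SIGMA i:I. snd (snd i))"
      | q where "q \<in> P" "v = ((x, T, P), q)" "u \<in> (SIGMA i:I. snd (snd i))"
      | q r where "q \<in> P" "r \<in> P" "u = ((x, T, P), q)" "v = ((x, T, P), r)"
      using old[OF uv(1)] old[OF uv(2)] by blast
    then show "u = v"
    proof cases
      case 1
      then show ?thesis using uv(3) inj by (simp add: inj_on_eq_iff)
    next
      case 2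
      then show ?thesis using uv(3) cI[of v] new[of q] by simp
    next
      case 3
      then show ?thesis using uv(3) cI[of u] new[of q] by simp
    next
      case 4
      then show ?thesis using uv(3) injP by auto
    qed
  qed
  moreover have "x' \<in> X \<and> good_point G a W x' \<and> T' \<in> \<T> \<and> P' \<subseteq> T' \<and>
      (1 - \<epsilon>) * real (card T') \<le> real (card P') \<and> (\<lambda>t. a t x') ` T' \<subseteq> covered a J"
    if "(x', T', P') \<in> J" for x' T' P'
  proof (cases "(x', T', P') = (x, T, P)")
    case True
    then show ?thesis using x T cardP by (auto simp: cov P_def)
  next
    case False
    then have "(x', T', P') \<in> I" using that by (auto simp: J_def)
    then show ?thesis using tilingD[OF I] cov by blast
  qed
  moreover have "finite J" using I by (simp add: tiling_def J_def)
  ultimately have "tiling G a W X \<T> \<epsilon> J"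
    unfolding tiling_def Ball_def split_paired_All prod.case by blast
  moreover have "covered a I \<subset> covered a J" using p new[OF p] cov by auto
  ultimately show ?thesis by blast
qed

text \<open>A tiling covering the most points is saturated: a good centre with too few covered
  points would admit one more tile.\<close>

lemma tiling_saturate:
  assumes I: "tiling G a W X \<T> \<epsilon> I" and T: "T \<in> \<T>" "finite T" "T \<noteq> {}" "T \<subseteq> W"
    and \<T>: "\<Union>\<T> \<subseteq> carrier G" and a: "\<And>g. g \<in> carrier G \<Longrightarrow> bij_betw (a g) X X"
    and X: "finite X" and \<epsilon>: "\<epsilon> < 1"
  shows "\<exists>J. tiling G a W X \<T> \<epsilon> J \<and> covered a I \<subseteq> covered a J \<and>
    (\<forall>x\<in>X. good_point G a W x \<longrightarrow> \<epsilon> * real (card T) < real (card {t \<in> T. a t x \<in> covered a J}))"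
proof -
  let ?P = "\<lambda>J. tiling G a W X \<T> \<epsilon> J \<and> covered a I \<subseteq> covered a J"
  have sub: "covered a J \<subseteq> X" if "tiling G a W X \<T> \<epsilon> J" for J
    using covered_subset[OF that \<T> a] by blast
  have "\<exists>J. ?P J \<and> (\<forall>J'. ?P J' \<longrightarrow> card (covered a J') \<le> card (covered a J))"
    by (rule ex_has_greatest_nat[of ?P I _ "Suc (card X)"])
      (use I sub X in \<open>auto intro: card_mono simp: less_Suc_eq_le\<close>)
  then obtain J where J: "tiling G a W X \<T> \<epsilon> J" "covered a I \<subseteq> covered a J"
    and max: "\<And>J'. ?P J' \<Longrightarrow> card (covered a J') \<le> card (covered a J)" by blast
  have "\<epsilon> * real (card T) < real (card {t \<in> T. a t x \<in> covered a J})"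
    if x: "x \<in> X" "good_point G a W x" for x
  proof (rule ccontr)
    assume "\<not> ?thesis"
    then obtain J' where J': "tiling G a W X \<T> \<epsilon> J'" "covered a J \<subset> covered a J'"
      using tiling_insert[OF J(1) T x \<epsilon>] by (auto simp: not_less)
    then have "card (covered a J) < card (covered a J')"
      using sub X by (meson finite_subset psubset_card_mono)
    moreover have "card (covered a J') \<le> card (covered a J)" using J' J by (intro max) auto
    ultimately show False by simp
  qed
  then show ?thesis using J by blast
qed

lemma card_UN_le_weighted:
  assumes "finite I" "\<And>i. i \<in> I \<Longrightarrow> finite (A i)" "\<And>i. i \<in> I \<Longrightarrow> real (card (A i)) \<le> c * w i"
  shows "real (card (\<Union>i\<in>I. A i)) \<le> c * (\<Sum>i\<in>I. w i)"
proof -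
  have "real (card (\<Union>i\<in>I. A i)) \<le> (\<Sum>i\<in>I. real (card (A i)))"
    using card_UN_le[OF assms(1), of A] by (simp flip: of_nat_sum)
  also have "\<dots> \<le> c * (\<Sum>i\<in>I. w i)" unfolding sum_distrib_left using assms by (intro sum_mono)
  finally show ?thesis .
qed

text \<open>The tiles of the first stage are so invariant under \<open>T\<inverse>\<close> that most \<open>T\<close>-translates centred in
  the uncovered part avoid them; saturation then forces a fraction \<open>\<epsilon>\<close> of that part to be covered.\<close>

lemma tiling_step:
  fixes G :: "('g, 'b) monoid_scheme" and a :: "'g \<Rightarrow> 'x \<Rightarrow> 'x"
  assumes "group G" and I: "tiling G a W X \<T> \<epsilon> I" and J: "tiling G a W X \<U> \<epsilon> J"
    and IJ: "covered a I \<subseteq> covered a J" and cJ: "covered a J \<subseteq> X"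
    and act: "approx_action G W \<delta> X a"
    and \<T>: "\<And>S. S \<in> \<T> \<Longrightarrow> folner G K e S"
    and T: "finite T" "T \<noteq> {}" "T \<subseteq> carrier G" "T \<subseteq> W" "m_inv G ` T \<subseteq> K" "finite K"
    and W: "\<And>S. S \<in> \<T> \<Longrightarrow> S \<subseteq> W" "\<And>S. S \<in> \<T> \<Longrightarrow> (m_inv G ` T) <#>\<^bsub>G\<^esub> S \<subseteq> W"
    and \<epsilon>: "0 < \<epsilon>" "\<epsilon> < 1/2" and e: "0 < e"
    and sat: "\<And>x. x \<in> X \<Longrightarrow> good_point G a W x \<Longrightarrow>
       \<epsilon> * real (card T) < real (card {t \<in> T. a t x \<in> covered a J})"
  shows "real (card (X - covered a J)) \<le>
    (1 - \<epsilon>) * real (card (X - covered a I)) + \<epsilon> * ((\<delta> + 2 * e) * real (card X))"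
proof -
  interpret G: group G by fact
  have X: "finite X" and bij: "\<And>g. g \<in> carrier G \<Longrightarrow> bij_betw (a g) X X"
    and bad: "real (card {x \<in> X. \<not> good_point G a W x}) \<le> \<delta> * real (card X)"
    using act by (auto simp: approx_action_def)
  have finS: "finite S" "S \<subseteq> carrier G" if "S \<in> \<T>" for S using \<T>[OF that] by (auto simp: folner_def)
  have finI: "finite I" using I by (rule tiling_finite)
  define D where "D = covered a J - covered a I"
  define Y where "Y = {x \<in> X. good_point G a W x \<and> (\<forall>t\<in>T. a t x \<notin> covered a I)}"
  have fD: "finite D" and fY: "finite Y" using X cJ finite_subset by (auto simp: D_def Y_def)
  \<comment> \<open>Double count of pairs \<open>(x, t)\<close> with \<open>a t x\<close> newly
    covered. Saturation gives more than \<open>\<epsilon> * card T\<close> pairs for each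
    \<open>x\<close> in \<open>Y\<close>, whereas each \<open>t\<close> contributes exactly
    \<open>card D\<close>, since \<open>a t\<close> is a bijection of \<open>X\<close>.\<close>
  have "real (card Y) * (\<epsilon> * real (card T)) \<le> (\<Sum>x\<in>Y. real (card {t \<in> T. a t x \<in> D}))"
  proof -
    have "(\<Sum>x\<in>Y. \<epsilon> * real (card T)) \<le> (\<Sum>x\<in>Y. real (card {t \<in> T. a t x \<in> D}))"
    proof (rule sum_mono)
      fix x assume x: "x \<in> Y"
      then have "{t \<in> T. a t x \<in> D} = {t \<in> T. a t x \<in> covered a J}" by (auto simp: Y_def D_def)
      then show "\<epsilon> * real (card T) \<le> real (card {t \<in> T. a t x \<in> D})"
        using sat[of x] x by (simp add: Y_def)
    qed
    then show ?thesis by simp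
  qed
  also have "\<dots> \<le> (\<Sum>x\<in>X. real (card {t \<in> T. a t x \<in> D}))"
    using X by (intro sum_mono2) (auto simp: Y_def)
  also have "\<dots> = real (card D * card T)"
  proof -
    have "card {x \<in> X. a t x \<in> D} = card D" if t: "t \<in> T" for t
    proof -
      have b: "bij_betw (a t) X X" using bij t T by auto
      have "a t ` {x \<in> X. a t x \<in> D} = D" using b cJ by (auto simp: bij_betw_def D_def)
      moreover have "inj_on (a t) {x \<in> X. a t x \<in> D}" using b by (auto simp: bij_betw_def intro: inj_on_subset)
      ultimately show ?thesis using card_image by fastforce
    qed
    then have "(\<Sum>x\<in>X. card {t \<in> T. a t x \<in> D}) = card D * card T"
      using X T by (intro sum_multicount) auto
    then have "real (\<Sum>x\<in>X. card {t \<in> T. a t x \<in> D}) = real (card D * card T)" by (rule arg_cong)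
    then show ?thesis by (simp only: of_nat_sum)
  qed
  finally have "real (card Y) * \<epsilon> * real (card T) \<le> real (card D) * real (card T)" by (simp add: mult.assoc)
  moreover have "real (card T) > 0" using T by (simp add: card_gt_0_iff)
  ultimately have YD: "\<epsilon> * real (card Y) \<le> real (card D)"
    by (simp add: mult_le_cancel_right mult.commute)
  \<comment> \<open>\<open>M i\<close> is the boundary of tile \<open>i\<close> under the inverses
    of \<open>T\<close>. A good uncovered centre whose \<open>T\<close>-translate meets the covered
    set lies in some \<open>M i\<close>, since it is not in the tile itself.\<close>
  define M where "M i = (\<lambda>g. a g (fst i)) ` (((m_inv G ` T) <#>\<^bsub>G\<^esub> fst (snd i)) - fst (snd i))"
    for i :: "'x \<times> 'g set \<times> 'g set"
  have "X - covered a I - Y \<subseteq> {x \<in> X. \<not> good_point G a W x} \<union> (\<Union>i\<in>I. M i)"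
  proof
    fix x assume "x \<in> X - covered a I - Y"
    then have x: "x \<in> X" "x \<notin> covered a I" "x \<notin> Y" by auto
    show "x \<in> {x \<in> X. \<not> good_point G a W x} \<union> (\<Union>i\<in>I. M i)"
    proof (cases "good_point G a W x")
      case True
      then obtain t where t: "t \<in> T" "a t x \<in> covered a I" using x by (auto simp: Y_def)
      then obtain y S P p where i: "(y, S, P) \<in> I" and p: "p \<in> P" "a t x = a p y"
        by (auto simp: mem_covered)
      have S: "S \<in> \<T>" "p \<in> S" "good_point G a W y" "y \<in> X" using tilingD[OF I i] p by auto
      have tG: "t \<in> carrier G" "p \<in> carrier G" using t T S(2) finS(2)[OF S(1)] by blast+
      have tp: "inv\<^bsub>G\<^esub> t \<otimes>\<^bsub>G\<^esub> p \<in> (m_inv G ` T) <#>\<^bsub>G\<^esub> S" using t S by (auto simp: set_mult_def)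
      \<comment> \<open>Goodness at the tile's centre \<open>y\<close>, applied to \<open>t\<close>
        and \<open>inv t \<otimes> p\<close>, together with injectivity of \<open>a t\<close>,
        recovers \<open>x\<close> as a translate of \<open>y\<close>. Hence \<open>W\<close> has to
        contain the products of inverses of \<open>T\<close> with shapes.\<close>
      have "a t (a (inv\<^bsub>G\<^esub> t \<otimes>\<^bsub>G\<^esub> p) y) = a (t \<otimes>\<^bsub>G\<^esub> (inv\<^bsub>G\<^esub> t \<otimes>\<^bsub>G\<^esub> p)) y"
        using S(3) t(1) T(4) tp W(2)[OF S(1)] by (auto simp: good_point_def)
      also have "t \<otimes>\<^bsub>G\<^esub> (inv\<^bsub>G\<^esub> t \<otimes>\<^bsub>G\<^esub> p) = p" using tG by (simp add: G.m_assoc[symmetric])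
      finally have "a t (a (inv\<^bsub>G\<^esub> t \<otimes>\<^bsub>G\<^esub> p) y) = a t x" using p by simp
      moreover have "a (inv\<^bsub>G\<^esub> t \<otimes>\<^bsub>G\<^esub> p) y \<in> X"
        using bij[of "inv\<^bsub>G\<^esub> t \<otimes>\<^bsub>G\<^esub> p"] tG S(4) by (auto simp: bij_betw_def)
      ultimately have x_eq: "a (inv\<^bsub>G\<^esub> t \<otimes>\<^bsub>G\<^esub> p) y = x"
        using bij[OF tG(1)] x(1) by (auto simp: bij_betw_def inj_on_def)
      have "inv\<^bsub>G\<^esub> t \<otimes>\<^bsub>G\<^esub> p \<notin> S" using x_eq x(2) tilingD(6)[OF I i] by metis
      then have "x \<in> M (y, S, P)" using x_eq tp by (auto simp: M_def)
      then show ?thesis using i by blast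
    qed (use x in simp)
  qed
  moreover have fM: "finite (M i)" if "i \<in> I" for i
    using tilingD(3)[OF I] that finS T by (cases i) (auto simp: M_def finite_set_mult)
  ultimately have "card (X - covered a I - Y) \<le> card {x \<in> X. \<not> good_point G a W x} + card (\<Union>i\<in>I. M i)"
    using X finI by (intro order_trans[OF card_mono card_Un_le]) auto
  moreover have "real (card (\<Union>i\<in>I. M i)) \<le> e * (\<Sum>i\<in>I. real (card (fst (snd i))))"
  proof (rule card_UN_le_weighted[OF finI fM])
    fix i assume "i \<in> I"
    moreover obtain y S P where i: "i = (y, S, P)" by (cases i)
    ultimately have S: "S \<in> \<T>" using tilingD(3)[OF I] by blast
    have "card (M i) \<le> card (((m_inv G ` T) <#>\<^bsub>G\<^esub> S) - S)"
      using T finS[OF S] by (simp add: M_def i card_image_le finite_set_mult)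
    also have "real \<dots> \<le> e * real (card S)"
      using folner_mono[OF \<T>[OF S] T(6,5) order_refl] by (simp add: folner_def)
    finally show "real (card (M i)) \<le> e * real (card (fst (snd i)))" by (simp add: i)
  qed
  \<comment> \<open>The factor 2 is the price of overlaps: \<open>1 - \<epsilon>\<close> is at least
    one half.\<close>
  moreover have "(\<Sum>i\<in>I. real (card (fst (snd i)))) \<le> 2 * real (card X)"
  proof -
    have "1 / 2 * (\<Sum>i\<in>I. real (card (fst (snd i)))) \<le> (1 - \<epsilon>) * (\<Sum>i\<in>I. real (card (fst (snd i))))"
      using \<epsilon> by (intro mult_right_mono sum_nonneg) auto
    also have "\<dots> \<le> real (card (covered a I))" using card_shapes_le[OF I] finS by blast
    also have "\<dots> \<le> real (card X)" using X IJ cJ by (simp add: card_mono)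
    finally show ?thesis by simp
  qed
  then have "e * (\<Sum>i\<in>I. real (card (fst (snd i)))) \<le> e * (2 * real (card X))"
    using e by (intro mult_left_mono) auto
  ultimately have "real (card (X - covered a I - Y)) \<le> (\<delta> + 2 * e) * real (card X)"
    using bad by (simp add: algebra_simps)
  moreover have "card (X - covered a I) \<le> card (X - covered a I - Y) + card Y"
    using X fY by (intro order_trans[OF card_mono card_Un_le]) auto
  ultimately have "real (card (X - covered a I)) - (\<delta> + 2 * e) * real (card X) \<le> real (card Y)" by linarith
  then have "\<epsilon> * (real (card (X - covered a I)) - (\<delta> + 2 * e) * real (card X)) \<le> real (card D)"
    using YD \<epsilon> by (meson mult_left_mono less_imp_le order_trans)
  moreover have "X - covered a I = (X - covered a J) \<union> D" "(X - covered a J) \<inter> D = {}"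
    using IJ cJ by (auto simp: D_def)
  then have "card (X - covered a I) = card (X - covered a J) + card D"
    using X fD by (metis card_Un_disjoint finite_Diff)
  ultimately show ?thesis by (simp add: algebra_simps)
qed

text \<open>Shapes are chosen in the reverse of the order in which they are placed: \<open>T\<close>
  is fixed before the shapes in \<open>\<T>\<close>, which can then be required to be nearly
  invariant under the inverses of \<open>T\<close>, but \<open>T\<close> is placed after them. Each
  stage covers a fraction \<open>\<epsilon>\<close> of the remainder up to a small error.
  \<open>W\<^sub>0\<close> and \<open>\<delta>\<close> do not depend on \<open>X\<close>, as
  stability requires.\<close>

theorem quasi_tiling:
  fixes G :: "('g, 'b) monoid_scheme" and \<epsilon> \<eta> e :: real
  assumes "group G"
    and \<S>: "\<forall>K e. finite K \<and> K \<subseteq> carrier G \<and> e > 0 \<longrightarrow> (\<exists>T\<in>\<S>. folner G K e T)"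
    and \<epsilon>: "0 < \<epsilon>" "\<epsilon> < 1/2" and \<eta>: "0 < \<eta>"
    and K: "finite K" "K \<subseteq> carrier G" and e: "0 < e"
  shows "\<exists>\<T> W\<^sub>0 \<delta>. finite \<T> \<and> \<T> \<subseteq> \<S> \<and> (\<forall>T\<in>\<T>. folner G K e T) \<and>
     finite W\<^sub>0 \<and> W\<^sub>0 \<subseteq> carrier G \<and> 0 < \<delta> \<and>
     (\<forall>W X (a :: 'g \<Rightarrow> 'x \<Rightarrow> 'x). W\<^sub>0 \<subseteq> W \<and> approx_action G W \<delta> X a \<longrightarrow>
        (\<exists>I. tiling G a W X \<T> \<epsilon> I \<and>
           real (card (X - covered a I)) \<le> ((1 - \<epsilon>) ^ n + \<eta>) * real (card X)))"
  using K e
proof (induction n arbitrary: K e)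
  case 0
  have "tiling G a W X {} \<epsilon> {} \<and> real (card (X - covered a {})) \<le> ((1 - \<epsilon>) ^ 0 + \<eta>) * real (card X)"
    for W X and a :: "'g \<Rightarrow> 'x \<Rightarrow> 'x"
    using \<eta> by (simp add: tiling_def covered_def algebra_simps)
  then have "\<forall>W X (a :: 'g \<Rightarrow> 'x \<Rightarrow> 'x). {} \<subseteq> W \<and> approx_action G W 1 X a \<longrightarrow>
      (\<exists>I. tiling G a W X {} \<epsilon> I \<and>
        real (card (X - covered a I)) \<le> ((1 - \<epsilon>) ^ 0 + \<eta>) * real (card X))" by blast
  then show ?case by (intro exI[of _ "{}"] exI[of _ 1] conjI) simp_all
next
  case (Suc n)
  interpret G: group G by fact
  obtain T where T\<S>: "T \<in> \<S>" and TF: "folner G K e T" using \<S> Suc.prems by blast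
  have T: "finite T" "T \<noteq> {}" "T \<subseteq> carrier G" using TF by (auto simp: folner_def)
  define K' where "K' = K \<union> m_inv G ` T"
  \<comment> \<open>Together with \<open>\<delta>' \<le> \<eta> / 2\<close> below, this bounds
    \<open>\<delta>' + 2 * e'\<close> by \<open>\<eta>\<close>. The new error
    \<open>\<epsilon> * \<eta>\<close> and the inherited \<open>(1 - \<epsilon>) * \<eta>\<close>
    add up to \<open>\<eta>\<close> again, so errors do not accumulate with
    \<open>n\<close>.\<close>
  define e' where "e' = min e (\<eta> / 4)"
  have K': "finite K'" "K' \<subseteq> carrier G" "0 < e'"
    using Suc.prems T \<eta> by (auto simp: K'_def e'_def)
  obtain \<T> W\<^sub>0 \<delta> where \<T>: "finite \<T>" "\<T> \<subseteq> \<S>" "\<And>T. T \<in> \<T> \<Longrightarrow> folner G K' e' T"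
    and W0: "finite W\<^sub>0" "W\<^sub>0 \<subseteq> carrier G" and \<delta>: "0 < \<delta>"
    and IH: "\<And>W X (a :: 'g \<Rightarrow> 'x \<Rightarrow> 'x). W\<^sub>0 \<subseteq> W \<Longrightarrow> approx_action G W \<delta> X a \<Longrightarrow>
        \<exists>I. tiling G a W X \<T> \<epsilon> I \<and> real (card (X - covered a I)) \<le> ((1 - \<epsilon>) ^ n + \<eta>) * real (card X)"
    using Suc.IH[OF K'] by auto
  have \<T>fin: "finite S" "S \<subseteq> carrier G" if "S \<in> \<T>" for S using \<T>(3)[OF that] by (auto simp: folner_def)
  define W\<^sub>1 where "W\<^sub>1 = W\<^sub>0 \<union> T \<union> \<Union>\<T> \<union> (\<Union>S\<in>\<T>. (m_inv G ` T) <#>\<^bsub>G\<^esub> S)"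
  define \<delta>' where "\<delta>' = min \<delta> (\<eta> / 2)"
  have fW: "finite W\<^sub>1" using W0 T \<T> \<T>fin by (auto simp: W\<^sub>1_def finite_set_mult)
  have "m_inv G ` T \<subseteq> carrier G" using T by auto
  then have Wcar: "W\<^sub>1 \<subseteq> carrier G" using W0 T \<T>fin(2) unfolding W\<^sub>1_def
    by (intro Un_least Sup_least UN_least G.set_mult_closed) auto
  have \<delta>pos: "0 < \<delta>'" using \<delta> \<eta> by (simp add: \<delta>'_def)
  have shapes: "folner G K e S" if "S \<in> insert T \<T>" for S
    using that TF folner_mono[OF \<T>(3) K'(1), of S K e] by (auto simp: K'_def e'_def)
  have main: "\<forall>W X (a :: 'g \<Rightarrow> 'x \<Rightarrow> 'x). W\<^sub>1 \<subseteq> W \<and> approx_action G W \<delta>' X a \<longrightarrow>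
      (\<exists>J. tiling G a W X (insert T \<T>) \<epsilon> J \<and>
        real (card (X - covered a J)) \<le> ((1 - \<epsilon>) ^ Suc n + \<eta>) * real (card X))"
  proof (intro allI impI, elim conjE)
    fix W X and a :: "'g \<Rightarrow> 'x \<Rightarrow> 'x"
    assume W: "W\<^sub>1 \<subseteq> W" and act: "approx_action G W \<delta>' X a"
    have X: "finite X" and bij: "\<And>g. g \<in> carrier G \<Longrightarrow> bij_betw (a g) X X"
      using act by (auto simp: approx_action_def)
    have "approx_action G W \<delta> X a"
      using act by (rule approx_action_mono) (simp add: \<delta>'_def)
    then obtain I where I: "tiling G a W X \<T> \<epsilon> I"
      and uncov: "real (card (X - covered a I)) \<le> ((1 - \<epsilon>) ^ n + \<eta>) * real (card X)"
      using IH[of W X a] W by (auto simp: W\<^sub>1_def)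
    have I': "tiling G a W X (insert T \<T>) \<epsilon> I" using I by (rule tiling_mono) auto
    have TW: "T \<subseteq> W" using W by (auto simp: W\<^sub>1_def)
    have car: "\<Union>(insert T \<T>) \<subseteq> carrier G" using T \<T>fin by auto
    obtain J where J: "tiling G a W X (insert T \<T>) \<epsilon> J" "covered a I \<subseteq> covered a J"
      and sat: "\<And>x. x \<in> X \<Longrightarrow> good_point G a W x \<Longrightarrow>
        \<epsilon> * real (card T) < real (card {t \<in> T. a t x \<in> covered a J})"
      using tiling_saturate[OF I' insertI1 T(1,2) TW car bij X] \<epsilon> by auto
    have "real (card (X - covered a J)) \<le>
      (1 - \<epsilon>) * real (card (X - covered a I)) + \<epsilon> * ((\<delta>' + 2 * e') * real (card X))"
    proof (rule tiling_step[OF assms(1) I J _ act \<T>(3) T TW])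
      show "covered a J \<subseteq> X" by (rule covered_subset[OF J(1) car bij])
      show "m_inv G ` T \<subseteq> K'" by (simp add: K'_def)
      show "S \<subseteq> W" "(m_inv G ` T) <#>\<^bsub>G\<^esub> S \<subseteq> W" if "S \<in> \<T>" for S
        using that W unfolding W\<^sub>1_def by blast+
    qed (use K' \<epsilon> sat in auto)
    also have "\<dots> \<le> (1 - \<epsilon>) * (((1 - \<epsilon>) ^ n + \<eta>) * real (card X)) + \<epsilon> * (\<eta> * real (card X))"
      using uncov \<epsilon> by (intro add_mono mult_left_mono mult_right_mono) (auto simp: \<delta>'_def e'_def)
    also have "\<dots> = ((1 - \<epsilon>) ^ Suc n + \<eta>) * real (card X)" by (simp add: algebra_simps)
    finally show "\<exists>J. tiling G a W X (insert T \<T>) \<epsilon> J \<and>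
        real (card (X - covered a J)) \<le> ((1 - \<epsilon>) ^ Suc n + \<eta>) * real (card X)" using J by blast
  qed
  have "finite (insert T \<T>)" "insert T \<T> \<subseteq> \<S>" using \<T> T\<S> by auto
  then show ?case
    by (intro exI[of _ "insert T \<T>"] exI[of _ W\<^sub>1] exI[of _ \<delta>'] conjI ballI shapes main fW Wcar \<delta>pos)
qed

section \<open>From quasi-tilings to actions\<close>

context group
begin

text \<open>Left multiplication on the finite quotient is carried over to \<open>T\<close>. If
  \<open>g \<otimes> t\<close> stays in \<open>T\<close>, it is the representative of its own coset,
  so there the action is honest translation.\<close>

lemma transversal_action:
  assumes "T \<in> finite_quotient_transversals G"
  shows "\<exists>b. (\<forall>g\<in>carrier G. \<forall>t\<in>T. b g t \<in> T \<and> (g \<otimes> t \<in> T \<longrightarrow> b g t = g \<otimes> t)) \<and>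
     (\<forall>g\<in>carrier G. \<forall>h\<in>carrier G. \<forall>t\<in>T. b (g \<otimes> h) t = b g (b h t))"
proof -
  obtain N where T: "T \<subseteq> carrier G" and N: "N \<lhd> G"
    and bij: "bij_betw (\<lambda>g. N #> g) T (carrier (G Mod N))"
    using assms by (auto simp: finite_quotient_transversals_def)
  interpret N: normal N G by fact
  interpret Q: group "G Mod N" by (rule N.factorgroup_is_group)
  have hom: "N #> (g \<otimes> h) = (N #> g) \<otimes>\<^bsub>G Mod N\<^esub> (N #> h)"
    if "g \<in> carrier G" "h \<in> carrier G" for g h
    using N.r_coset_hom_Mod that by (simp add: hom_mult)
  have Q: "N #> g \<in> carrier (G Mod N)" if "g \<in> carrier G" for g
    using N.r_coset_hom_Mod that by (rule hom_in_carrier)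
  define b where "b g t = inv_into T (\<lambda>g. N #> g) (N #> (g \<otimes> t))" for g t
  have b: "b g t \<in> T" "N #> b g t = N #> (g \<otimes> t)" if "g \<in> carrier G" "t \<in> T" for g t
  proof -
    have "N #> (g \<otimes> t) \<in> (\<lambda>g. N #> g) ` T"
      using bij Q[of "g \<otimes> t"] that T by (auto simp: bij_betw_def)
    then show "b g t \<in> T" "N #> b g t = N #> (g \<otimes> t)"
      unfolding b_def by (rule inv_into_into, rule f_inv_into_f)
  qed
  have uniq: "t = u" if "t \<in> T" "u \<in> T" "N #> t = N #> u" for t u
    using bij that by (auto simp: bij_betw_def inj_on_def)
  have "b g t = g \<otimes> t" if "g \<in> carrier G" "t \<in> T" "g \<otimes> t \<in> T" for g t
    using b[of g t] that by (intro uniq) auto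
  moreover have "b (g \<otimes> h) t = b g (b h t)" if "g \<in> carrier G" "h \<in> carrier G" "t \<in> T" for g h t
  proof (rule uniq)
    have t: "t \<in> carrier G" "b h t \<in> carrier G" using that T b by auto
    have "N #> b g (b h t) = (N #> g) \<otimes>\<^bsub>G Mod N\<^esub> (N #> b h t)"
      using b that t by (simp add: hom)
    also have "\<dots> = (N #> g) \<otimes>\<^bsub>G Mod N\<^esub> ((N #> h) \<otimes>\<^bsub>G Mod N\<^esub> (N #> t))"
      using b that t by (simp add: hom)
    also have "\<dots> = N #> b (g \<otimes> h) t"
      using b that t Q by (simp add: hom Q.m_assoc del: mult_FactGroup)
    finally show "N #> b (g \<otimes> h) t = N #> b g (b h t)" by simp
  qed (use that b in auto)
  ultimately show ?thesis using b by blast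
qed

text \<open>Fixing all points outside the image of \<open>j\<close> leaves the multiplication rule
  intact, and the inverse of \<open>g\<close> then provides the inverse permutation.\<close>

lemma transport_action:
  assumes j: "inj_on j D" "j ` D \<subseteq> X"
    and closed: "\<And>g d. g \<in> carrier G \<Longrightarrow> d \<in> D \<Longrightarrow> b g d \<in> D"
    and act: "\<And>g h d. g \<in> carrier G \<Longrightarrow> h \<in> carrier G \<Longrightarrow> d \<in> D \<Longrightarrow> b (g \<otimes> h) d = b g (b h d)"
    and one: "\<And>d. d \<in> D \<Longrightarrow> b \<one> d = d"
  shows "\<exists>\<Phi>. (\<forall>g\<in>carrier G. \<Phi> g permutes X \<and> (\<forall>d\<in>D. \<Phi> g (j d) = j (b g d))) \<and>
     (\<forall>g\<in>carrier G. \<forall>h\<in>carrier G. \<Phi> (g \<otimes> h) = \<Phi> g \<circ> \<Phi> h)"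
proof -
  define \<Phi> where "\<Phi> g x = (if x \<in> j ` D then j (b g (inv_into D j x)) else x)" for g x
  have \<Phi>j: "\<Phi> g (j d) = j (b g d)" if "d \<in> D" for g d using that j by (simp add: \<Phi>_def)
  have \<Phi>o: "\<Phi> g x = x" if "x \<notin> j ` D" for g x using that by (simp add: \<Phi>_def)
  have hom: "\<Phi> (g \<otimes> h) x = \<Phi> g (\<Phi> h x)" if "g \<in> carrier G" "h \<in> carrier G" for g h x
  proof (cases "x \<in> j ` D")
    case True
    then show ?thesis using that closed by (auto simp: \<Phi>j act)
  qed (simp add: \<Phi>o)
  have id: "\<Phi> \<one> x = x" for x
    by (cases "x \<in> j ` D") (auto simp: \<Phi>j \<Phi>o one)
  have "\<Phi> g permutes X" if g: "g \<in> carrier G" for g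
  proof (rule bij_imp_permutes)
    have into: "\<Phi> g x \<in> X" if "g \<in> carrier G" "x \<in> X" for g x
      using that j(2) closed by (cases "x \<in> j ` D") (auto simp: \<Phi>j \<Phi>o)
    show "bij_betw (\<Phi> g) X X"
      by (rule bij_betw_byWitness[where f' = "\<Phi> (inv g)"])
         (use g into in \<open>auto simp: id simp flip: hom\<close>)
    show "\<Phi> g x = x" if "x \<notin> X" for x using that j(2) by (auto intro!: \<Phi>o)
  qed
  then show ?thesis using \<Phi>j hom by (intro exI[of _ \<Phi>]) (auto simp: fun_eq_iff)
qed

end

text \<open>The values not yet used are at least as many as the arguments not yet treated. Serves
  both to embed tiles and, with \<open>D = X\<close>, to complete a partial injection to a
  permutation.\<close>

lemma extend_injection:
  assumes "finite D" "finite X" "D0 \<subseteq> D" "inj_on f D0" "f ` D0 \<subseteq> X" "card D \<le> card X"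
  shows "\<exists>j. inj_on j D \<and> j ` D \<subseteq> X \<and> (\<forall>d\<in>D0. j d = f d)"
proof -
  have "card (D - D0) = card D - card D0"
    using assms finite_subset by (intro card_Diff_subset) auto
  also have "\<dots> \<le> card X - card (f ` D0)" using assms by (simp add: card_image)
  also have "\<dots> = card (X - f ` D0)"
    using assms by (intro card_Diff_subset[symmetric]) (auto intro: finite_subset)
  finally obtain k where k: "inj_on k (D - D0)" "k ` (D - D0) \<subseteq> X - f ` D0"
    using assms inj_on_iff_card_le[of "D - D0" "X - f ` D0"] by auto
  define j where "j d = (if d \<in> D0 then f d else k d)" for d
  have neq: "f c \<noteq> k d" if "c \<in> D0" "d \<in> D - D0" for c d using k(2) that by blast
  have "inj_on j D"
  proof (rule inj_onI)
    fix c d assume "c \<in> D" "d \<in> D" "j c = j d"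
    then show "c = d"
      using neq[of c d] neq[of d c] inj_onD[OF assms(4), of c d] inj_onD[OF k(1), of c d]
      by (cases "c \<in> D0"; cases "d \<in> D0") (auto simp: j_def)
  qed
  moreover have "j ` D \<subseteq> X" using k assms by (auto simp: j_def)
  moreover have "\<forall>d\<in>D0. j d = f d" by (simp add: j_def)
  ultimately show ?thesis by blast
qed

text \<open>Greedy choice: once an item does not fit, the gap to \<open>m\<close> is at most its
  weight, hence at most \<open>L\<close>.\<close>

lemma subset_sum_up_to:
  fixes w :: "'i \<Rightarrow> nat"
  assumes "finite I" "\<And>i. i \<in> I \<Longrightarrow> w i \<le> L"
  shows "\<exists>J\<subseteq>I. sum w J \<le> m \<and> (J = I \<or> m \<le> sum w J + L)"
  using assms
proof (induction I)
  case (insert i I)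
  then obtain J where J: "J \<subseteq> I" "sum w J \<le> m" "J = I \<or> m \<le> sum w J + L" by auto
  show ?case
  proof (cases "J = I \<and> sum w I + w i \<le> m")
    case True
    then show ?thesis using insert by (intro exI[of _ "insert i I"]) auto
  next
    case False
    have "w i \<le> L" using insert.prems by simp
    then show ?thesis using J False by (intro exI[of _ J]) auto
  qed
qed simp

text \<open>A set of tiles of total size at most \<open>card X\<close> is kept, their disjoint union, on which \<open>G\<close> acts
  through finite quotients, is embedded into \<open>X\<close> extending the inclusion of the parts \<open>P\<close>, and the
  remaining points are fixed.\<close>

theorem tiling_imp_action:
  fixes G :: "('g, 'b) monoid_scheme" and a :: "'g \<Rightarrow> 'x \<Rightarrow> 'x"
  assumes "group G" and I: "tiling G a W X \<T> \<epsilon> I" and X: "finite X"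
    and bij: "\<And>g. g \<in> carrier G \<Longrightarrow> bij_betw (a g) X X"
    and \<T>: "\<T> \<subseteq> finite_quotient_transversals G" "\<And>T. T \<in> \<T> \<Longrightarrow> folner G K e T"
    and L: "\<And>T. T \<in> \<T> \<Longrightarrow> card T \<le> L" "real L \<le> \<epsilon> * real (card X)"
    and K: "finite K" "K \<subseteq> carrier G" "K \<subseteq> W" and W: "\<Union>\<T> \<subseteq> W"
    and \<epsilon>: "0 \<le> \<epsilon>" "0 \<le> e" and \<beta>: "0 \<le> \<beta>"
    and uncov: "real (card (X - covered a I)) \<le> \<beta> * real (card X)"
  shows "\<exists>\<Phi>. (\<forall>g\<in>carrier G. \<Phi> g permutes X) \<and>
     (\<forall>g\<in>carrier G. \<forall>h\<in>carrier G. \<Phi> (g \<otimes>\<^bsub>G\<^esub> h) = \<Phi> g \<circ> \<Phi> h) \<and>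
     (\<forall>g\<in>K. real (card {x \<in> X. \<Phi> g x \<noteq> a g x}) \<le> (\<beta> + 3 * \<epsilon> + e) * real (card X))"
proof -
  interpret G: group G by fact
  let ?T = "\<lambda>i :: 'x \<times> 'g set \<times> 'g set. fst (snd i)" and ?P = "\<lambda>i :: 'x \<times> 'g set \<times> 'g set. snd (snd i)"
  let ?f = "\<lambda>((x, T, P), p). a p x"
  have finI: "finite I" using I by (rule tiling_finite)
  have fin\<T>: "finite T" "T \<subseteq> carrier G" if "T \<in> \<T>" for T using \<T>(2)[OF that] by (auto simp: folner_def)
  have IT: "?T i \<in> \<T>" "?P i \<subseteq> ?T i" "(1 - \<epsilon>) * real (card (?T i)) \<le> real (card (?P i))" if "i \<in> I" for i
    using tilingD[OF I] that by (cases i; auto)+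
  have finT: "finite (?T i)" "finite (?P i)" if "i \<in> I" for i
    using IT[OF that] fin\<T> by (blast intro: finite_subset)+
  \<comment> \<open>Overlaps can make the shapes of \<open>I\<close> larger in total than
    \<open>X\<close>; tiles are dropped until the disjoint union fits.\<close>
  obtain J where J: "J \<subseteq> I" "(\<Sum>i\<in>J. card (?T i)) \<le> card X"
    "J = I \<or> card X \<le> (\<Sum>i\<in>J. card (?T i)) + L"
    using subset_sum_up_to[OF finI, of "\<lambda>i. card (?T i)" L "card X"] L(1) IT(1) by blast
  have finJ: "finite J" using J finI finite_subset by blast
  define \<Sigma> where "\<Sigma> = (\<Sum>i\<in>J. real (card (?T i)))"
  have \<Sigma>: "0 \<le> \<Sigma>" "\<Sigma> \<le> real (card X)"
    using J(2) by (auto simp: \<Sigma>_def sum_nonneg simp flip: of_nat_sum)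
  \<comment> \<open>If nothing was dropped, the deficit is at most the uncovered part; otherwise it
    is at most one tile, and \<open>L\<close> is a small fraction of \<open>card X\<close>.\<close>
  have \<Sigma>_large: "real (card X) - \<Sigma> \<le> (\<beta> + \<epsilon>) * real (card X)"
    using J(3)
  proof
    assume "J = I"
    have "card (covered a I) = (\<Sum>i\<in>I. card (?P i))"
      using card_covered[OF I] fin\<T> by blast
    also have "\<dots> \<le> (\<Sum>i\<in>I. card (?T i))" using IT finT by (intro sum_mono card_mono) auto
    finally have "real (card (covered a I)) \<le> \<Sigma>" by (simp add: \<Sigma>_def \<open>J = I\<close> flip: of_nat_sum)
    moreover have "card X \<le> card (X - covered a I) + card (covered a I)"
    proof -
      have "covered a I \<subseteq> X" using covered_subset[OF I _ bij] fin\<T> by blast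
      then show ?thesis using X by (metis card_Diff_subset card_mono finite_subset le_add_diff_inverse2 order_refl)
    qed
    then have "real (card X) \<le> real (card (X - covered a I)) + real (card (covered a I))" by linarith
    moreover have "0 \<le> \<epsilon> * real (card X)" using \<epsilon> by simp
    ultimately show ?thesis using uncov by (simp add: algebra_simps)
  next
    assume "card X \<le> (\<Sum>i\<in>J. card (?T i)) + L"
    then have "real (card X) \<le> \<Sigma> + real L" by (simp add: \<Sigma>_def flip: of_nat_sum)
    moreover have "0 \<le> \<beta> * real (card X)" using \<beta> by simp
    ultimately show ?thesis using L(2) by (simp add: algebra_simps)
  qed
  define D where "D = (SIGMA i:J. ?T i)"
  define D0 where "D0 = (SIGMA i:J. ?P i)"
  have finJT: "finite (?T i)" "finite (?P i)" if "i \<in> J" for i using finT J(1) that by blast+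
  have fD: "finite D" using finJ finJT by (auto simp: D_def intro!: finite_SigmaI)
  have D0D: "D0 \<subseteq> D" using IT(2) J by (fastforce simp: D_def D0_def)
  have cardD: "card D = (\<Sum>i\<in>J. card (?T i))" unfolding D_def using finJ finJT by (intro card_SigmaI) auto
  have cardD0: "card D0 = (\<Sum>i\<in>J. card (?P i))" unfolding D0_def using finJ finJT by (intro card_SigmaI) auto
  have D0I: "D0 \<subseteq> (SIGMA i:I. ?P i)" using J by (auto simp: D0_def)
  have injf: "inj_on ?f D0" using I D0I by (auto simp: tiling_def intro: inj_on_subset)
  have "?f ` D0 \<subseteq> covered a I" unfolding covered_def using D0I by blast
  also have "covered a I \<subseteq> X" using covered_subset[OF I _ bij] fin\<T> by blast
  finally have fX: "?f ` D0 \<subseteq> X" .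
  obtain j where j: "inj_on j D" "j ` D \<subseteq> X" "\<And>d. d \<in> D0 \<Longrightarrow> j d = ?f d"
    using extend_injection[OF fD X D0D injf fX] J(2) cardD by auto
  define acts where "acts T b \<longleftrightarrow>
     (\<forall>g\<in>carrier G. \<forall>t\<in>T. b g t \<in> T \<and> (g \<otimes>\<^bsub>G\<^esub> t \<in> T \<longrightarrow> b g t = g \<otimes>\<^bsub>G\<^esub> t)) \<and>
     (\<forall>g\<in>carrier G. \<forall>h\<in>carrier G. \<forall>t\<in>T. b (g \<otimes>\<^bsub>G\<^esub> h) t = b g (b h t))" for T b
  have "\<forall>T\<in>\<T>. \<exists>b. acts T b"
    using G.transversal_action \<T>(1) unfolding acts_def by blast
  from bchoice[OF this] obtain b where b: "\<And>T. T \<in> \<T> \<Longrightarrow> acts T (b T)" by blast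
  define B where "B g d = (fst d, b (?T (fst d)) g (snd d))" for g d
  have D\<T>: "?T (fst d) \<in> \<T>" "snd d \<in> ?T (fst d)" "fst d \<in> J" if "d \<in> D" for d
    using that J IT(1) by (auto simp: D_def)
  have "\<exists>\<Phi>. (\<forall>g\<in>carrier G. \<Phi> g permutes X \<and> (\<forall>d\<in>D. \<Phi> g (j d) = j (B g d))) \<and>
     (\<forall>g\<in>carrier G. \<forall>h\<in>carrier G. \<Phi> (g \<otimes>\<^bsub>G\<^esub> h) = \<Phi> g \<circ> \<Phi> h)"
  proof (rule G.transport_action[OF j(1,2)])
    fix d assume d: "d \<in> D"
    note bd = b[OF D\<T>(1)[OF d], unfolded acts_def]
    show "B g d \<in> D" if "g \<in> carrier G" for g
      using bd that D\<T>[OF d] by (auto simp: B_def D_def)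
    show "B (g \<otimes>\<^bsub>G\<^esub> h) d = B g (B h d)" if "g \<in> carrier G" "h \<in> carrier G" for g h
      using bd that D\<T>[OF d] by (simp add: B_def)
    have "snd d \<in> carrier G" using D\<T>[OF d] fin\<T> by blast
    then show "B \<one>\<^bsub>G\<^esub> d = d"
      using bd D\<T>[OF d] by (simp add: B_def)
  qed
  then obtain \<Phi> where \<Phi>: "\<And>g. g \<in> carrier G \<Longrightarrow> \<Phi> g permutes X"
    "\<And>g d. g \<in> carrier G \<Longrightarrow> d \<in> D \<Longrightarrow> \<Phi> g (j d) = j (B g d)"
    "\<And>g h. g \<in> carrier G \<Longrightarrow> h \<in> carrier G \<Longrightarrow> \<Phi> (g \<otimes>\<^bsub>G\<^esub> h) = \<Phi> g \<circ> \<Phi> h" by blast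
  have "real (card {x \<in> X. \<Phi> g x \<noteq> a g x}) \<le> (\<beta> + 3 * \<epsilon> + e) * real (card X)" if g: "g \<in> K" for g
  proof -
    have gG: "g \<in> carrier G" "g \<in> W" using g K by auto
    define A where "A i = {p \<in> ?P i. g \<otimes>\<^bsub>G\<^esub> p \<notin> ?P i}" for i
    define E where "E = (SIGMA i:J. A i)"
    \<comment> \<open>At a point coming from \<open>p\<close> in \<open>P\<close> with
      \<open>g \<otimes> p\<close> again in \<open>P\<close>, both maps are translation within the
      tile; so they disagree only off the embedded parts or where \<open>g\<close> leaves
      \<open>P\<close>.\<close>
    have "{x \<in> X. \<Phi> g x \<noteq> a g x} \<subseteq> (X - ?f ` D0) \<union> ?f ` E"
    proof
      fix x assume "x \<in> {x \<in> X. \<Phi> g x \<noteq> a g x}"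
      then have x: "x \<in> X" "\<Phi> g x \<noteq> a g x" by auto
      show "x \<in> (X - ?f ` D0) \<union> ?f ` E"
      proof (rule ccontr)
        assume neg: "\<not> ?thesis"
        then obtain d where d: "d \<in> D0" "x = ?f d" "d \<notin> E" using x by blast
        obtain y T P p where dd: "d = ((y, T, P), p)" by (metis prod.exhaust)
        have i: "(y, T, P) \<in> J" "(y, T, P) \<in> I" "p \<in> P" "g \<otimes>\<^bsub>G\<^esub> p \<in> P"
          using d(1,3) J(1) by (auto simp: dd D0_def E_def A_def)
        note tile = tilingD[OF I i(2)]
        have pT: "p \<in> T" "g \<otimes>\<^bsub>G\<^esub> p \<in> T" "T \<subseteq> W" using tile(3,4) i W by auto
        have gp: "((y, T, P), g \<otimes>\<^bsub>G\<^esub> p) \<in> D0" using i by (auto simp: D0_def)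
        have "\<Phi> g x = \<Phi> g (j d)" using j(3)[OF d(1)] d(2) by simp
        also have "\<dots> = j (B g d)" using \<Phi>(2)[OF gG(1)] d(1) D0D by blast
        also have "B g d = ((y, T, P), g \<otimes>\<^bsub>G\<^esub> p)"
          using b[OF tile(3)] pT gG(1) by (simp add: acts_def B_def dd)
        also have "j \<dots> = a (g \<otimes>\<^bsub>G\<^esub> p) y" using j(3)[OF gp] by simp
        also have "\<dots> = a g (a p y)"
          using tile(2) pT gG(2) by (auto simp: good_point_def)
        also have "a p y = x" by (simp add: d(2) dd)
        finally show False using x by simp
      qed
    qed
    moreover have "finite E" using finJ finJT by (auto simp: E_def A_def intro!: finite_SigmaI)
    ultimately have "card {x \<in> X. \<Phi> g x \<noteq> a g x} \<le> card (X - ?f ` D0) + card E"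
      using X by (meson card_Un_le card_image_le card_mono finite_Diff finite_UnI finite_imageI
          order_trans add_le_mono order_refl)
    moreover have "card (X - ?f ` D0) = card X - card D0"
      using X fX fD D0D injf by (subst card_Diff_subset) (auto intro: finite_subset simp: card_image)
    moreover have "card D0 \<le> card X"
      using X fX injf by (metis card_image card_mono)
    moreover have "(1 - \<epsilon>) * \<Sigma> \<le> real (card D0)"
      using IT(3) J(1) by (auto simp: cardD0 \<Sigma>_def sum_distrib_left intro!: sum_mono)
    moreover have "real (card E) \<le> (e + \<epsilon>) * \<Sigma>"
    proof -
      have "card E = (\<Sum>i\<in>J. card (A i))"
        unfolding E_def using finJ finJT by (intro card_SigmaI) (auto simp: A_def)
      also have "real \<dots> \<le> (\<Sum>i\<in>J. (e + \<epsilon>) * real (card (?T i)))"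
        unfolding of_nat_sum
      proof (rule sum_mono)
        fix i assume "i \<in> J"
        then have i: "i \<in> I" using J by blast
        note T = fin\<T>[OF IT(1)[OF i]]
        \<comment> \<open>A point leaving \<open>P\<close> either leaves the shape, which invariance
          controls, or lands in the shape minus \<open>P\<close>, which has at most a fraction
          \<open>\<epsilon>\<close> of it.\<close>
        have "card (A i) \<le> card (((K <#>\<^bsub>G\<^esub> ?T i) - ?T i) \<union> (?T i - ?P i))"
        proof (rule card_inj_on_le[where f = "\<lambda>p. g \<otimes>\<^bsub>G\<^esub> p"])
          have "A i \<subseteq> carrier G" using T IT(2)[OF i] by (auto simp: A_def)
          then show "inj_on (\<lambda>p. g \<otimes>\<^bsub>G\<^esub> p) (A i)" using gG by (intro inj_onI) (auto simp: subset_eq)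
          show "(\<lambda>p. g \<otimes>\<^bsub>G\<^esub> p) ` A i \<subseteq> ((K <#>\<^bsub>G\<^esub> ?T i) - ?T i) \<union> (?T i - ?P i)"
            using g IT(2)[OF i] by (auto simp: A_def set_mult_def)
        qed (use T K in \<open>auto simp: finite_set_mult\<close>)
        also have "\<dots> \<le> card ((K <#>\<^bsub>G\<^esub> ?T i) - ?T i) + card (?T i - ?P i)" by (rule card_Un_le)
        also have "card (?T i - ?P i) = card (?T i) - card (?P i)"
          using IT(2)[OF i] finT[OF i] by (intro card_Diff_subset) auto
        finally have "real (card (A i)) \<le> real (card ((K <#>\<^bsub>G\<^esub> ?T i) - ?T i)) + real (card (?T i) - card (?P i))"
          by (simp flip: of_nat_add)
        moreover have "real (card ((K <#>\<^bsub>G\<^esub> ?T i) - ?T i)) \<le> e * real (card (?T i))"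
          using \<T>(2)[OF IT(1)[OF i]] by (simp add: folner_def)
        moreover have "card (?P i) \<le> card (?T i)" using IT(2)[OF i] finT[OF i] by (intro card_mono)
        ultimately show "real (card (A i)) \<le> (e + \<epsilon>) * real (card (?T i))"
          using IT(3)[OF i] by (simp add: algebra_simps of_nat_diff)
      qed
      finally show ?thesis by (simp add: \<Sigma>_def sum_distrib_left)
    qed
    \<comment> \<open>At most \<open>card X - (1 - \<epsilon>) * \<Sigma>\<close> points lie off the
      embedded parts, and \<open>E\<close> contributes
      \<open>(e + \<epsilon>) * \<Sigma>\<close>.\<close>
    ultimately have "real (card {x \<in> X. \<Phi> g x \<noteq> a g x}) \<le> real (card X) - \<Sigma> + (e + 2 * \<epsilon>) * \<Sigma>"
      by (simp add: algebra_simps of_nat_diff)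
    also have "\<dots> \<le> (\<beta> + \<epsilon>) * real (card X) + (e + 2 * \<epsilon>) * real (card X)"
      using \<Sigma>_large \<Sigma> \<epsilon> by (intro add_mono mult_left_mono) auto
    also have "\<dots> = (\<beta> + 3 * \<epsilon> + e) * real (card X)" by (simp add: algebra_simps)
    finally show ?thesis .
  qed
  then show ?thesis using \<Phi> by blast
qed

section \<open>Polynomial maps and the relations of the universal group\<close>

lemma normal_closure_subset: "A \<subseteq> normal_closure G A"
  by (auto simp: normal_closure_def)

lemma normal_closure_least: "N \<lhd> G \<Longrightarrow> A \<subseteq> N \<Longrightarrow> normal_closure G A \<subseteq> N"
  by (auto simp: normal_closure_def)

lemma iter_deriv_Cons:
  "iter_deriv G H (g # gs) f x =
     iter_deriv G H gs f (g \<otimes>\<^bsub>G\<^esub> x) \<otimes>\<^bsub>H\<^esub> inv\<^bsub>H\<^esub> iter_deriv G H gs f x"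
  by (simp add: iter_deriv_def deriv_at_def)

text \<open>Derivatives only use products and inverses in the target, and homomorphisms preserve
  these.\<close>

lemma iter_deriv_hom:
  assumes "group G" "group H" "group H'" and h: "h \<in> hom H H'"
    and f: "f \<in> carrier G \<rightarrow> carrier H" "\<And>x. x \<in> carrier G \<Longrightarrow> f' x = h (f x)"
    and gs: "set gs \<subseteq> carrier G" and x: "x \<in> carrier G"
  shows "iter_deriv G H' gs f' x = h (iter_deriv G H gs f x)"
  using gs x
proof (induction gs arbitrary: x)
  case Nil
  then show ?case by (simp add: iter_deriv_def f(2))
next
  case (Cons g gs)
  interpret G: group G by fact
  interpret h: group_hom H H' h using assms by (simp add: group_hom_def group_hom_axioms_def)
  have "iter_deriv G H gs f \<in> carrier G \<rightarrow> carrier H"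
    using iter_deriv_closed[OF assms(1,2) f(1)] Cons.prems by simp
  then show ?case using Cons by (simp add: iter_deriv_Cons Pi_iff)
qed

text \<open>The first difference operator turns vanishing at \<open>\<one>\<close> into constancy.\<close>

lemma polynomial_map_iff_at_one:
  assumes "group G" "group H" "f \<in> carrier G \<rightarrow> carrier H"
  shows "polynomial_map s G H f \<longleftrightarrow>
    (\<forall>gs. set gs \<subseteq> carrier G \<and> length gs = s + 1 \<longrightarrow> iter_deriv G H gs f \<one>\<^bsub>G\<^esub> = \<one>\<^bsub>H\<^esub>)" (is "_ \<longleftrightarrow> ?R")
proof
  interpret G: group G by fact
  interpret H: group H by fact
  show ?R if "polynomial_map s G H f" using that by (auto simp: polynomial_map_def)
  assume R: ?R
  have "iter_deriv G H gs f x = \<one>\<^bsub>H\<^esub>"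
    if gs: "set gs \<subseteq> carrier G" "length gs = s + 1" and x: "x \<in> carrier G" for gs x
  proof -
    obtain g gs' where gs': "gs = g # gs'" using gs(2) by (cases gs) auto
    have cl: "iter_deriv G H gs' f \<in> carrier G \<rightarrow> carrier H"
      using iter_deriv_closed[OF assms] gs by (simp add: gs')
    have const: "iter_deriv G H gs' f y = iter_deriv G H gs' f \<one>\<^bsub>G\<^esub>" if y: "y \<in> carrier G" for y
    proof -
      have "iter_deriv G H (y # gs') f \<one>\<^bsub>G\<^esub> = \<one>\<^bsub>H\<^esub>" using R gs y by (simp add: gs')
      then show ?thesis using cl y by (auto simp: iter_deriv_Cons Pi_iff dest: H.inv_equality)
    qed
    show ?thesis
      using gs x const[of x] const[of "g \<otimes>\<^bsub>G\<^esub> x"] cl by (simp add: gs' iter_deriv_Cons Pi_iff)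
  qed
  then show "polynomial_map s G H f" using assms(3) by (simp add: polynomial_map_def)
qed

abbreviation relators :: "nat \<Rightarrow> ('a, 'b) monoid_scheme \<Rightarrow> 'a word set" where
  "relators s G \<equiv> {iter_deriv G (F_grp G) gs (iota G) \<one>\<^bsub>G\<^esub> | gs. set gs \<subseteq> carrier G \<and> length gs = s + 1}"

lemma finite_relators: "finite (carrier G) \<Longrightarrow> finite (relators s G)"
  using finite_lists_length_eq[of "carrier G" "s + 1"] by (simp add: setcompr_eq_image)

lemma relators_subset_R_sub: "relators s G \<subseteq> R_sub s G"
  unfolding R_sub_def by (rule normal_closure_subset)

lemma R_sub_closed: "group G \<Longrightarrow> R_sub s G \<subseteq> carrier (F_grp G)"
  using normal_imp_subgroup[OF R_sub_normal] by (rule subgroup.subset)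

lemma relators_closed: "group G \<Longrightarrow> relators s G \<subseteq> carrier (F_grp G)"
  using relators_subset_R_sub R_sub_closed by (rule order_trans)

lemma unital_map_lift:
  assumes "group H" "unital_map G H f"
  shows "free_lift H f \<in> hom (F_grp G) H" "\<And>g. g \<in> carrier G \<Longrightarrow> free_lift H f (iota G g) = f g"
proof -
  show "free_lift H f \<in> hom (F_grp G) H"
    unfolding F_grp_def using assms by (intro free_lift_hom) (auto simp: unital_map_def)
qed (rule free_lift_iota[OF assms])

text \<open>The universal property of \<open>Pol s G\<close>: derivatives of \<open>f\<close> at the
  unit are the images of the relators. A general \<open>h\<close> is allowed because it is applied
  both to \<open>free_lift\<close> and to a composite through \<open>Pol s G\<close>.\<close>

lemma polynomial_map_iff_relators:
  assumes "group G" "group H" and h: "h \<in> hom (F_grp G) H"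
    and f: "\<And>g. g \<in> carrier G \<Longrightarrow> f g = h (iota G g)"
  shows "polynomial_map s G H f \<longleftrightarrow> (\<forall>r\<in>relators s G. h r = \<one>\<^bsub>H\<^esub>)"
proof -
  interpret G: group G by fact
  have "f \<in> carrier G \<rightarrow> carrier H"
    using f iota_closed[of G] h by (auto simp: Pi_iff hom_def)
  then have "polynomial_map s G H f \<longleftrightarrow>
      (\<forall>gs. set gs \<subseteq> carrier G \<and> length gs = s + 1 \<longrightarrow> iter_deriv G H gs f \<one>\<^bsub>G\<^esub> = \<one>\<^bsub>H\<^esub>)"
    using polynomial_map_iff_at_one assms by blast
  moreover have "iter_deriv G H gs f \<one>\<^bsub>G\<^esub> = h (iter_deriv G (F_grp G) gs (iota G) \<one>\<^bsub>G\<^esub>)"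
    if "set gs \<subseteq> carrier G" for gs
    using that by (intro iter_deriv_hom assms F_grp_group iota_closed) auto
  ultimately show ?thesis by auto
qed

lemma hom_kills_R_sub:
  assumes "group G" "group H" and h: "h \<in> hom (F_grp G) H"
    and "\<And>r. r \<in> relators s G \<Longrightarrow> h r = \<one>\<^bsub>H\<^esub>" and r: "r \<in> R_sub s G"
  shows "h r = \<one>\<^bsub>H\<^esub>"
proof -
  interpret h: group_hom "F_grp G" H h
    using assms F_grp_group by (simp add: group_hom_def group_hom_axioms_def)
  have "R_sub s G \<subseteq> kernel (F_grp G) H h"
    unfolding R_sub_def using assms(4) relators_closed[OF assms(1), of s]
    by (intro normal_closure_least h.normal_kernel) (auto simp: kernel_def)
  then show ?thesis using r by (auto simp: kernel_def)
qed

section \<open>Word maps\<close>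

definition signed_letter :: "('h, 'b) monoid_scheme \<Rightarrow> ('a \<Rightarrow> 'h) \<Rightarrow> 'a \<times> bool \<Rightarrow> 'h" where
  "signed_letter H f a = (if snd a then f (fst a) else inv\<^bsub>H\<^esub> f (fst a))"

lemma free_lift_Cons: "free_lift H f (a # w) = signed_letter H f a \<otimes>\<^bsub>H\<^esub> free_lift H f w"
  by (simp add: free_lift_def signed_letter_def case_prod_beta)

lemma free_lift_Nil: "free_lift H f [] = \<one>\<^bsub>H\<^esub>"
  by (simp add: free_lift_def)

lemma hom_eq_free_lift:
  assumes "group H" and h: "h \<in> hom (F_grp G) H"
    and f: "\<And>g. g \<in> carrier G \<Longrightarrow> f g = h (iota G g)" and w: "w \<in> carrier (F_grp G)"
  shows "h w = free_lift H f w"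
  using w
proof (induction w)
  case Nil
  have "h \<one>\<^bsub>F_grp G\<^esub> = \<one>\<^bsub>H\<^esub>" by (rule hom_one[OF h F_grp_group assms(1)])
  then show ?case by (simp add: F_grp_def free_group_def free_lift_Nil)
next
  case (Cons a w)
  interpret h: group_hom "F_grp G" H h
    using assms F_grp_group by (simp add: group_hom_def group_hom_axioms_def)
  have red: "reduced (a # w)" and a: "fst a \<in> carrier G" "fst a \<noteq> \<one>\<^bsub>G\<^esub>"
    using Cons.prems by (auto simp: F_grp_def free_group_def)
  have w: "w \<in> carrier (F_grp G)" and a1: "[a] \<in> carrier (F_grp G)"
    using Cons.prems by (auto simp: F_grp_def free_group_def dest: reduced_ConsD)
  have i: "iota G (fst a) \<in> carrier (F_grp G)" using iota_closed[of G] a by blast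
  have "a # w = [a] \<otimes>\<^bsub>F_grp G\<^esub> w"
    using cons_red_reduced[OF red] by (simp add: F_grp_def free_group_def)
  then have "h (a # w) = h [a] \<otimes>\<^bsub>H\<^esub> h w" using w a1 by simp
  also have "h [a] = signed_letter H f a"
  proof (cases "snd a")
    case True
    then have "[a] = iota G (fst a)" using a by (simp add: iota_def prod_eq_iff)
    then show ?thesis using True a by (simp add: signed_letter_def f)
  next
    case False
    then have "[a] = inv\<^bsub>F_grp G\<^esub> iota G (fst a)" using a by (simp add: inv_iota prod_eq_iff)
    then show ?thesis using False a i by (simp add: signed_letter_def f)
  qed
  finally show ?case using Cons.IH[OF w] by (simp add: free_lift_Cons)
qed

text \<open>The map \<open>c\<close> intertwines each letter up to \<open>d\<close> points. Since
  the suffix already applied is a bijection, the exceptional set of the next letter is only pulled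
  back to one of no greater size, and errors add up along the word.\<close>

lemma card_word_defect:
  fixes \<alpha> :: "'l \<Rightarrow> 'x \<Rightarrow> 'x" and \<beta> :: "'l \<Rightarrow> 'y \<Rightarrow> 'y" and c :: "'x \<Rightarrow> 'y" and d :: real
  assumes X: "finite X" and bij: "\<And>a. a \<in> set w \<Longrightarrow> bij_betw (\<alpha> a) X X"
    and defect: "\<And>a. a \<in> set w \<Longrightarrow> real (card {x \<in> X. c (\<alpha> a x) \<noteq> \<beta> a (c x)}) \<le> d"
  shows "real (card {x \<in> X. c (foldr \<alpha> w x) \<noteq> foldr \<beta> w (c x)}) \<le> real (length w) * d"
  using bij defect
proof (induction w)
  case (Cons a w)
  have bw: "bij_betw (foldr \<alpha> w) X X"
    using Cons.prems(1)
  proof (induction w)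
    case Nil
    then show ?case by (simp add: bij_betw_def id_def)
  next
    case (Cons b w)
    then have "bij_betw (\<alpha> b \<circ> foldr \<alpha> w) X X" by (intro bij_betw_trans[of _ X X]) auto
    then show ?case by (simp add: comp_def)
  qed
  let ?B = "{x \<in> X. c (\<alpha> a (foldr \<alpha> w x)) \<noteq> \<beta> a (c (foldr \<alpha> w x))}"
  have "card ?B \<le> card {x \<in> X. c (\<alpha> a x) \<noteq> \<beta> a (c x)}"
    by (rule card_inj_on_le[where f = "foldr \<alpha> w"])
       (use bw X in \<open>auto simp: bij_betw_def intro: inj_on_subset\<close>)
  moreover have "{x \<in> X. c (foldr \<alpha> (a # w) x) \<noteq> foldr \<beta> (a # w) (c x)}
      \<subseteq> {x \<in> X. c (foldr \<alpha> w x) \<noteq> foldr \<beta> w (c x)} \<union> ?B" by auto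
  then have "card {x \<in> X. c (foldr \<alpha> (a # w) x) \<noteq> foldr \<beta> (a # w) (c x)}
      \<le> card {x \<in> X. c (foldr \<alpha> w x) \<noteq> foldr \<beta> w (c x)} + card ?B"
    using X by (intro order_trans[OF card_mono card_Un_le]) auto
  moreover have "real (card {x \<in> X. c (foldr \<alpha> w x) \<noteq> foldr \<beta> w (c x)}) \<le> real (length w) * d"
    using Cons by simp
  moreover have "real (card {x \<in> X. c (\<alpha> a x) \<noteq> \<beta> a (c x)}) \<le> d" using Cons.prems(2) by simp
  ultimately have "real (card {x \<in> X. c (foldr \<alpha> (a # w) x) \<noteq> foldr \<beta> (a # w) (c x)})
      \<le> real (length w) * d + d" by linarith
  then show ?case by (simp add: algebra_simps)
qed simp

section \<open>Permutations\<close>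

lemma sym_group_simps:
  "\<sigma> \<in> carrier (sym_group m) \<longleftrightarrow> \<sigma> permutes {1..m}" "\<sigma> \<otimes>\<^bsub>sym_group m\<^esub> \<tau> = \<sigma> \<circ> \<tau>"
  "\<one>\<^bsub>sym_group m\<^esub> = id"
  by (simp_all add: sym_group_def)

lemma free_lift_sym_group:
  "free_lift (sym_group m) f w x = foldr (signed_letter (sym_group m) f) w x"
  by (induction w) (simp_all add: free_lift_Nil free_lift_Cons sym_group_simps)

lemma card_filter_not: "finite A \<Longrightarrow> card {x \<in> A. P x} + card {x \<in> A. \<not> P x} = card A"
  using card_Int_Diff[of A "Collect P"] by (simp add: Int_def set_diff_eq)

lemma hamming_eq:
  assumes "\<sigma> permutes {1..m}" "\<tau> permutes {1..m}" "m \<ge> 1"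
  shows "hamming m \<sigma> \<tau> = real (card {i \<in> {1..m}. \<sigma> i \<noteq> \<tau> i}) / real m"
proof -
  have "(inv\<^bsub>sym_group m\<^esub> \<sigma> \<otimes>\<^bsub>sym_group m\<^esub> \<tau>) i = i \<longleftrightarrow> \<sigma> i = \<tau> i" for i
    using assms(1,2) permutes_inv_eq[OF assms(1), of "\<tau> i" i]
    by (auto simp: sym_group_simps)
  moreover have "card {i \<in> {1..m}. \<sigma> i = \<tau> i} + card {i \<in> {1..m}. \<sigma> i \<noteq> \<tau> i} = card {1..m}"
    by (rule card_filter_not) simp
  then have "real (card {i \<in> {1..m}. \<sigma> i = \<tau> i}) + real (card {i \<in> {1..m}. \<sigma> i \<noteq> \<tau> i}) = real m"
    by (simp flip: of_nat_add)
  ultimately show ?thesis using assms(3) by (simp add: hamming_def field_simps)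
qed

lemma hamming_one:
  assumes "\<sigma> permutes {1..m}" "m \<ge> 1"
  shows "hamming m \<sigma> \<one>\<^bsub>sym_group m\<^esub> < \<delta> \<longleftrightarrow> real (card {i \<in> {1..m}. \<sigma> i \<noteq> i}) < \<delta> * real m"
    "hamming m \<sigma> \<one>\<^bsub>sym_group m\<^esub> > 1 - \<delta> \<longleftrightarrow> real (card {i \<in> {1..m}. \<sigma> i = i}) < \<delta> * real m"
proof -
  have h: "hamming m \<sigma> \<one>\<^bsub>sym_group m\<^esub> = real (card {i \<in> {1..m}. \<sigma> i \<noteq> i}) / real m"
    using hamming_eq[OF assms(1) permutes_id assms(2)] by (simp add: sym_group_simps)
  have "card {i \<in> {1..m}. \<sigma> i = i} + card {i \<in> {1..m}. \<sigma> i \<noteq> i} = card {1..m}"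
    by (rule card_filter_not) simp
  then have "real (card {i \<in> {1..m}. \<sigma> i = i}) + real (card {i \<in> {1..m}. \<sigma> i \<noteq> i}) = real m"
    by (simp flip: of_nat_add)
  then show "hamming m \<sigma> \<one>\<^bsub>sym_group m\<^esub> < \<delta> \<longleftrightarrow> real (card {i \<in> {1..m}. \<sigma> i \<noteq> i}) < \<delta> * real m"
    "hamming m \<sigma> \<one>\<^bsub>sym_group m\<^esub> > 1 - \<delta> \<longleftrightarrow> real (card {i \<in> {1..m}. \<sigma> i = i}) < \<delta> * real m"
    using assms(2) by (auto simp: h field_simps)
qed

lemma strong_poly_approx_iff:
  assumes "m \<ge> 1" "unital_map G (sym_group m) f"
  shows "strong_poly_approx s G \<delta> m f \<longleftrightarrow>
    (\<forall>w\<in>carrier (F_grp G). real (length w) < 1 / \<delta> \<longrightarrow>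
       (w \<in> R_sub s G \<longrightarrow>
         real (card {i \<in> {1..m}. free_lift (sym_group m) f w i \<noteq> i}) < \<delta> * real m) \<and>
       (w \<notin> R_sub s G \<longrightarrow>
         real (card {i \<in> {1..m}. free_lift (sym_group m) f w i = i}) < \<delta> * real m))"
proof -
  have "free_lift (sym_group m) f w permutes {1..m}" if "w \<in> carrier (F_grp G)" for w
    using unital_map_lift(1)[OF sym_group_is_group assms(2)] that
    by (auto simp: hom_def sym_group_simps)
  then show ?thesis
    using assms by (simp add: strong_poly_approx_def word_length_F_grp hamming_one)
qed

lemma strong_poly_approx_mono:
  assumes "strong_poly_approx s G \<delta> m f" "0 < \<delta>" "\<delta> \<le> \<delta>'"
  shows "strong_poly_approx s G \<delta>' m f"
proof -
  have "1 / \<delta>' \<le> 1 / \<delta>" using assms by (simp add: frac_le)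
  then show ?thesis using assms by (fastforce simp: strong_poly_approx_def)
qed

section \<open>Strong approximations of the universal polynomial group\<close>

definition pol_class :: "nat \<Rightarrow> ('a, 'b) monoid_scheme \<Rightarrow> 'a word \<Rightarrow> 'a word set" where
  "pol_class s G w = R_sub s G #>\<^bsub>F_grp G\<^esub> w"

lemma pol_class_hom:
  assumes "group G"
  shows "pol_class s G \<in> hom (F_grp G) (Pol s G)"
proof -
  interpret normal "R_sub s G" "F_grp G" using assms by (rule R_sub_normal)
  show ?thesis using r_coset_hom_Mod by (simp add: Pol_def pol_class_def[abs_def])
qed

lemma pol_class_surj: "X \<in> carrier (Pol s G) \<Longrightarrow> \<exists>w\<in>carrier (F_grp G). pol_class s G w = X"
  by (auto simp: Pol_def pol_class_def FactGroup_def RCOSETS_def)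

lemma pol_class_eq_one:
  assumes "group G" "w \<in> carrier (F_grp G)"
  shows "pol_class s G w = \<one>\<^bsub>Pol s G\<^esub> \<longleftrightarrow> w \<in> R_sub s G"
proof -
  interpret group "F_grp G" by (rule F_grp_group)
  have R: "subgroup (R_sub s G) (F_grp G)"
    using R_sub_normal[OF assms(1)] by (rule normal_imp_subgroup)
  show ?thesis
    using coset_join1[OF _ assms(2) R] coset_join2[OF assms(2) R]
    by (auto simp: Pol_def pol_class_def FactGroup_def)
qed

lemma pol_class_eq_iff:
  assumes "group G" "v \<in> carrier (F_grp G)" "w \<in> carrier (F_grp G)"
  shows "pol_class s G v = pol_class s G w \<longleftrightarrow> inv\<^bsub>F_grp G\<^esub> v \<otimes>\<^bsub>F_grp G\<^esub> w \<in> R_sub s G"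
proof -
  interpret F: group "F_grp G" by (rule F_grp_group)
  interpret P: group "Pol s G" using assms(1) by (rule Pol_group)
  interpret h: group_hom "F_grp G" "Pol s G" "pol_class s G"
    using pol_class_hom[OF assms(1)] by unfold_locales
  have "pol_class s G v = pol_class s G w \<longleftrightarrow> pol_class s G (inv\<^bsub>F_grp G\<^esub> v \<otimes>\<^bsub>F_grp G\<^esub> w) = \<one>\<^bsub>Pol s G\<^esub>"
    using assms P.inv_solve_left[of "\<one>\<^bsub>Pol s G\<^esub>" "pol_class s G v" "pol_class s G w"] by auto
  also have "\<dots> \<longleftrightarrow> inv\<^bsub>F_grp G\<^esub> v \<otimes>\<^bsub>F_grp G\<^esub> w \<in> R_sub s G"
    using assms by (intro pol_class_eq_one) auto
  finally show ?thesis .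
qed

text \<open>The generators act on a Folner set of \<open>Pol s G\<close> by partial left translations, which are
  completed to permutations.\<close>

theorem amenable_imp_strong_poly_approx:
  fixes G :: "('a, 'b) monoid_scheme"
  assumes G: "group G" "finite (carrier G)" and am: "amenable (Pol s G)" and \<delta>: "\<delta> > 0"
  shows "\<exists>m\<ge>1. \<exists>f. strong_poly_approx s G \<delta> m f"
proof -
  let ?\<Gamma> = "Pol s G"
  interpret G: group G by fact
  interpret P: group "?\<Gamma>" using G(1) by (rule Pol_group)
  interpret h: group_hom "F_grp G" ?\<Gamma> "pol_class s G"
    using pol_class_hom[OF G(1)] F_grp_group by (simp add: group_hom_def group_hom_axioms_def P.is_group)
  define \<gamma> where "\<gamma> g = pol_class s G (iota G g)" for g
  have \<gamma>: "\<gamma> g \<in> carrier ?\<Gamma>" if "g \<in> carrier G" for g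
    using h.hom_closed[OF funcset_mem[OF iota_closed that]] by (simp add: \<gamma>_def)
  \<comment> \<open>Inverses are included because words also contain inverse letters.\<close>
  define K where "K = \<gamma> ` carrier G \<union> (\<lambda>g. inv\<^bsub>?\<Gamma>\<^esub> \<gamma> g) ` carrier G"
  have K: "finite K" "K \<subseteq> carrier ?\<Gamma>" using G(2) \<gamma> by (auto simp: K_def)
  have letterK: "signed_letter ?\<Gamma> \<gamma> a \<in> K" if "fst a \<in> carrier G" for a
    using that by (auto simp: signed_letter_def K_def)
  \<comment> \<open>A word of length below \<open>1 / \<delta>\<close> with error
    \<open>\<delta>\<^sup>2 / 2\<close> per letter stays within \<open>\<delta> / 2\<close>.\<close>
  define \<epsilon> where "\<epsilon> = \<delta>\<^sup>2 / 2"
  have "\<epsilon> > 0" using \<delta> by (simp add: \<epsilon>_def)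
  then obtain S where S: "folner ?\<Gamma> K \<epsilon> S" using P.amenable_imp_folner[OF am K] by blast
  have S': "S \<subseteq> carrier ?\<Gamma>" "finite S" "S \<noteq> {}" using S by (auto simp: folner_def)
  define m where "m = card S"
  define X where "X = {1..m}"
  have finX: "finite X" by (simp add: X_def)
  have m: "m \<ge> 1" using S' by (simp add: m_def Suc_le_eq card_gt_0_iff)
  obtain c where c: "bij_betw c X S" using ex_bij_betw_nat_finite_1[OF S'(2)] by (auto simp: X_def m_def)
  have cX: "c i \<in> S" "c i \<in> carrier ?\<Gamma>" if "i \<in> X" for i using c that S' by (auto simp: bij_betw_def)
  have cinj: "i = j" if "i \<in> X" "j \<in> X" "c i = c j" for i j using c that by (auto simp: bij_betw_def inj_on_def)
  define e where "e = inv_into X c"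
  have e: "e y \<in> X" "c (e y) = y" if "y \<in> S" for y
    using c that by (auto simp: e_def bij_betw_def inv_into_into f_inv_into_f)
  have "\<exists>\<sigma>. \<sigma> permutes X \<and> (\<forall>i\<in>X. \<gamma> g \<otimes>\<^bsub>?\<Gamma>\<^esub> c i \<in> S \<longrightarrow> c (\<sigma> i) = \<gamma> g \<otimes>\<^bsub>?\<Gamma>\<^esub> c i)"
    if g: "g \<in> carrier G" for g
  proof -
    let ?D = "{i \<in> X. \<gamma> g \<otimes>\<^bsub>?\<Gamma>\<^esub> c i \<in> S}" and ?p = "\<lambda>i. e (\<gamma> g \<otimes>\<^bsub>?\<Gamma>\<^esub> c i)"
    have "inj_on ?p ?D"
    proof (rule inj_onI)
      fix i j assume ij: "i \<in> ?D" "j \<in> ?D" "?p i = ?p j"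
      have "\<gamma> g \<otimes>\<^bsub>?\<Gamma>\<^esub> c i = c (?p i)" using ij(1) e(2) by simp
      also have "\<dots> = c (?p j)" using ij(3) by (rule arg_cong)
      also have "\<dots> = \<gamma> g \<otimes>\<^bsub>?\<Gamma>\<^esub> c j" using ij(2) e(2) by simp
      finally show "i = j" using ij cX(2) \<gamma>[OF g] by (intro cinj) simp_all
    qed
    moreover have "?D \<subseteq> X" "?p ` ?D \<subseteq> X" using e(1) by auto
    ultimately obtain j where j: "inj_on j X" "j ` X \<subseteq> X" "\<And>i. i \<in> ?D \<Longrightarrow> j i = ?p i"
      using extend_injection[OF finX finX _ _ _ order_refl, of ?D ?p] by blast
    define \<sigma> where "\<sigma> i = (if i \<in> X then j i else i)" for i
    have "bij_betw j X X" using j(1,2) endo_inj_surj[OF finX j(2,1)] by (simp add: bij_betw_def)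
    then have "bij_betw \<sigma> X X" by (rule iffD1[OF bij_betw_cong, rotated]) (simp add: \<sigma>_def)
    then have "\<sigma> permutes X" by (rule bij_imp_permutes) (simp add: \<sigma>_def)
    moreover have "c (\<sigma> i) = \<gamma> g \<otimes>\<^bsub>?\<Gamma>\<^esub> c i" if "i \<in> X" "\<gamma> g \<otimes>\<^bsub>?\<Gamma>\<^esub> c i \<in> S" for i
      using that j(3)[of i] e by (simp add: \<sigma>_def)
    ultimately show ?thesis by blast
  qed
  then have "\<forall>g\<in>carrier G. \<exists>\<sigma>. \<sigma> permutes X \<and> (\<forall>i\<in>X. \<gamma> g \<otimes>\<^bsub>?\<Gamma>\<^esub> c i \<in> S \<longrightarrow> c (\<sigma> i) = \<gamma> g \<otimes>\<^bsub>?\<Gamma>\<^esub> c i)"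
    by blast
  from bchoice[OF this] obtain f where perm: "\<And>g. g \<in> carrier G \<Longrightarrow> f g permutes X"
    and f: "\<And>g i. g \<in> carrier G \<Longrightarrow> i \<in> X \<Longrightarrow> \<gamma> g \<otimes>\<^bsub>?\<Gamma>\<^esub> c i \<in> S \<Longrightarrow> c (f g i) = \<gamma> g \<otimes>\<^bsub>?\<Gamma>\<^esub> c i"
    by blast
  have perm_in: "f g i \<in> X" if "g \<in> carrier G" "i \<in> X" for g i
    using permutes_in_image[OF perm] that by blast
  have "\<gamma> \<one>\<^bsub>G\<^esub> = \<one>\<^bsub>?\<Gamma>\<^esub>" using h.hom_one by (simp add: \<gamma>_def iota_def F_grp_def free_group_def)
  \<comment> \<open>Translation by the unit moves no point out of \<open>S\<close>, so its
    completion has no freedom and the map is unital.\<close>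
  then have "f \<one>\<^bsub>G\<^esub> i = i" for i
  proof (cases "i \<in> X")
    case True
    then show ?thesis
      using f[of "\<one>\<^bsub>G\<^esub>" i] cX[OF True] perm_in[of "\<one>\<^bsub>G\<^esub>" i] \<open>\<gamma> \<one>\<^bsub>G\<^esub> = \<one>\<^bsub>?\<Gamma>\<^esub>\<close> by (intro cinj) auto
  qed (use permutes_not_in[OF perm] in blast)
  then have unital: "unital_map G (sym_group m) f"
    using perm by (auto simp: unital_map_def sym_group_simps X_def fun_eq_iff)
  let ?\<alpha> = "signed_letter (sym_group m) f" and ?\<beta> = "\<lambda>a y. signed_letter ?\<Gamma> \<gamma> a \<otimes>\<^bsub>?\<Gamma>\<^esub> y"
  have \<alpha>: "?\<alpha> a permutes X" if "fst a \<in> carrier G" for a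
    using perm[OF that] by (simp add: signed_letter_def sym_group_simps X_def permutes_inv)
  have defect: "real (card {i \<in> X. c (?\<alpha> a i) \<noteq> ?\<beta> a (c i)}) \<le> \<epsilon> * real m"
    if a: "fst a \<in> carrier G" for a
  proof -
    have l: "signed_letter ?\<Gamma> \<gamma> a \<in> carrier ?\<Gamma>" using letterK[OF a] K by blast
    \<comment> \<open>For an inverse letter, if the translate \<open>?y\<close> of
      \<open>c i\<close> by the inverse lies in \<open>S\<close>, then the forward permutation sends
      the index of \<open>?y\<close> to \<open>i\<close>.\<close>
    have agree: "c (?\<alpha> a i) = ?\<beta> a (c i)" if i: "i \<in> X" "?\<beta> a (c i) \<in> S" for i
    proof (cases "snd a")
      case True
      then show ?thesis using i f[OF a i(1)] by (simp add: signed_letter_def)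
    next
      case False
      let ?y = "inv\<^bsub>?\<Gamma>\<^esub> \<gamma> (fst a) \<otimes>\<^bsub>?\<Gamma>\<^esub> c i"
      have y: "?y \<in> S" using False i by (simp add: signed_letter_def)
      have "\<gamma> (fst a) \<otimes>\<^bsub>?\<Gamma>\<^esub> c (e ?y) = c i"
        using e(2)[OF y] \<gamma>[OF a] cX[OF i(1)] by (simp add: P.m_assoc[symmetric])
      then have "c (f (fst a) (e ?y)) = c i" using f[OF a e(1)[OF y]] cX[OF i(1)] by simp
      then have "f (fst a) (e ?y) = i" using cinj perm_in[OF a e(1)[OF y]] i by blast
      then have "inv' (f (fst a)) i = e ?y" using permutes_inv_eq[OF perm[OF a]] by blast
      then show ?thesis
        using False e(2)[OF y] perm[OF a] by (simp add: signed_letter_def sym_group_simps X_def)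
    qed
    have "card {i \<in> X. c (?\<alpha> a i) \<noteq> ?\<beta> a (c i)} \<le> card ((K <#>\<^bsub>?\<Gamma>\<^esub> S) - S)"
    proof (rule card_inj_on_le[where f = "\<lambda>i. ?\<beta> a (c i)"])
      show "inj_on (\<lambda>i. ?\<beta> a (c i)) {i \<in> X. c (?\<alpha> a i) \<noteq> ?\<beta> a (c i)}"
        using l cX(2) by (intro inj_onI cinj) simp_all
      show "(\<lambda>i. ?\<beta> a (c i)) ` {i \<in> X. c (?\<alpha> a i) \<noteq> ?\<beta> a (c i)} \<subseteq> (K <#>\<^bsub>?\<Gamma>\<^esub> S) - S"
        using agree letterK[OF a] cX(1) unfolding set_mult_def by blast
    qed (use K S' in \<open>simp add: finite_set_mult\<close>)
    then show ?thesis using S by (simp add: folner_def m_def)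
  qed
  have words: "real (card {i \<in> X. c (free_lift (sym_group m) f w i) \<noteq> pol_class s G w \<otimes>\<^bsub>?\<Gamma>\<^esub> c i}) < \<delta> * real m"
    if w: "w \<in> carrier (F_grp G)" "real (length w) < 1 / \<delta>" for w
  proof -
    have letters: "fst a \<in> carrier G" if "a \<in> set w" for a
      using w(1) that by (auto simp: F_grp_def free_group_def)
    then have ls: "fst ` set w \<subseteq> carrier G" by blast
    have free_closed: "free_lift ?\<Gamma> \<gamma> v \<in> carrier ?\<Gamma>" if "fst ` set v \<subseteq> carrier G" for v
      using that
    proof (induction v)
      case (Cons a v)
      then show ?case using letterK[of a] K(2) by (simp add: free_lift_Cons subset_eq)
    qed (simp add: free_lift_Nil)
    have "foldr ?\<beta> v y = free_lift ?\<Gamma> \<gamma> v \<otimes>\<^bsub>?\<Gamma>\<^esub> y" if "fst ` set v \<subseteq> carrier G" "y \<in> carrier ?\<Gamma>" for v y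
      using that(1)
    proof (induction v)
      case (Cons a v)
      then have "signed_letter ?\<Gamma> \<gamma> a \<in> carrier ?\<Gamma>" using letterK[of a] K by auto
      then show ?case using Cons free_closed that(2) by (simp add: free_lift_Cons P.m_assoc)
    qed (use that in \<open>simp add: free_lift_Nil\<close>)
    moreover have "pol_class s G w = free_lift ?\<Gamma> \<gamma> w"
      using hom_eq_free_lift[OF P.is_group h.homh _ w(1), of \<gamma>] by (simp add: \<gamma>_def)
    ultimately have \<beta>w: "foldr ?\<beta> w (c i) = pol_class s G w \<otimes>\<^bsub>?\<Gamma>\<^esub> c i" if "i \<in> X" for i
      using ls cX(2)[OF that] by simp
    have "real (card {i \<in> X. c (foldr ?\<alpha> w i) \<noteq> foldr ?\<beta> w (c i)}) \<le> real (length w) * (\<epsilon> * real m)"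
      using letters \<alpha> defect by (intro card_word_defect) (auto simp: X_def permutes_imp_bij)
    also have "\<dots> = (real (length w) * \<delta>) * (\<delta> / 2 * real m)" by (simp add: \<epsilon>_def power2_eq_square)
    also have "\<dots> \<le> 1 * (\<delta> / 2 * real m)"
      using w(2) \<delta> by (intro mult_right_mono) (auto simp: field_simps)
    also have "\<dots> < \<delta> * real m" using \<delta> m by simp
    finally have "real (card {i \<in> X. c (foldr ?\<alpha> w i) \<noteq> foldr ?\<beta> w (c i)}) < \<delta> * real m" .
    moreover have "{i \<in> X. c (foldr ?\<alpha> w i) \<noteq> foldr ?\<beta> w (c i)} =
        {i \<in> X. c (free_lift (sym_group m) f w i) \<noteq> pol_class s G w \<otimes>\<^bsub>?\<Gamma>\<^esub> c i}"
      using \<beta>w by (simp add: free_lift_sym_group cong: conj_cong)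
    ultimately show ?thesis by simp
  qed
  have "strong_poly_approx s G \<delta> m f"
    unfolding strong_poly_approx_iff[OF m unital]
  proof (intro ballI impI conjI)
    fix w assume w: "w \<in> carrier (F_grp G)" "real (length w) < 1 / \<delta>"
    let ?B = "{i \<in> X. c (free_lift (sym_group m) f w i) \<noteq> pol_class s G w \<otimes>\<^bsub>?\<Gamma>\<^esub> c i}"
    have fin: "finite ?B" by (simp add: X_def)
    have hw: "pol_class s G w \<in> carrier ?\<Gamma>" using w by simp
    have "free_lift (sym_group m) f w permutes X"
      using unital_map_lift(1)[OF sym_group_is_group unital] w(1)
      by (auto simp: hom_def sym_group_simps X_def)
    then have in_X: "free_lift (sym_group m) f w i \<in> X" if "i \<in> X" for i
      using that by (simp add: permutes_in_image)
    show "real (card {i \<in> {1..m}. free_lift (sym_group m) f w i \<noteq> i}) < \<delta> * real m" if "w \<in> R_sub s G"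
    proof -
      have "pol_class s G w = \<one>\<^bsub>?\<Gamma>\<^esub>" using pol_class_eq_one[OF G(1) w(1)] that by blast
      then have "{i \<in> {1..m}. free_lift (sym_group m) f w i \<noteq> i} \<subseteq> ?B"
        using cX(2) cinj in_X unfolding X_def[symmetric] by force
      then have "card {i \<in> {1..m}. free_lift (sym_group m) f w i \<noteq> i} \<le> card ?B"
        using fin by (intro card_mono)
      then show ?thesis using words[OF w] by linarith
    qed
    show "real (card {i \<in> {1..m}. free_lift (sym_group m) f w i = i}) < \<delta> * real m" if "w \<notin> R_sub s G"
    proof -
      have "pol_class s G w \<noteq> \<one>\<^bsub>?\<Gamma>\<^esub>" using pol_class_eq_one[OF G(1) w(1)] that by blast
      \<comment> \<open>A nontrivial left translation has no fixed points, so every fixed point of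
        the permutation is a place where it fails to imitate the translation.\<close>
      then have "c i \<noteq> pol_class s G w \<otimes>\<^bsub>?\<Gamma>\<^esub> c i" if "i \<in> X" for i
        using cX[OF that] hw P.r_cancel_one' by blast
      then have "{i \<in> {1..m}. free_lift (sym_group m) f w i = i} \<subseteq> ?B"
        unfolding X_def[symmetric] by auto
      then have "card {i \<in> {1..m}. free_lift (sym_group m) f w i = i} \<le> card ?B"
        using fin by (intro card_mono)
      then show ?thesis using words[OF w] by linarith
    qed
  qed
  then show ?thesis using m by blast
qed

section \<open>Stability implies residual finiteness\<close>

lemma hom_finite_separates:
  assumes "group G" "group H" "finite (carrier H)" "h \<in> hom G H" "g \<in> carrier G" "h g \<noteq> \<one>\<^bsub>H\<^esub>"
  shows "\<exists>N. N \<lhd> G \<and> finite (carrier (G Mod N)) \<and> g \<notin> N"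
proof -
  interpret h: group_hom G H h using assms by (simp add: group_hom_def group_hom_axioms_def)
  have "(\<lambda>X. the_elem (h ` X)) ` carrier (G Mod kernel G H h) \<subseteq> carrier H"
    using h.FactGroup_the_elem_mem by blast
  then have "finite (carrier (G Mod kernel G H h))"
    using assms(3) h.FactGroup_inj_on by (meson finite_imageD finite_subset)
  then show ?thesis using assms(5,6) h.normal_kernel by (intro exI[of _ "kernel G H h"]) (auto simp: kernel_def)
qed

text \<open>At the point \<open>\<sigma> j\<close> the inverses agree iff \<open>\<sigma>\<close>
  and \<open>\<tau>\<close> agree at \<open>j\<close>. This extends estimates for generators to
  inverse letters.\<close>

lemma card_inv_disagree:
  assumes \<sigma>: "\<sigma> permutes X" and \<tau>: "\<tau> permutes X" and X: "finite X"
  shows "card {i \<in> X. inv' \<sigma> i \<noteq> inv' \<tau> i} \<le> card {i \<in> X. \<sigma> i \<noteq> \<tau> i}"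
proof -
  have "{i \<in> X. inv' \<sigma> i \<noteq> inv' \<tau> i} \<subseteq> \<sigma> ` {i \<in> X. \<sigma> i \<noteq> \<tau> i}"
  proof
    fix i assume i: "i \<in> {i \<in> X. inv' \<sigma> i \<noteq> inv' \<tau> i}"
    have "\<sigma> (inv' \<sigma> i) = i" using permutes_inverses(1)[OF \<sigma>] .
    moreover have "\<tau> (inv' \<sigma> i) \<noteq> i" using i permutes_inverses(2)[OF \<tau>] by (metis (mono_tags, lifting) mem_Collect_eq)
    moreover have "inv' \<sigma> i \<in> X" using i permutes_in_image[OF permutes_inv[OF \<sigma>]] by simp
    ultimately show "i \<in> \<sigma> ` {i \<in> X. \<sigma> i \<noteq> \<tau> i}" by (intro image_eqI[of _ _ "inv' \<sigma> i"]) auto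
  qed
  then have "card {i \<in> X. inv' \<sigma> i \<noteq> inv' \<tau> i} \<le> card (\<sigma> ` {i \<in> X. \<sigma> i \<noteq> \<tau> i})"
    using X by (intro card_mono) auto
  also have "\<dots> \<le> card {i \<in> X. \<sigma> i \<noteq> \<tau> i}" using X by (intro card_image_le) auto
  finally show ?thesis .
qed

theorem weakly_P_stable_imp_residually_finite:
  fixes G :: "('a, 'b) monoid_scheme"
  assumes G: "group G" "finite (carrier G)" and am: "amenable (Pol s G)" and st: "weakly_P_stable s G"
  shows "residually_finite (Pol s G)"
  unfolding residually_finite_def
proof
  let ?\<Gamma> = "Pol s G"
  interpret G: group G by fact
  interpret P: group "?\<Gamma>" using G(1) by (rule Pol_group)
  fix x assume x: "x \<in> carrier ?\<Gamma> - {\<one>\<^bsub>?\<Gamma>\<^esub>}"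
  then obtain w where w: "w \<in> carrier (F_grp G)" "pol_class s G w = x" using pol_class_surj by blast
  have wR: "w \<notin> R_sub s G" using pol_class_eq_one[OF G(1) w(1)] w(2) x by blast
  \<comment> \<open>Replacing \<open>f\<close> by \<open>q\<close> changes the image of
    \<open>w\<close> at no more than a quarter of the points.\<close>
  define \<epsilon> where "\<epsilon> = 1 / (4 * (real (length w) + 1))"
  have "\<epsilon> > 0" by (simp add: \<epsilon>_def add_pos_nonneg)
  then obtain \<delta>\<^sub>0 where \<delta>0: "\<delta>\<^sub>0 > 0" and stable: "\<And>m f. m \<ge> 1 \<Longrightarrow> strong_poly_approx s G \<delta>\<^sub>0 m f \<Longrightarrow>
      \<exists>q. unital_map G (sym_group m) q \<and> polynomial_map s G (sym_group m) q \<and>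
        (MAX g \<in> carrier G. hamming m (f g) (q g)) < \<epsilon>"
    using st unfolding weakly_P_stable_def by blast
  \<comment> \<open>The second bound does two things: \<open>w\<close> is short enough to be tested,
    and \<open>\<delta> \<le> 1 / 2\<close>, so fewer than half of the points are fixed by
    \<open>w\<close> under \<open>f\<close>.\<close>
  define \<delta> where "\<delta> = min \<delta>\<^sub>0 (1 / (2 * (real (length w) + 1)))"
  have \<delta>: "\<delta> > 0" "\<delta> \<le> \<delta>\<^sub>0" "\<delta> \<le> 1 / (2 * (real (length w) + 1))"
    using \<delta>0 by (auto simp: \<delta>_def add_pos_nonneg)
  have "\<delta> \<le> 1 / 2" using \<delta>(3) by (rule order_trans) (simp add: field_simps)
  have len: "real (length w) < 1 / \<delta>"
  proof -
    have "real (length w) < 2 * (real (length w) + 1)" by simp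
    also have "\<dots> \<le> 1 / \<delta>" using \<delta>(1,3) by (simp add: field_simps)
    finally show ?thesis .
  qed
  obtain m f where m: "m \<ge> 1" and f: "strong_poly_approx s G \<delta> m f"
    using amenable_imp_strong_poly_approx[OF G am \<delta>(1)] by blast
  obtain q where q: "unital_map G (sym_group m) q" "polynomial_map s G (sym_group m) q"
    and close: "(MAX g \<in> carrier G. hamming m (f g) (q g)) < \<epsilon>"
    using stable[OF m strong_poly_approx_mono[OF f \<delta>(1,2)]] by blast
  have unital: "unital_map G (sym_group m) f" using f by (simp add: strong_poly_approx_def)
  have perm: "f g permutes {1..m}" "q g permutes {1..m}" if "g \<in> carrier G" for g
    using unital q(1) that by (auto simp: unital_map_def sym_group_simps Pi_iff)
  have close': "real (card {i \<in> {1..m}. f g i \<noteq> q g i}) \<le> \<epsilon> * real m" if g: "g \<in> carrier G" for g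
  proof -
    have "hamming m (f g) (q g) \<le> (MAX g \<in> carrier G. hamming m (f g) (q g))"
      using G(2) g by (intro Max_ge) auto
    then have "hamming m (f g) (q g) < \<epsilon>" using close by linarith
    then show ?thesis using hamming_eq[OF perm[OF g] m] m by (simp add: field_simps)
  qed
  let ?\<alpha> = "signed_letter (sym_group m) f" and ?\<beta> = "signed_letter (sym_group m) q"
  let ?f = "free_lift (sym_group m) f" and ?q = "free_lift (sym_group m) q"
  have letters: "fst a \<in> carrier G" if "a \<in> set w" for a
    using w(1) that by (auto simp: F_grp_def free_group_def)
  have \<alpha>: "?\<alpha> a permutes {1..m}" if "a \<in> set w" for a
    using perm(1)[OF letters[OF that]] by (simp add: signed_letter_def sym_group_simps permutes_inv)
  have defect: "real (card {i \<in> {1..m}. id (?\<alpha> a i) \<noteq> ?\<beta> a (id i)}) \<le> \<epsilon> * real m" if "a \<in> set w" for a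
  proof -
    note p = perm[OF letters[OF that]]
    have "card {i \<in> {1..m}. id (?\<alpha> a i) \<noteq> ?\<beta> a (id i)} \<le> card {i \<in> {1..m}. f (fst a) i \<noteq> q (fst a) i}"
      using card_inv_disagree[OF p] p by (cases "snd a") (simp_all add: signed_letter_def sym_group_simps)
    then show ?thesis using close'[OF letters[OF that]] by linarith
  qed
  have "real (card {i \<in> {1..m}. id (foldr ?\<alpha> w i) \<noteq> foldr ?\<beta> w (id i)}) \<le> real (length w) * (\<epsilon> * real m)"
    using \<alpha> defect by (intro card_word_defect) (auto simp: permutes_imp_bij)
  then have dist: "real (card {i \<in> {1..m}. ?f w i \<noteq> ?q w i}) \<le> real (length w) * \<epsilon> * real m"
    by (simp add: free_lift_sym_group mult.assoc)
  have qw: "?q w \<noteq> id"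
  proof
    assume "?q w = id"
    then have "real (card {i \<in> {1..m}. ?f w i \<noteq> i}) \<le> real (length w) * \<epsilon> * real m" using dist by simp
    moreover have "real (length w) * \<epsilon> \<le> 1 / 4" by (simp add: \<epsilon>_def field_simps)
    then have "real (length w) * \<epsilon> * real m \<le> 1 / 4 * real m" by (intro mult_right_mono) auto
    moreover have "real (card {i \<in> {1..m}. ?f w i = i}) < \<delta> * real m"
      using f w(1) wR len by (simp add: strong_poly_approx_iff[OF m unital])
    moreover have "\<delta> * real m \<le> 1 / 2 * real m" using \<open>\<delta> \<le> 1 / 2\<close> by (intro mult_right_mono) auto
    moreover have "card {i \<in> {1..m}. ?f w i = i} + card {i \<in> {1..m}. ?f w i \<noteq> i} = m"
      using card_filter_not[of "{1..m}" "\<lambda>i. ?f w i = i"] by simp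
    then have "real (card {i \<in> {1..m}. ?f w i = i}) + real (card {i \<in> {1..m}. ?f w i \<noteq> i}) = real m"
      by (simp flip: of_nat_add)
    moreover have "real m > 0" using m by simp
    ultimately show False by linarith
  qed
  note lift = unital_map_lift[OF sym_group_is_group q(1)]
  interpret Q: group_hom "F_grp G" "sym_group m" ?q
    using lift(1) F_grp_group sym_group_is_group by (simp add: group_hom_def group_hom_axioms_def)
  have "\<forall>r\<in>relators s G. ?q r = \<one>\<^bsub>sym_group m\<^esub>"
    using polynomial_map_iff_relators[OF G(1) sym_group_is_group lift(1), of q s] lift(2) q(2) by simp
  then have "?q r = \<one>\<^bsub>sym_group m\<^esub>" if "r \<in> R_sub s G" for r
    using hom_kills_R_sub[OF G(1) sym_group_is_group lift(1) _ that] by blast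
  moreover have "R_sub s G \<subseteq> carrier (F_grp G)" using G(1) by (rule R_sub_closed)
  ultimately have "R_sub s G \<subseteq> kernel (F_grp G) (sym_group m) ?q"
    by (auto simp: kernel_def)
  \<comment> \<open>Being polynomial, \<open>q\<close> factors through \<open>Pol s G\<close>; the
    result is a homomorphism to a finite group that is nontrivial at \<open>x\<close>.\<close>
  then obtain \<phi> where \<phi>: "\<phi> \<in> hom ?\<Gamma> (sym_group m)"
    "\<And>v. v \<in> carrier (F_grp G) \<Longrightarrow> \<phi> (pol_class s G v) = ?q v"
    using Q.FactGroup_universal_kernel[OF R_sub_normal[OF G(1)]] unfolding Pol_def pol_class_def by blast
  have "finite (carrier (sym_group m))" by (simp add: sym_group_def finite_permutations)
  then show "\<exists>N. N \<lhd> ?\<Gamma> \<and> finite (carrier (?\<Gamma> Mod N)) \<and> x \<notin> N"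
    using hom_finite_separates[OF P.is_group sym_group_is_group _ \<phi>(1), of x] x \<phi>(2)[OF w(1)] w(2) qw
    by (simp add: sym_group_simps)
qed

section \<open>Residual finiteness implies stability\<close>

text \<open>The fixed points of the image of \<open>inv v \<otimes> w\<close> are the points where
  the images of \<open>v\<close> and \<open>w\<close> agree, so the defining condition need only be
  applied to this one word.\<close>

lemma strong_poly_approx_compare:
  fixes G :: "('a, 'b) monoid_scheme"
  assumes G: "group G" and m: "m \<ge> 1" and f: "strong_poly_approx s G \<delta> m f"
    and vw: "v \<in> carrier (F_grp G)" "w \<in> carrier (F_grp G)"
    and len: "real (length (inv\<^bsub>F_grp G\<^esub> v \<otimes>\<^bsub>F_grp G\<^esub> w)) < 1 / \<delta>"
  shows "pol_class s G v = pol_class s G w \<Longrightarrow>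
      real (card {i \<in> {1..m}. free_lift (sym_group m) f w i \<noteq> free_lift (sym_group m) f v i}) < \<delta> * real m"
    and "pol_class s G v \<noteq> pol_class s G w \<Longrightarrow>
      real (card {i \<in> {1..m}. free_lift (sym_group m) f w i = free_lift (sym_group m) f v i}) < \<delta> * real m"
proof -
  let ?f = "free_lift (sym_group m) f" and ?u = "inv\<^bsub>F_grp G\<^esub> v \<otimes>\<^bsub>F_grp G\<^esub> w"
  have unital: "unital_map G (sym_group m) f" using f by (simp add: strong_poly_approx_def)
  interpret F: group "F_grp G" by (rule F_grp_group)
  interpret h: group_hom "F_grp G" "sym_group m" ?f
    using unital_map_lift(1)[OF sym_group_is_group unital] F_grp_group sym_group_is_group
    by (simp add: group_hom_def group_hom_axioms_def)
  have u: "?u \<in> carrier (F_grp G)" using vw by simp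
  have pv: "?f v permutes {1..m}" using h.hom_closed[OF vw(1)] by (simp add: sym_group_simps)
  have "?f ?u i = inv' (?f v) (?f w i)" for i
    using vw pv by (simp add: sym_group_simps)
  then have eq: "?f ?u i = i \<longleftrightarrow> ?f w i = ?f v i" for i
    using permutes_inv_eq[OF pv, of "?f w i" i] by auto
  have "pol_class s G v = pol_class s G w \<longleftrightarrow> ?u \<in> R_sub s G"
    using G vw by (rule pol_class_eq_iff)
  then show "pol_class s G v = pol_class s G w \<Longrightarrow>
      real (card {i \<in> {1..m}. ?f w i \<noteq> ?f v i}) < \<delta> * real m"
    and "pol_class s G v \<noteq> pol_class s G w \<Longrightarrow>
      real (card {i \<in> {1..m}. ?f w i = ?f v i}) < \<delta> * real m"
    using f[unfolded strong_poly_approx_iff[OF m unital], rule_format, OF u len] by (simp_all add: eq)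
qed

lemma hom_permutation_action:
  assumes "\<And>g. g \<in> carrier G \<Longrightarrow> \<Phi> g permutes {1..m}"
    and "\<And>g h. g \<in> carrier G \<Longrightarrow> h \<in> carrier G \<Longrightarrow> \<Phi> (g \<otimes>\<^bsub>G\<^esub> h) = \<Phi> g \<circ> \<Phi> h"
  shows "\<Phi> \<in> hom G (sym_group m)"
  using assms by (auto simp: hom_def sym_group_simps)

text \<open>Needed because tiles can only be dropped freely when they are small compared with \<open>m\<close>.\<close>

lemma strong_poly_approx_exact:
  assumes G: "group G" and m: "m \<ge> 1" and f: "strong_poly_approx s G \<delta> m f"
    and small: "\<delta> * real m < 1"
    and len: "\<And>r. r \<in> relators s G \<Longrightarrow> real (length r) < 1 / \<delta>"
  shows "polynomial_map s G (sym_group m) f"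
proof -
  have unital: "unital_map G (sym_group m) f" using f by (simp add: strong_poly_approx_def)
  note lift = unital_map_lift[OF sym_group_is_group unital]
  have "free_lift (sym_group m) f r = \<one>\<^bsub>sym_group m\<^esub>" if r: "r \<in> relators s G" for r
  proof -
    have rF: "r \<in> carrier (F_grp G)" using r by (rule subsetD[OF relators_closed[OF G]])
    have "r \<in> R_sub s G" using r by (rule subsetD[OF relators_subset_R_sub])
    \<comment> \<open>Fewer than one moved point means none, so the relator acts trivially.\<close>
    then have "real (card {i \<in> {1..m}. free_lift (sym_group m) f r i \<noteq> i}) < 1"
      using f[unfolded strong_poly_approx_iff[OF m unital], rule_format, OF rF len[OF r]] small by linarith
    then have fixed: "\<forall>i\<in>{1..m}. free_lift (sym_group m) f r i = i" by simp
    have "free_lift (sym_group m) f r permutes {1..m}"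
      using lift(1) rF by (auto simp: hom_def sym_group_simps)
    then have "free_lift (sym_group m) f r i = i" for i
      using fixed permutes_not_in by metis
    then show ?thesis by (simp add: sym_group_simps fun_eq_iff)
  qed
  then show ?thesis
    using polynomial_map_iff_relators[OF G sym_group_is_group lift(1), of f s] lift(2) by simp
qed

lemma MAX_hamming_less:
  assumes "finite (carrier G)" "carrier G \<noteq> {}" "m \<ge> 1"
    and "\<And>g. g \<in> carrier G \<Longrightarrow> f g permutes {1..m}" "\<And>g. g \<in> carrier G \<Longrightarrow> q g permutes {1..m}"
    and "\<And>g. g \<in> carrier G \<Longrightarrow> real (card {i \<in> {1..m}. f g i \<noteq> q g i}) < \<epsilon> * real m"
  shows "(MAX g \<in> carrier G. hamming m (f g) (q g)) < \<epsilon>"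
proof -
  have "hamming m (f g) (q g) < \<epsilon>" if "g \<in> carrier G" for g
    using assms(3,6) that by (simp add: hamming_eq[OF assms(4,5)[OF that] assms(3)] field_simps)
  then show ?thesis using assms(1,2) by (subst Max_less_iff) auto
qed

theorem residually_finite_imp_weakly_P_stable:
  fixes G :: "('a, 'b) monoid_scheme"
  assumes G: "group G" "finite (carrier G)" and am: "amenable (Pol s G)"
    and rf: "residually_finite (Pol s G)"
  shows "weakly_P_stable s G"
  unfolding weakly_P_stable_def
proof (intro allI impI)
  fix \<epsilon> :: real assume \<epsilon>: "0 < \<epsilon>"
  let ?\<Gamma> = "Pol s G"
  interpret G: group G by fact
  interpret F: group "F_grp G" by (rule F_grp_group)
  interpret P: group "?\<Gamma>" using G(1) by (rule Pol_group)
  interpret h: group_hom "F_grp G" ?\<Gamma> "pol_class s G"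
    using pol_class_hom[OF G(1)] F_grp_group by (simp add: group_hom_def group_hom_axioms_def P.is_group)
  define \<gamma> where "\<gamma> g = pol_class s G (iota G g)" for g
  have iF: "iota G g \<in> carrier (F_grp G)" if "g \<in> carrier G" for g
    using funcset_mem[OF iota_closed that] .
  have \<gamma>: "\<gamma> g \<in> carrier ?\<Gamma>" if "g \<in> carrier G" for g
    using h.hom_closed[OF iF[OF that]] by (simp add: \<gamma>_def)
  define K where "K = \<gamma> ` carrier G"
  have K: "finite K" "K \<subseteq> carrier ?\<Gamma>" using G(2) \<gamma> by (auto simp: K_def)
  \<comment> \<open>The final error is at most \<open>7 * e\<close>: \<open>e\<close> for passing
    from \<open>f\<close> to representatives, \<open>2 * e\<close> for uncovered points,
    \<open>3 * e\<close> for overlaps and dropped tiles, and \<open>e\<close> for boundaries of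
    shapes.\<close>
  define e where "e = min (\<epsilon> / 8) (1 / 4)"
  have e: "0 < e" "e < 1 / 2" "7 * e < \<epsilon>" using \<epsilon> by (auto simp: e_def)
  obtain n where n: "(1 - e) ^ n < e" using real_arch_pow_inv[of e "1 - e"] e by auto
  have "\<forall>K e. finite K \<and> K \<subseteq> carrier ?\<Gamma> \<and> e > 0 \<longrightarrow>
      (\<exists>T\<in>finite_quotient_transversals ?\<Gamma>. folner ?\<Gamma> K e T)"
    using P.folner_transversal[OF rf am] by blast
  from quasi_tiling[where n = n, OF P.is_group this e(1,2,1) K e(1)]
  obtain \<T> W\<^sub>0 \<delta>\<^sub>0 where \<T>: "finite \<T>" "\<T> \<subseteq> finite_quotient_transversals ?\<Gamma>" "\<forall>T\<in>\<T>. folner ?\<Gamma> K e T"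
    and W0: "finite W\<^sub>0" "W\<^sub>0 \<subseteq> carrier ?\<Gamma>" and \<delta>0: "0 < \<delta>\<^sub>0"
    and tile: "\<forall>W X (a :: _ \<Rightarrow> nat \<Rightarrow> nat). W\<^sub>0 \<subseteq> W \<and> approx_action ?\<Gamma> W \<delta>\<^sub>0 X a \<longrightarrow>
        (\<exists>I. tiling ?\<Gamma> a W X \<T> e I \<and> real (card (X - covered a I)) \<le> ((1 - e) ^ n + e) * real (card X))"
    by (elim exE conjE) (rule that)
  have \<T>fin: "finite T" "T \<subseteq> carrier ?\<Gamma>" if "T \<in> \<T>" for T using \<T>(3) that by (auto simp: folner_def)
  \<comment> \<open>Beyond what the quasi-tiling asks for, goodness is needed for the generators in
    \<open>K\<close> and on the shapes, where the approximate and the genuine action get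
    compared.\<close>
  define W where "W = W\<^sub>0 \<union> K \<union> \<Union>\<T>"
  have W: "finite W" "W \<subseteq> carrier ?\<Gamma>"
    unfolding W_def using W0 K \<T>(1) \<T>fin by (simp, intro Un_least Sup_least)
  define L where "L = (\<Sum>T\<in>\<T>. card T)"
  have L: "card T \<le> L" if "T \<in> \<T>" for T unfolding L_def using \<T>(1) that by (intro member_le_sum) auto
  have "\<forall>X\<in>carrier ?\<Gamma>. \<exists>w. w \<in> carrier (F_grp G) \<and> pol_class s G w = X" using pol_class_surj by blast
  from bchoice[OF this] obtain rep where rep: "\<And>X. X \<in> carrier ?\<Gamma> \<Longrightarrow> rep X \<in> carrier (F_grp G)"
    "\<And>X. X \<in> carrier ?\<Gamma> \<Longrightarrow> pol_class s G (rep X) = X" by blast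
  \<comment> \<open>The only words on which the approximation is tested: they control, in turn,
    multiplicativity on \<open>W\<close>, freeness on \<open>W\<close>, agreement with
    \<open>f\<close> on generators, and exactness for small \<open>m\<close>.\<close>
  define \<Omega> where "\<Omega> =
    (\<lambda>(X, Y). inv\<^bsub>F_grp G\<^esub> rep (X \<otimes>\<^bsub>?\<Gamma>\<^esub> Y) \<otimes>\<^bsub>F_grp G\<^esub> (rep X \<otimes>\<^bsub>F_grp G\<^esub> rep Y)) ` (W \<times> W) \<union>
    (\<lambda>(X, Y). inv\<^bsub>F_grp G\<^esub> rep X \<otimes>\<^bsub>F_grp G\<^esub> rep Y) ` (W \<times> W) \<union>
    (\<lambda>g. inv\<^bsub>F_grp G\<^esub> rep (\<gamma> g) \<otimes>\<^bsub>F_grp G\<^esub> iota G g) ` carrier G \<union> relators s G"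
  have fin\<Omega>: "finite \<Omega>" unfolding \<Omega>_def using W(1) G(2) finite_relators[OF G(2)] by simp
  have relators\<Omega>: "relators s G \<subseteq> \<Omega>" unfolding \<Omega>_def by (rule Un_upper2)
  define N where "N = (\<Sum>w\<in>\<Omega>. length w)"
  have N: "length w \<le> N" if "w \<in> \<Omega>" for w unfolding N_def using fin\<Omega> that by (intro member_le_sum) auto
  \<comment> \<open>The entries serve, in this order, closeness on generators, the density of bad
    points over all pairs from \<open>W\<close>, the inequality \<open>\<delta> * m < 1\<close> when
    \<open>m\<close> is small, and the length of the words in \<open>\<Omega>\<close>.\<close>
  define \<delta> where "\<delta> = Min {e, \<delta>\<^sub>0 / (2 * (real (card W))\<^sup>2 + 1), e / (real L + 1), 1 / (real N + 1)}"
  have \<delta>_le: "\<delta> \<le> e" "\<delta> \<le> \<delta>\<^sub>0 / (2 * (real (card W))\<^sup>2 + 1)" "\<delta> \<le> e / (real L + 1)" "\<delta> \<le> 1 / (real N + 1)"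
    unfolding \<delta>_def by (rule Min_le; simp)+
  have "0 < 2 * (real (card W))\<^sup>2 + 1" by (simp add: add_nonneg_pos)
  then have \<delta>: "0 < \<delta>" using e \<delta>0 by (simp add: \<delta>_def add_nonneg_pos)
  have len: "real (length w) < 1 / \<delta>" if "w \<in> \<Omega>" for w
  proof -
    have "real (length w) < real N + 1" using N[OF that] by simp
    also have "\<dots> \<le> 1 / \<delta>" using \<delta> \<delta>_le(4) by (simp add: field_simps)
    finally show ?thesis .
  qed
  have "\<exists>q. unital_map G (sym_group m) q \<and> polynomial_map s G (sym_group m) q \<and>
      (MAX g \<in> carrier G. hamming m (f g) (q g)) < \<epsilon>"
    if m: "m \<ge> 1" and f: "strong_poly_approx s G \<delta> m f" for m f
  proof -
    let ?f = "free_lift (sym_group m) f" and ?X = "{1..m}"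
    have unital: "unital_map G (sym_group m) f" using f by (simp add: strong_poly_approx_def)
    have fperm: "f g permutes ?X" if "g \<in> carrier G" for g
      using unital that by (auto simp: unital_map_def sym_group_simps Pi_iff)
    note lift = unital_map_lift[OF sym_group_is_group unital]
    interpret f: group_hom "F_grp G" "sym_group m" ?f
      using lift(1) F_grp_group sym_group_is_group by (simp add: group_hom_def group_hom_axioms_def)
    have mpos: "0 < real m" using m by simp
    show ?thesis
    proof (cases "real L \<le> e * real m")
      case False
      have "\<delta> * real m \<le> e / (real L + 1) * real m" using \<delta>_le(3) by (intro mult_right_mono) auto
      also have "\<dots> < 1" using False by (simp add: divide_less_eq add_nonneg_pos)
      finally have "polynomial_map s G (sym_group m) f"
        using len[OF subsetD[OF relators\<Omega>]] by (intro strong_poly_approx_exact[OF G(1) m f])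
      moreover have "(MAX g \<in> carrier G. hamming m (f g) (f g)) < \<epsilon>"
        using G(2) m fperm \<epsilon> by (intro MAX_hamming_less) auto
      ultimately show ?thesis using unital by blast
    next
      case True
      \<comment> \<open>\<open>rep\<close> is a mere choice of words, so \<open>a\<close> is
        multiplicative only up to the defects recorded in \<open>\<Omega>\<close>; still every
        \<open>a X\<close> is a genuine permutation.\<close>
      define a where "a X = ?f (rep X)" for X
      have aperm: "a X permutes ?X" if "X \<in> carrier ?\<Gamma>" for X
        using f.hom_closed[OF rep(1)[OF that]] by (simp add: a_def sym_group_simps)
      have mult: "real (card {i \<in> ?X. a X (a Y i) \<noteq> a (X \<otimes>\<^bsub>?\<Gamma>\<^esub> Y) i}) \<le> \<delta> * real m"
        if XY: "X \<in> W" "Y \<in> W" for X Y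
      proof -
        have c: "X \<in> carrier ?\<Gamma>" "Y \<in> carrier ?\<Gamma>" "X \<otimes>\<^bsub>?\<Gamma>\<^esub> Y \<in> carrier ?\<Gamma>" using XY W(2) by auto
        note r = rep(1)[OF c(1)] rep(1)[OF c(2)] rep(1)[OF c(3)]
        have "inv\<^bsub>F_grp G\<^esub> rep (X \<otimes>\<^bsub>?\<Gamma>\<^esub> Y) \<otimes>\<^bsub>F_grp G\<^esub> (rep X \<otimes>\<^bsub>F_grp G\<^esub> rep Y) \<in> \<Omega>"
          using XY by (auto simp: \<Omega>_def)
        from len[OF this] have "real (card {i \<in> ?X. ?f (rep X \<otimes>\<^bsub>F_grp G\<^esub> rep Y) i \<noteq> ?f (rep (X \<otimes>\<^bsub>?\<Gamma>\<^esub> Y)) i}) < \<delta> * real m"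
          using r c rep(2) by (intro strong_poly_approx_compare(1)[OF G(1) m f]) simp_all
        moreover have "?f (rep X \<otimes>\<^bsub>F_grp G\<^esub> rep Y) = a X \<circ> a Y" using r by (simp add: a_def sym_group_simps)
        ultimately show ?thesis by (simp add: a_def)
      qed
      have sep: "real (card {i \<in> ?X. a Y i = a X i}) \<le> \<delta> * real m"
        if XY: "X \<in> W" "Y \<in> W" "X \<noteq> Y" for X Y
      proof -
        have c: "X \<in> carrier ?\<Gamma>" "Y \<in> carrier ?\<Gamma>" using XY W(2) by auto
        have "inv\<^bsub>F_grp G\<^esub> rep X \<otimes>\<^bsub>F_grp G\<^esub> rep Y \<in> \<Omega>" using XY by (auto simp: \<Omega>_def)
        from len[OF this] show ?thesis
          unfolding a_def using rep c XY(3)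
          by (intro less_imp_le strong_poly_approx_compare(2)[OF G(1) m f]) simp_all
      qed
      have gen: "real (card {i \<in> ?X. f g i \<noteq> a (\<gamma> g) i}) \<le> \<delta> * real m" if g: "g \<in> carrier G" for g
      proof -
        have "inv\<^bsub>F_grp G\<^esub> rep (\<gamma> g) \<otimes>\<^bsub>F_grp G\<^esub> iota G g \<in> \<Omega>" using g by (auto simp: \<Omega>_def)
        from len[OF this]
        have "real (card {i \<in> ?X. ?f (iota G g) i \<noteq> ?f (rep (\<gamma> g)) i}) < \<delta> * real m"
          using rep \<gamma>[OF g] iF[OF g]
          by (intro strong_poly_approx_compare(1)[OF G(1) m f]) (simp_all add: \<gamma>_def)
        then show ?thesis using lift(2)[OF g] by (simp add: a_def)
      qed
      \<comment> \<open>For each pair the multiplicative defect and the coincidence of distinct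
        elements each have density at most \<open>\<delta>\<close>.\<close>
      define bad where "bad p = {i \<in> ?X. a (fst p) (a (snd p) i) \<noteq> a (fst p \<otimes>\<^bsub>?\<Gamma>\<^esub> snd p) i} \<union>
          {i \<in> ?X. fst p \<noteq> snd p \<and> a (snd p) i = a (fst p) i}" for p
      have "real (card {i \<in> ?X. \<not> good_point ?\<Gamma> a W i}) \<le> \<delta>\<^sub>0 * real (card ?X)"
      proof -
        have badp: "real (card (bad p)) \<le> 2 * \<delta> * real m" if p: "p \<in> W \<times> W" for p
        proof -
          have "real (card {i \<in> ?X. fst p \<noteq> snd p \<and> a (snd p) i = a (fst p) i}) \<le> \<delta> * real m"
            using sep[of "fst p" "snd p"] p \<delta> mpos by (cases "fst p = snd p") auto
          moreover have "real (card {i \<in> ?X. a (fst p) (a (snd p) i) \<noteq> a (fst p \<otimes>\<^bsub>?\<Gamma>\<^esub> snd p) i}) \<le> \<delta> * real m"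
            using mult p by auto
          moreover have "card (bad p) \<le> card {i \<in> ?X. a (fst p) (a (snd p) i) \<noteq> a (fst p \<otimes>\<^bsub>?\<Gamma>\<^esub> snd p) i} +
              card {i \<in> ?X. fst p \<noteq> snd p \<and> a (snd p) i = a (fst p) i}"
            unfolding bad_def by (rule card_Un_le)
          ultimately show ?thesis by linarith
        qed
        have "{i \<in> ?X. \<not> good_point ?\<Gamma> a W i} \<subseteq> (\<Union>p\<in>W \<times> W. bad p)"
          by (fastforce simp: good_point_def bad_def)
        then have "card {i \<in> ?X. \<not> good_point ?\<Gamma> a W i} \<le> card (\<Union>p\<in>W \<times> W. bad p)"
          using W(1) by (intro card_mono) (auto simp: bad_def)
        moreover have "real (card (\<Union>p\<in>W \<times> W. bad p)) \<le> 2 * \<delta> * real m * (\<Sum>p\<in>W \<times> W. 1)"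
          using W(1) badp by (intro card_UN_le_weighted) (auto simp: bad_def)
        ultimately have "real (card {i \<in> ?X. \<not> good_point ?\<Gamma> a W i}) \<le> (2 * (real (card W))\<^sup>2 * \<delta>) * real m"
          by (simp add: card_cartesian_product power2_eq_square mult_ac)
        also have "\<dots> \<le> \<delta>\<^sub>0 * real m"
        proof (rule mult_right_mono)
          have "2 * (real (card W))\<^sup>2 * \<delta> \<le> (2 * (real (card W))\<^sup>2 + 1) * \<delta>" using \<delta> by (simp add: algebra_simps)
          also have "\<dots> \<le> \<delta>\<^sub>0"
            using \<delta>_le(2) \<open>0 < 2 * (real (card W))\<^sup>2 + 1\<close> by (simp add: pos_le_divide_eq mult.commute)
          finally show "2 * (real (card W))\<^sup>2 * \<delta> \<le> \<delta>\<^sub>0" .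
        qed simp
        finally show ?thesis by simp
      qed
      moreover have abij: "bij_betw (a X) ?X ?X" if "X \<in> carrier ?\<Gamma>" for X
        using aperm[OF that] by (rule permutes_imp_bij)
      ultimately have "approx_action ?\<Gamma> W \<delta>\<^sub>0 ?X a" by (simp add: approx_action_def)
      then obtain I where I: "tiling ?\<Gamma> a W ?X \<T> e I"
        and uncov: "real (card (?X - covered a I)) \<le> ((1 - e) ^ n + e) * real (card ?X)"
        using tile[rule_format, of W ?X a] by (auto simp: W_def)
      have uncov': "real (card (?X - covered a I)) \<le> 2 * e * real (card ?X)"
        using uncov n by (elim order_trans) (intro mult_right_mono, auto)
      have "\<exists>\<Phi>. (\<forall>X\<in>carrier ?\<Gamma>. \<Phi> X permutes ?X) \<and>
         (\<forall>X\<in>carrier ?\<Gamma>. \<forall>Y\<in>carrier ?\<Gamma>. \<Phi> (X \<otimes>\<^bsub>?\<Gamma>\<^esub> Y) = \<Phi> X \<circ> \<Phi> Y) \<and>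
         (\<forall>X\<in>K. real (card {x \<in> ?X. \<Phi> X x \<noteq> a X x}) \<le> (2 * e + 3 * e + e) * real (card ?X))"
        by (rule tiling_imp_action[OF P.is_group I _ abij \<T>(2) \<T>(3)[rule_format] L _ K _ _ _ _ _ uncov'])
           (use True e in \<open>auto simp: W_def\<close>)
      then obtain \<Phi> where \<Phi>: "\<And>X. X \<in> carrier ?\<Gamma> \<Longrightarrow> \<Phi> X permutes ?X"
        "\<And>X Y. X \<in> carrier ?\<Gamma> \<Longrightarrow> Y \<in> carrier ?\<Gamma> \<Longrightarrow> \<Phi> (X \<otimes>\<^bsub>?\<Gamma>\<^esub> Y) = \<Phi> X \<circ> \<Phi> Y"
        "\<And>X. X \<in> K \<Longrightarrow> real (card {x \<in> ?X. \<Phi> X x \<noteq> a X x}) \<le> (2 * e + 3 * e + e) * real (card ?X)" by blast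
      have \<Phi>hom: "\<Phi> \<in> hom ?\<Gamma> (sym_group m)" using \<Phi>(1,2) by (rule hom_permutation_action)
      define q where "q g = \<Phi> (\<gamma> g)" for g
      have \<Phi>one: "\<Phi> \<one>\<^bsub>?\<Gamma>\<^esub> = \<one>\<^bsub>sym_group m\<^esub>" by (rule hom_one[OF \<Phi>hom P.is_group sym_group_is_group])
      have "\<gamma> \<one>\<^bsub>G\<^esub> = \<one>\<^bsub>?\<Gamma>\<^esub>" using h.hom_one by (simp add: \<gamma>_def iota_def F_grp_def free_group_def)
      then have "unital_map G (sym_group m) q"
        using \<Phi>one \<Phi>(1) \<gamma> by (auto simp: unital_map_def q_def sym_group_simps)
      moreover have "polynomial_map s G (sym_group m) q"
      proof -
        have hom: "\<Phi> \<circ> pol_class s G \<in> hom (F_grp G) (sym_group m)"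
          using hom_compose[OF h.homh \<Phi>hom] .
        have "(\<Phi> \<circ> pol_class s G) r = \<one>\<^bsub>sym_group m\<^esub>" if r: "r \<in> relators s G" for r
        proof -
          have "r \<in> R_sub s G" using r by (rule subsetD[OF relators_subset_R_sub])
          moreover have "r \<in> carrier (F_grp G)" using r by (rule subsetD[OF relators_closed[OF G(1)]])
          ultimately have "pol_class s G r = \<one>\<^bsub>?\<Gamma>\<^esub>" by (simp add: pol_class_eq_one[OF G(1)])
          then show ?thesis using \<Phi>one by simp
        qed
        then show ?thesis
          using polynomial_map_iff_relators[OF G(1) sym_group_is_group hom, of q s] by (simp add: q_def \<gamma>_def)
      qed
      moreover have "(MAX g \<in> carrier G. hamming m (f g) (q g)) < \<epsilon>"
      proof (rule MAX_hamming_less[OF G(2) _ m fperm])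
        fix g assume g: "g \<in> carrier G"
        show "q g permutes ?X" using \<Phi>(1) \<gamma>[OF g] by (simp add: q_def)
        have "{i \<in> ?X. f g i \<noteq> q g i} \<subseteq> {i \<in> ?X. f g i \<noteq> a (\<gamma> g) i} \<union> {i \<in> ?X. \<Phi> (\<gamma> g) i \<noteq> a (\<gamma> g) i}"
          by (auto simp: q_def)
        then have "card {i \<in> ?X. f g i \<noteq> q g i} \<le>
            card {i \<in> ?X. f g i \<noteq> a (\<gamma> g) i} + card {i \<in> ?X. \<Phi> (\<gamma> g) i \<noteq> a (\<gamma> g) i}"
          by (intro order_trans[OF card_mono card_Un_le]) auto
        moreover have "real (card {i \<in> ?X. \<Phi> (\<gamma> g) i \<noteq> a (\<gamma> g) i}) \<le> 6 * e * real m"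
          using \<Phi>(3)[of "\<gamma> g"] g by (simp add: K_def)
        ultimately have "real (card {i \<in> ?X. f g i \<noteq> q g i}) \<le> \<delta> * real m + 6 * e * real m"
          using gen[OF g] by linarith
        also have "\<dots> \<le> 7 * e * real m" using \<delta>_le(1) mpos by (simp add: algebra_simps)
        also have "\<dots> < \<epsilon> * real m" using e(3) mpos by simp
        finally show "real (card {i \<in> ?X. f g i \<noteq> q g i}) < \<epsilon> * real m" .
      qed auto
      ultimately show ?thesis by blast
    qed
  qed
  then show "\<exists>\<delta>>0. \<forall>m\<ge>1. \<forall>f. strong_poly_approx s G \<delta> m f \<longrightarrow>
        (\<exists>q. unital_map G (sym_group m) q \<and> polynomial_map s G (sym_group m) q \<and>
             (MAX g \<in> carrier G. hamming m (f g) (q g)) < \<epsilon>)"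
    using \<delta> by blast
qed

theorem corollary6p4:
  fixes G :: "('a, 'b) monoid_scheme" and s :: nat
  assumes "group G" and "finite (carrier G)" and "s \<ge> 1"
    and "amenable (Pol s G)"
  shows "weakly_P_stable s G \<longleftrightarrow> residually_finite (Pol s G)"
  using weakly_P_stable_imp_residually_finite residually_finite_imp_weakly_P_stable assms by blast

end
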